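(* Let $\sigma\subset N_{\mathbb R}$ be a strongly convex rational polyhedral cone with $\dim\sigma=\dim N_{\mathbb R}$, let $R\in M$ be arbitrary, and let $\sigma(-R)=Q_0+Q_1+\cdots+Q_k$ be a Minkowski sum decomposition of the polyhedron $\sigma(-R)=\sigma\cap\{n\mid\langle R,n\rangle=1\}$ such that (a) for every vertex $q$ of $\sigma(-R)$ the induced decomposition $q=q_0+\cdots+q_k$ ($q_i$ a vertex of $Q_i$) has at most one summand not in $N$; (b) $Q_0\subset\{n\in N_{\mathbb R}\mid\langle R,n\rangle=1\}$ and $Q_i\subset\{n\in N_{\mathbb R}\mid\langle R,n\rangle=0\}$ for $i=1,\dots,k$. Let $\tilde\sigma=\langle\sigma,Q_0-e_1-\cdots-e_k,Q_1+e_1,\dots,Q_k+e_k\rangle\subset\tilde N_{\mathbb R}$, $\tau=\sigma\cap\{n\in N_{\mathbb R}\mid\langle R,n\rangle\ge0\}$, $\tilde\tau=\langle\tau,Q_0-e_1-\cdots-e_k,Q_1+e_1,\dots,Q_k+e_k\rangle$, and $$B=\mathbb C[\tilde\sigma^\vee\cap\tilde M]\big[\chi^{R+e_1^*}-\chi^R,\dots,\chi^{R+e_k^*}-\chi^R\big]\subseteq\mathbb C[\tilde\tau^\vee\cap\tilde M].$$ Then there is a natural ring isomorphism $$\big(\mathbb C[x_\xi\mid\xi\in\tilde\sigma(1)]\otimes\mathbb C[\lambda_1,\dots,\lambda_k]/I_\lambda\big)^{G(\tilde\sigma)}\simeq B,$$ where the ideal $I_\lambda$ is generated by $$(x^{R+e_i^*}-x^R-\lambda_i)\prod_{\langle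 R,v_\xi\rangle<0}x_\xi^{-\langle R,v_\xi\rangle},\qquad i=1,\dots,k.$$
   Context: $N$ is a lattice, $M=\mathrm{Hom}(N,\mathbb Z)$, $\tilde N=N\oplus\mathbb Z^k$ with standard basis $e_1,\dots,e_k$ of $\mathbb Z^k$, $\tilde M=M\oplus\mathbb Z^k$ with dual basis $e_1^*,\dots,e_k^*$. $\langle\cdots\rangle$ applied to sets denotes the convex cone they generate. All summands $Q_i$ have the same recession cone as $\sigma(-R)$, namely $\sigma\cap R^\perp$. $\chi^u$ denotes the element of a semigroup ring corresponding to the lattice point $u$. $\tilde\sigma(1)$ is the set of edges of $\tilde\sigma$, $v_\xi$ the primitive lattice generator of $\xi\in\tilde\sigma(1)$, and $x^u:=\prod_{\xi\in\tilde\sigma(1)}x_\xi^{\langle u,v_\xi\rangle}$ for $u\in\tilde M$. The group $G(\tilde\sigma)=\{(\mu_\xi)\in(\mathbb C^* )^{\tilde\sigma(1)}\mid\prod_\xi\mu_\xi^{\langle u,v_\xi\rangle}=1\ \forall u\in\tilde M\}$ acts diagonally on the $x_\xi$ and trivially on the $\lambda_i$; one has the standard isomorphism $\mathbb C[\tilde\sigma^\vee\cap\tilde M]\simeq\mathbb C[x_\xi\mid\xi\in\tilde\sigma(1)]^{G(\tilde\sigma)}$, $\chi^u\mapsto x^u$. "Natural" refers to compatibility with this isomorphism and with $\lambda_i\leftrightarrow\chi^{R+e_i^*}-\chi^R$. *)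

theory Defs
  imports
    "HOL-Analysis.Analysis"
    "HOL-Library.Poly_Mapping"
    "HOL-Algebra.QuotRing"
    "HOL-Algebra.Generated_Rings"
begin

section \<open>Lattices and cones\<close>

text \<open>
  After a choice of basis, the lattice \<open>N\<close> is \<open>int ^ 'n\<close> and \<open>N\<^sub>\<real>\<close> is \<open>real ^ 'n\<close>; its dual \<open>M\<close> is
  again \<open>int ^ 'n\<close> by means of the dual basis, so that the pairing is the dot product. Accordingly
  the lattices \<open>N \<oplus> \<int>\<^sup>k\<close> and \<open>M \<oplus> \<int>\<^sup>k\<close> are both \<open>int ^ 'n \<times> int ^ 'k\<close>, with \<open>k = CARD('k)\<close>.
\<close>

definition real_vec :: "int ^ 'n \<Rightarrow> real ^ 'n" where
  "real_vec v = (\<chi> i. real_of_int (v $ i))"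

type_synonym ('n, 'k) lat = "(int ^ 'n) \<times> (int ^ 'k)"
type_synonym ('n, 'k) latR = "(real ^ 'n) \<times> (real ^ 'k)"

definition real_pt :: "('n::finite, 'k::finite) lat \<Rightarrow> ('n, 'k) latR" where
  "real_pt v = (real_vec (fst v), real_vec (snd v))"

definition pairing :: "('n::finite, 'k::finite) lat \<Rightarrow> ('n, 'k) lat \<Rightarrow> int" where
  "pairing u v = (\<Sum>i\<in>UNIV. fst u $ i * fst v $ i) + (\<Sum>j\<in>UNIV. snd u $ j * snd v $ j)"

definition rational_polyhedral_cone :: "(real ^ 'n) set \<Rightarrow> bool" where
  "rational_polyhedral_cone \<sigma> \<longleftrightarrow>
     (\<exists>S :: (int ^ 'n) set. finite S \<and> \<sigma> = convex_cone hull (real_vec ` S))"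

definition strongly_convex :: "'a::real_vector set \<Rightarrow> bool" where
  "strongly_convex \<sigma> \<longleftrightarrow> \<sigma> \<inter> uminus ` \<sigma> = {0}"

definition recession_cone :: "'a::real_vector set \<Rightarrow> 'a set" where
  "recession_cone P = {v. \<forall>x\<in>P. \<forall>t\<ge>0. x + t *\<^sub>R v \<in> P}"

definition slice :: "(real ^ 'n) set \<Rightarrow> int ^ 'n \<Rightarrow> (real ^ 'n) set" where
  "slice \<sigma> R = \<sigma> \<inter> {n. real_vec R \<bullet> n = 1}"

text \<open>
  The summands \<open>Q\<^sub>0, \<dots>, Q\<^sub>k\<close> are indexed by \<open>'k option\<close>: \<open>Q None\<close> is \<open>Q\<^sub>0\<close>, and \<open>Q (Some i)\<close> for
  \<open>i :: 'k\<close> are the remaining ones. Their sum is the Minkowski sum of \<^theory>\<open>HOL-Library.Set_Algebras\<close>.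
\<close>

definition minkowski_decomposition :: "(real ^ 'n) set \<Rightarrow> ('k::finite option \<Rightarrow> (real ^ 'n) set) \<Rightarrow> bool" where
  "minkowski_decomposition P Q \<longleftrightarrow>
     (\<forall>j. polyhedron (Q j) \<and> Q j \<noteq> {}) \<and> P = (\<Sum>j\<in>UNIV. Q j)"

definition at_most_one_nonlattice_vertex ::
    "(real ^ 'n) set \<Rightarrow> ('k::finite option \<Rightarrow> (real ^ 'n) set) \<Rightarrow> bool" where
  "at_most_one_nonlattice_vertex P Q \<longleftrightarrow>
     (\<forall>q qs. q extreme_point_of P \<and> (\<forall>j. qs j extreme_point_of Q j) \<and> q = (\<Sum>j\<in>UNIV. qs j)
        \<longrightarrow> card {j. qs j \<notin> range real_vec} \<le> 1)"

definition cayley_cone ::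
    "(real ^ 'n) set \<Rightarrow> ('k option \<Rightarrow> (real ^ 'n) set) \<Rightarrow> ('n::finite, 'k::finite) latR set" where
  "cayley_cone C Q = convex_cone hull
     ((\<lambda>n. (n, 0)) ` C \<union> (\<lambda>q. (q, - (\<Sum>i\<in>UNIV. axis i 1))) ` Q None
        \<union> (\<Union>i. (\<lambda>q. (q, axis i 1)) ` Q (Some i)))"

definition dual_lattice_points :: "('n::finite, 'k::finite) latR set \<Rightarrow> ('n, 'k) lat set" where
  "dual_lattice_points C = {u. \<forall>n\<in>C. real_pt u \<bullet> n \<ge> 0}"

definition rays :: "('n::finite, 'k::finite) latR set \<Rightarrow> ('n, 'k) latR set set" where
  "rays C = {\<xi>. \<xi> edge_of C}"

definition primitive :: "('n::finite, 'k::finite) lat \<Rightarrow> bool" where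
  "primitive v \<longleftrightarrow> (\<forall>d::int. (\<forall>i. d dvd fst v $ i) \<and> (\<forall>j. d dvd snd v $ j) \<longrightarrow> is_unit d)"

definition ray_generator :: "('n::finite, 'k::finite) latR set \<Rightarrow> ('n, 'k) lat" where
  "ray_generator \<xi> = (THE v. real_pt v \<in> \<xi> \<and> primitive v)"


section \<open>Semigroup rings and the Cox ring\<close>

text \<open>
  A type \<open>'s \<Rightarrow>\<^sub>0 complex\<close> over a commutative monoid \<open>'s\<close> is the semigroup ring of all of \<open>'s\<close>, with
  the convolution product. The semigroup ring of a submonoid \<open>S\<close> consists of the elements
  supported on \<open>S\<close>.
\<close>

definition semigroup_ring :: "'s::comm_monoid_add set \<Rightarrow> ('s \<Rightarrow>\<^sub>0 complex) ring" where
  "semigroup_ring S = \<lparr>carrier = {p. Poly_Mapping.keys p \<subseteq> S}, monoid.mult = (*), one = 1, zero = 0, add = (+)\<rparr>"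

abbreviation chi :: "'s \<Rightarrow> ('s \<Rightarrow>\<^sub>0 complex)" where
  "chi u \<equiv> Poly_Mapping.single u 1"

definition lat_of_M :: "int ^ 'n \<Rightarrow> ('n::finite, 'k::finite) lat" where
  "lat_of_M R = (R, 0)"

definition e_dual :: "'k \<Rightarrow> ('n::finite, 'k::finite) lat" where
  "e_dual i = (0, axis i 1)"

definition B_generator :: "int ^ 'n \<Rightarrow> 'k \<Rightarrow> (('n::finite, 'k::finite) lat \<Rightarrow>\<^sub>0 complex)" where
  "B_generator R i = chi (lat_of_M R + e_dual i) - chi (lat_of_M R)"

definition B_ring ::
    "('n::finite, 'k::finite) latR set \<Rightarrow> ('n, 'k) latR set \<Rightarrow> int ^ 'n \<Rightarrow> (('n, 'k) lat \<Rightarrow>\<^sub>0 complex) ring" where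
  "B_ring \<sigma>' \<tau>' R = (let A = semigroup_ring (dual_lattice_points \<tau>') in
     A\<lparr>carrier := generate_ring A
         (carrier (semigroup_ring (dual_lattice_points \<sigma>')) \<union> range (B_generator R))\<rparr>)"

text \<open>
  Monomials in the \<open>x\<^sub>\<xi>\<close> (Laurent) and the \<open>\<lambda>\<^sub>i\<close> (polynomial) are exponent pairs. The ring
  \<open>\<complex>[x\<^sub>\<xi>] \<otimes> \<complex>[\<lambda>\<^sub>1, \<dots>, \<lambda>\<^sub>k]\<close> is the semigroup ring of the pairs without negative exponents; the
  surrounding Laurent ring is only needed because \<open>x\<^sup>u\<close> may have negative exponents.
\<close>

type_synonym ('n, 'k) expo = "(('n, 'k) latR set \<Rightarrow>\<^sub>0 int) \<times> ('k \<Rightarrow>\<^sub>0 nat)"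
type_synonym ('n, 'k) cox = "('n, 'k) expo \<Rightarrow>\<^sub>0 complex"

definition cox_ring :: "('n::finite, 'k::finite) latR set \<Rightarrow> ('n, 'k) cox ring" where
  "cox_ring C = semigroup_ring {(a, b). Poly_Mapping.keys a \<subseteq> rays C \<and> (\<forall>\<xi>. Poly_Mapping.lookup a \<xi> \<ge> 0)}"

definition x_var :: "('n::finite, 'k::finite) latR set \<Rightarrow> ('n, 'k) cox" where
  "x_var \<xi> = chi (Poly_Mapping.single \<xi> 1, 0)"

definition lambda_var :: "'k \<Rightarrow> ('n::finite, 'k::finite) cox" where
  "lambda_var i = chi (0, Poly_Mapping.single i 1)"

definition x_monom :: "('n::finite, 'k::finite) latR set \<Rightarrow> ('n, 'k) lat \<Rightarrow> ('n, 'k) cox" where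
  "x_monom C u = chi ((\<Sum>\<xi>\<in>rays C. Poly_Mapping.single \<xi> (pairing u (ray_generator \<xi>))), 0)"

text \<open>The \<open>\<complex>\<close>-linear extension of \<open>\<chi>\<^sup>u \<mapsto> x\<^sup>u\<close>.\<close>

definition cox_hom :: "('n::finite, 'k::finite) latR set \<Rightarrow> (('n, 'k) lat \<Rightarrow>\<^sub>0 complex) \<Rightarrow> ('n, 'k) cox" where
  "cox_hom C p = (\<Sum>u\<in>Poly_Mapping.keys p. Poly_Mapping.single 0 (Poly_Mapping.lookup p u) * x_monom C u)"

definition I_generator :: "('n::finite, 'k::finite) latR set \<Rightarrow> int ^ 'n \<Rightarrow> 'k \<Rightarrow> ('n, 'k) cox" where
  "I_generator C R i =
     (x_monom C (lat_of_M R + e_dual i) - x_monom C (lat_of_M R) - lambda_var i)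
     * (\<Prod>\<xi>\<in>{\<xi>\<in>rays C. pairing (lat_of_M R) (ray_generator \<xi>) < 0}.
          x_var \<xi> ^ nat (- pairing (lat_of_M R) (ray_generator \<xi>)))"

definition I_lambda :: "('n::finite, 'k::finite) latR set \<Rightarrow> int ^ 'n \<Rightarrow> ('n, 'k) cox set" where
  "I_lambda C R = genideal (cox_ring C) (range (I_generator C R))"

definition cox_group :: "('n::finite, 'k::finite) latR set \<Rightarrow> (('n, 'k) latR set \<Rightarrow> complex) set" where
  "cox_group C = {\<mu> \<in> rays C \<rightarrow>\<^sub>E - {0}.
     \<forall>u. (\<Prod>\<xi>\<in>rays C. \<mu> \<xi> powi pairing u (ray_generator \<xi>)) = 1}"

definition cox_act :: "(('n::finite, 'k::finite) latR set \<Rightarrow> complex) \<Rightarrow> ('n, 'k) cox \<Rightarrow> ('n, 'k) cox" where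
  "cox_act \<mu> = Poly_Mapping.mapp
     (\<lambda>(a, b) c. (\<Prod>\<xi>\<in>Poly_Mapping.keys a. \<mu> \<xi> powi Poly_Mapping.lookup a \<xi>) * c)"

text \<open>The elements of the quotient ring are cosets, on which the group acts elementwise.\<close>

definition invariant_quotient :: "('n::finite, 'k::finite) latR set \<Rightarrow> int ^ 'n \<Rightarrow> ('n, 'k) cox set ring" where
  "invariant_quotient C R = (let A = cox_ring C Quot I_lambda C R in
     A\<lparr>carrier := {X \<in> carrier A. \<forall>\<mu>\<in>cox_group C. cox_act \<mu> ` X = X}\<rparr>)"

end

theory Submission
  imports Defs
begin

text \<open>
  Both sides are compared with the polynomial ring in the \<open>\<lambda>\<^sub>i\<close> over the semigroup ring of the lattice
  points \<open>D\<close> of the dual of \<open>\<sigma>'\<close>. Every class invariant under the group has a representative in the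
  degree zero part \<open>\<complex>[x\<^sup>u, \<lambda> | u \<in> D]\<close>, because a representative with the fewest monomials has no monomial
  on which some group element acts nontrivially. Substituting \<open>x\<^sup>R\<^sup>+\<^sup>e\<^sup>i - x\<^sup>R\<close> for \<open>\<lambda>\<^sub>i\<close> is a ring
  homomorphism that kills \<open>I\<^sub>\<lambda>\<close> and maps the degree zero part onto \<open>B\<close>.

  For its kernel, observe that \<open>I\<^sub>\<lambda>\<close> contains \<open>x\<^sup>u (x\<^sup>R\<^sup>+\<^sup>e\<^sup>i - x\<^sup>R - \<lambda>\<^sub>i)\<close> whenever \<open>u\<close> and \<open>u + R\<close> are in \<open>D\<close>.
  Grade by a functional \<open>ell\<close> that is nonnegative on \<open>D\<close>, vanishes on \<open>R\<close> and is \<open>1\<close> on every \<open>e\<^sub>i\<close>; then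
  \<open>x\<^sup>u \<lambda>\<^sup>b\<close> has leading exponent \<open>u + \<Sum> b\<^sub>i (R + e\<^sub>i)\<close>. Monomials with the same leading exponent agree modulo
  \<open>I\<^sub>\<lambda>\<close> and monomials of lower degree, so a system of representatives of the leading exponents spans the
  degree zero part modulo \<open>I\<^sub>\<lambda>\<close>, and its image is linearly independent.

  The condition on the vertices only serves to make \<open>\<sigma>'\<close> rational: a vertex of \<open>Q\<^sub>j\<close> is a summand
  of a vertex of the slice, which is rational, and all but one of the summands are lattice points.
\<close>

section \<open>Semigroup rings\<close>

text \<open>The obstacle is the monomial factor of the generators of \<open>I_lambda\<close>, called
  \<open>x^phi\<close> below, where \<open>phi\<close> is the negative part of the exponent of
  \<open>x^R\<close>. The relation \<open>x^(R+e_i) - x^R = \<lambda>_i\<close> becomes available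
  only after multiplication by monomials divisible by \<open>x^phi\<close>; in degree zero these are
  the \<open>x^u\<close> with both \<open>u\<close> and \<open>u + R\<close> in \<open>D\<close>. So
  the monomials with one leading exponent have to be connected by such restricted moves without
  leaving \<open>D\<close>. Here the Minkowski decomposition enters: splitting a point of the slice
  into points of the \<open>Q_j\<close> and adding up the inequalities that define \<open>D\<close>
  shows that \<open>u - R\<close> lies in \<open>D\<close> as soon as \<open>u\<close> and
  \<open>u + e_i\<close> do. The functional \<open>ell\<close> comes from choosing one point in each
  \<open>Q_i\<close> with \<open>i >= 1\<close>. Rationality and pointedness of
  \<open>\<sigma>'\<close> let its finitely many edges describe \<open>D\<close>, and the full
  dimension of \<open>\<sigma>\<close> lets \<open>x^u\<close> determine \<open>u\<close>.\<close>

lemma poly_mapping_sum_singles: "(\<Sum>k\<in>Poly_Mapping.keys p. Poly_Mapping.single k (Poly_Mapping.lookup p k)) = p"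
  by (rule poly_mapping_eqI)
    (auto simp: lookup_sum lookup_single when_def in_keys_iff sum.delta)

lemma poly_mapping_keys_induct [consumes 1, case_names zero single add]:
  fixes p :: "'s \<Rightarrow>\<^sub>0 'c::comm_monoid_add"
  assumes "Poly_Mapping.keys p \<subseteq> S" and "P 0"
    and "\<And>k c. k \<in> S \<Longrightarrow> P (Poly_Mapping.single k c)"
    and "\<And>p q. P p \<Longrightarrow> P q \<Longrightarrow> P (p + q)"
  shows "P p"
proof -
  have "P (\<Sum>k\<in>A. Poly_Mapping.single k (Poly_Mapping.lookup p k))" if "finite A" "A \<subseteq> S" for A
    using that by (induction A) (auto intro: assms)
  from this[of "Poly_Mapping.keys p"] show ?thesis
    using assms(1) by (simp add: poly_mapping_sum_singles)
qed

text \<open>Scalars act through the constants \<open>single 0 c\<close> of the target ring. The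
  substitutions, the embedding into the Cox ring and the group action below are all of this
  form.\<close>

definition linear_extension ::
    "('s::comm_monoid_add \<Rightarrow> ('t::comm_monoid_add \<Rightarrow>\<^sub>0 complex)) \<Rightarrow> ('s \<Rightarrow>\<^sub>0 complex) \<Rightarrow> ('t \<Rightarrow>\<^sub>0 complex)" where
  "linear_extension F p = (\<Sum>u\<in>Poly_Mapping.keys p. Poly_Mapping.single 0 (Poly_Mapping.lookup p u) * F u)"

lemma linear_extension_superset:
  assumes "finite A" "Poly_Mapping.keys p \<subseteq> A"
  shows "linear_extension F p = (\<Sum>u\<in>A. Poly_Mapping.single 0 (Poly_Mapping.lookup p u) * F u)"
  unfolding linear_extension_def
  by (rule sum.mono_neutral_left) (use assms in \<open>auto simp: in_keys_iff\<close>)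

lemma linear_extension_zero [simp]: "linear_extension F 0 = 0"
  by (simp add: linear_extension_def)

lemma linear_extension_single [simp]:
  "linear_extension F (Poly_Mapping.single u c) = Poly_Mapping.single 0 c * F u"
  by (simp add: linear_extension_def)

lemma linear_extension_add:
  "linear_extension F (p + q) = linear_extension F p + linear_extension F q"
proof -
  let ?A = "Poly_Mapping.keys p \<union> Poly_Mapping.keys q"
  have "Poly_Mapping.keys (p + q) \<subseteq> ?A" by (rule keys_add)
  then show ?thesis
    by (simp add: linear_extension_superset[of ?A] lookup_add single_add distrib_right sum.distrib)
qed

lemma linear_extension_uminus: "linear_extension F (- p) = - linear_extension F p"
  using linear_extension_add[of F p "- p"] by (simp add: eq_neg_iff_add_eq_0 add.commute)

lemma linear_extension_diff: "linear_extension F (p - q) = linear_extension F p - linear_extension F q"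
  using linear_extension_add[of F p "- q"] by (simp add: linear_extension_uminus)

text \<open>Both sides are biadditive in \<open>p\<close> and \<open>q\<close>, so monomials
  suffice.\<close>

lemma linear_extension_mult:
  assumes F: "\<And>x y. F (x + y) = F x * F y"
  shows "linear_extension F (p * q) = linear_extension F p * linear_extension F q"
proof (induction p rule: poly_mapping_keys_induct[OF subset_UNIV])
  case (2 k c)
  show ?case
  proof (induction q rule: poly_mapping_keys_induct[OF subset_UNIV])
    case (2 l d)
    have "Poly_Mapping.single 0 (c * d) * (F k * F l)
        = (Poly_Mapping.single 0 c * Poly_Mapping.single 0 d) * (F k * F l)"
      by (simp add: mult_single)
    then show ?case by (simp add: mult_single[of k] F mult_ac)
  qed (auto simp: distrib_left linear_extension_add)
qed (auto simp: distrib_right linear_extension_add)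

lemma lookup_linear_extension_inj:
  assumes "inj f"
  shows "Poly_Mapping.lookup (linear_extension (\<lambda>u. chi (f u)) p) (f u) = Poly_Mapping.lookup p u"
  using assms
  by (auto simp: linear_extension_def lookup_sum mult_single lookup_single when_def inj_eq in_keys_iff sum.delta)

lemma linear_extension_injective:
  assumes "inj f" "linear_extension (\<lambda>u. chi (f u)) p = linear_extension (\<lambda>u. chi (f u)) q"
  shows "p = q"
  by (rule poly_mapping_eqI) (metis assms lookup_linear_extension_inj)

lemma keys_linear_extension_chi:
  "Poly_Mapping.keys (linear_extension (\<lambda>u. chi (f u)) p) \<subseteq> f ` Poly_Mapping.keys p"
proof -
  have "Poly_Mapping.keys (linear_extension (\<lambda>u. chi (f u)) p)
      \<subseteq> (\<Union>u\<in>Poly_Mapping.keys p. Poly_Mapping.keys (Poly_Mapping.single (f u) (Poly_Mapping.lookup p u)))"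
    unfolding linear_extension_def by (rule order.trans[OF keys_sum]) (simp add: mult_single)
  then show ?thesis by auto
qed

lemma carrier_semigroup_ring: "carrier (semigroup_ring S) = {p. Poly_Mapping.keys p \<subseteq> S}"
  and mult_semigroup_ring: "(\<otimes>\<^bsub>semigroup_ring S\<^esub>) = (*)"
  and one_semigroup_ring: "\<one>\<^bsub>semigroup_ring S\<^esub> = 1"
  and zero_semigroup_ring: "\<zero>\<^bsub>semigroup_ring S\<^esub> = 0"
  and add_semigroup_ring: "(\<oplus>\<^bsub>semigroup_ring S\<^esub>) = (+)"
  by (simp_all add: semigroup_ring_def)

lemmas semigroup_ring_simps =
  carrier_semigroup_ring mult_semigroup_ring one_semigroup_ring zero_semigroup_ring add_semigroup_ring

lemma keys_mult_closed:
  assumes "\<And>a b. a \<in> S \<Longrightarrow> b \<in> T \<Longrightarrow> a + b \<in> U"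
    and "Poly_Mapping.keys p \<subseteq> S" "Poly_Mapping.keys q \<subseteq> T"
  shows "Poly_Mapping.keys (p * q) \<subseteq> U"
  using keys_mult[of p q] assms by blast

lemma keys_add_closed:
  "Poly_Mapping.keys p \<subseteq> S \<Longrightarrow> Poly_Mapping.keys q \<subseteq> S \<Longrightarrow> Poly_Mapping.keys (p + q) \<subseteq> S"
  using keys_add[of p q] by blast

lemma keys_diff_closed:
  fixes p q :: "'s \<Rightarrow>\<^sub>0 complex"
  shows "Poly_Mapping.keys p \<subseteq> S \<Longrightarrow> Poly_Mapping.keys q \<subseteq> S \<Longrightarrow> Poly_Mapping.keys (p - q) \<subseteq> S"
  using keys_diff[of p q] by blast

lemma keys_single_subset: "k \<in> S \<Longrightarrow> Poly_Mapping.keys (Poly_Mapping.single k c) \<subseteq> S"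
  by auto

lemma cring_semigroup_ring:
  assumes "0 \<in> S" and S: "\<And>a b. a \<in> S \<Longrightarrow> b \<in> S \<Longrightarrow> a + b \<in> S"
  shows "cring (semigroup_ring S)"
proof (rule cringI)
  show "abelian_group (semigroup_ring S)"
  proof (rule abelian_groupI)
    fix x assume "x \<in> carrier (semigroup_ring S)"
    then show "\<exists>y\<in>carrier (semigroup_ring S). y \<oplus>\<^bsub>semigroup_ring S\<^esub> x = \<zero>\<^bsub>semigroup_ring S\<^esub>"
      by (intro bexI[of _ "- x"]) (auto simp: semigroup_ring_simps)
  qed (auto simp: semigroup_ring_simps algebra_simps dest: subsetD[OF keys_add])
  show "comm_monoid (semigroup_ring S)"
    by (rule comm_monoidI)
      (use assms in \<open>auto simp: semigroup_ring_simps algebra_simps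
         dest!: subsetD[OF keys_mult]\<close>)
qed (simp add: semigroup_ring_simps algebra_simps)

lemma a_inv_semigroup_ring:
  assumes "0 \<in> S" "\<And>a b. a \<in> S \<Longrightarrow> b \<in> S \<Longrightarrow> a + b \<in> S" "Poly_Mapping.keys p \<subseteq> S"
  shows "\<ominus>\<^bsub>semigroup_ring S\<^esub> p = - p"
proof -
  interpret cring "semigroup_ring S" by (rule cring_semigroup_ring) (fact assms)+
  show ?thesis
    by (rule minus_equality) (use assms in \<open>auto simp: semigroup_ring_simps\<close>)
qed

lemma lookup_single_zero_mult:
  "Poly_Mapping.lookup (Poly_Mapping.single 0 c * p) k = c * Poly_Mapping.lookup (p :: 's::comm_monoid_add \<Rightarrow>\<^sub>0 complex) k"
proof (induction p rule: poly_mapping_keys_induct[OF subset_UNIV])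
  case (2 l d)
  then show ?case by (simp add: mult_single lookup_single when_def)
qed (auto simp: lookup_add distrib_left)

section \<open>The kernel of the substitution\<close>

definition exponent_size :: "('k::finite \<Rightarrow>\<^sub>0 nat) \<Rightarrow> nat" where
  "exponent_size b = (\<Sum>i\<in>UNIV. Poly_Mapping.lookup b i)"

lemma exponent_size_add: "exponent_size (b + b') = exponent_size b + exponent_size b'"
  by (simp add: exponent_size_def lookup_add sum.distrib)

lemma exponent_size_single [simp]: "exponent_size (Poly_Mapping.single i n) = n"
  by (simp add: exponent_size_def lookup_single when_def)

lemma exponent_size_zero [simp]: "exponent_size 0 = 0"
  by (simp add: exponent_size_def)

lemma exponent_split:
  fixes b :: "'k \<Rightarrow>\<^sub>0 nat"
  assumes "Poly_Mapping.lookup b i > 0"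
  obtains b' where "b = b' + Poly_Mapping.single i 1"
proof
  show "b = (b - Poly_Mapping.single i 1) + Poly_Mapping.single i 1"
    by (rule poly_mapping_eqI) (use assms in \<open>auto simp: lookup_add lookup_minus lookup_single when_def\<close>)
qed

lemma exponent_size_eq_0_iff: "exponent_size b = 0 \<longleftrightarrow> b = 0"
proof
  assume "exponent_size b = 0"
  then show "b = 0" by (intro poly_mapping_eqI) (simp add: exponent_size_def)
qed simp

lemma exponent_induct [case_names zero add]:
  fixes b :: "'k::finite \<Rightarrow>\<^sub>0 nat"
  assumes "P 0" "\<And>b i. P b \<Longrightarrow> P (b + Poly_Mapping.single i 1)"
  shows "P b"
proof (induction "exponent_size b" arbitrary: b)
  case 0
  then show ?case using assms(1) exponent_size_eq_0_iff by metis
next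
  case (Suc n)
  then obtain i where "Poly_Mapping.lookup b i > 0"
    by (metis exponent_size_eq_0_iff gr0I lookup_zero nat.distinct(1) poly_mapping_eqI)
  then obtain b' where "b = b' + Poly_Mapping.single i 1" by (rule exponent_split)
  then show ?case using Suc assms(2)[of b' i] by (simp add: exponent_size_add)
qed

lemma vec_scale_simps:
  "(0::int) *s (x :: int ^ 'n) = 0" "1 *s x = x" "(a + b) *s x = a *s x + b *s x" "(a - b) *s x = a *s x - b *s x"
  by (simp_all add: vec_eq_iff algebra_simps)

definition leading_exponent :: "int ^ 'n \<Rightarrow> ('n::finite, 'k::finite) lat \<times> ('k \<Rightarrow>\<^sub>0 nat) \<Rightarrow> ('n, 'k) lat" where
  "leading_exponent R z = (fst (fst z) + int (exponent_size (snd z)) *s R,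
     snd (fst z) + (\<chi> i. int (Poly_Mapping.lookup (snd z) i)))"

lemma leading_exponent_zero [simp]: "leading_exponent R (u, 0) = u"
  by (simp add: leading_exponent_def vec_scale_simps prod_eq_iff vec_eq_iff)

lemma leading_exponent_add:
  "leading_exponent R (u, b + Poly_Mapping.single i 1) = leading_exponent R (u, b) + (lat_of_M R + e_dual i)"
  by (simp add: leading_exponent_def exponent_size_add vec_scale_simps lat_of_M_def e_dual_def prod_eq_iff
    vec_eq_iff lookup_add lookup_single when_def axis_def)

lemma leading_exponent_translate:
  "leading_exponent R (u + v, b) = leading_exponent R (u, b) + v"
  by (simp add: leading_exponent_def prod_eq_iff)

text \<open>The value of \<open>x^u \<lambda>^b\<close> under the substitution. It lives in the
  group ring of the whole lattice because \<open>R\<close> and \<open>R + e_i\<close> may lie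
  outside \<open>D\<close>.\<close>

definition lambda_value :: "int ^ 'n \<Rightarrow> ('n::finite, 'k::finite) lat \<times> ('k \<Rightarrow>\<^sub>0 nat) \<Rightarrow> (('n, 'k) lat \<Rightarrow>\<^sub>0 complex)" where
  "lambda_value R = (\<lambda>(u, b). chi u * (\<Prod>i\<in>UNIV. B_generator R i ^ Poly_Mapping.lookup b i))"

lemma lambda_value_zero: "lambda_value R (u, 0) = chi u"
  by (simp add: lambda_value_def)

lemma lambda_value_add: "lambda_value R (z + z') = lambda_value R z * lambda_value R z'"
proof (cases z; cases z')
  fix u b u' b' assume [simp]: "z = (u, b)" "z' = (u', b')"
  have "chi (u + u') = chi u * (chi u' :: _ \<Rightarrow>\<^sub>0 complex)" by (simp add: mult_single)
  then show ?thesis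
    by (simp add: lambda_value_def lookup_add power_add prod.distrib mult_ac)
qed

lemma lambda_value_single: "lambda_value R (0, Poly_Mapping.single i 1) = B_generator R i"
proof -
  have "(\<Prod>j\<in>UNIV. B_generator R j ^ Poly_Mapping.lookup (Poly_Mapping.single i 1) j)
      = (\<Prod>j\<in>UNIV. if j = i then B_generator R j else 1)"
    by (rule prod.cong) (auto simp: lookup_single)
  then show ?thesis by (simp add: lambda_value_def)
qed

lemma lambda_value_step:
  "lambda_value R (u, b + Poly_Mapping.single i 1) = lambda_value R (u, b) * B_generator R i"
  using lambda_value_add[of R "(u, b)" "(0, Poly_Mapping.single i 1)"] lambda_value_single[of R i] by simp

text \<open>The convex geometry enters through the four closure properties \<open>D_add\<close> to
  \<open>D_decrease\<close>. The set \<open>J\<close> stands for the polynomials whose image in the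
  Cox ring lies in \<open>I_lambda\<close>; it is treated as a vector space, with the multiples of
  the relations by powers of the \<open>\<lambda>_i\<close> supplied by
  \<open>J_relation\<close>.\<close>

locale lambda_substitution =
  fixes R :: "int ^ 'n" and D :: "('n::finite, 'k::finite) lat set" and ell :: "('n, 'k) lat \<Rightarrow> real"
    and J :: "(('n, 'k) lat \<times> ('k \<Rightarrow>\<^sub>0 nat) \<Rightarrow>\<^sub>0 complex) set"
  assumes D_add: "\<And>u i. u \<in> D \<Longrightarrow> u + lat_of_M R \<in> D \<Longrightarrow> u + (lat_of_M R + e_dual i) \<in> D"
    and D_diff: "\<And>u i. u \<in> D \<Longrightarrow> u + e_dual i \<in> D \<Longrightarrow> u - lat_of_M R \<in> D"
    and D_between: "\<And>m c c' n. (m, c) \<in> D \<Longrightarrow> (m - int n *s R, c') \<in> D \<Longrightarrow> n > 0 \<Longrightarrow> (m - int n *s R + R, c') \<in> D"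
    and D_decrease: "\<And>m c c' i. (m, c) \<in> D \<Longrightarrow> (m, c') \<in> D \<Longrightarrow> c $ i < c' $ i \<Longrightarrow> (m, c') - e_dual i \<in> D"
    and ell_add: "\<And>u v. ell (u + v) = ell u + ell v"
    and ell_R: "ell (lat_of_M R) = 0"
    and ell_e: "\<And>i. ell (e_dual i) = 1"
    and ell_nonneg: "\<And>u. u \<in> D \<Longrightarrow> ell u \<ge> 0"
    and J_zero: "0 \<in> J"
    and J_add: "\<And>p q. p \<in> J \<Longrightarrow> q \<in> J \<Longrightarrow> p + q \<in> J"
    and J_scale: "\<And>p c. p \<in> J \<Longrightarrow> Poly_Mapping.single 0 c * p \<in> J"
    and J_relation: "\<And>u b i. u \<in> D \<Longrightarrow> u + lat_of_M R \<in> D \<Longrightarrow>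
      chi (u + (lat_of_M R + e_dual i), b) - chi (u + lat_of_M R, b) - chi (u, b + Poly_Mapping.single i 1) \<in> J"
    and J_kernel: "\<And>p. p \<in> J \<Longrightarrow> linear_extension (lambda_value R) p = 0"
begin

lemma J_uminus: "p \<in> J \<Longrightarrow> - p \<in> J"
  using J_scale[of p "-1"] by (simp add: single_uminus)

section \<open>Congruence of monomials with the same leading exponent\<close>

abbreviation "fib \<equiv> leading_exponent R"

lemma ell_fib: "ell (fib (u, b)) = ell u + exponent_size b"
proof (induction b rule: exponent_induct)
  case (add b i)
  then show ?case
    by (simp add: leading_exponent_add ell_add ell_R ell_e exponent_size_add del: One_nat_def)
qed simp

definition smaller :: "real \<Rightarrow> (('n, 'k) lat \<times> ('k \<Rightarrow>\<^sub>0 nat) \<Rightarrow>\<^sub>0 complex) set" where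
  "smaller r = {q. Poly_Mapping.keys q \<subseteq> {z. fst z \<in> D \<and> ell (fib z) \<le> r}}"

text \<open>Congruence modulo \<open>J\<close> and terms whose degree is lower by at least one. The
  degree bound is taken at the first argument, hence the equalities of leading exponents in symmetry
  and transitivity.\<close>

definition related where
  "related z z' \<longleftrightarrow> (\<exists>q\<in>smaller (ell (fib z) - 1). chi z - chi z' - q \<in> J)"

lemma related_refl: "related z z"
  unfolding related_def by (intro bexI[of _ 0]) (auto simp: smaller_def J_zero)

lemma related_sym: "related z z' \<Longrightarrow> fib z = fib z' \<Longrightarrow> related z' z"
  unfolding related_def
proof (elim bexE)
  fix q assume fib: "fib z = fib z'" and q: "q \<in> smaller (ell (fib z) - 1)" "chi z - chi z' - q \<in> J"
  have "chi z' - chi z - (- q) = - (chi z - chi z' - q)" by simp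
  then have "chi z' - chi z - (- q) \<in> J" using J_uminus[OF q(2)] by metis
  moreover have "- q \<in> smaller (ell (fib z') - 1)" using q(1) fib by (simp add: smaller_def)
  ultimately show "\<exists>q\<in>smaller (ell (fib z') - 1). chi z' - chi z - q \<in> J" by blast
qed

lemma related_trans:
  assumes "related z z'" "related z' z''" "fib z = fib z'"
  shows "related z z''"
proof -
  obtain q q' where q: "q \<in> smaller (ell (fib z) - 1)" "chi z - chi z' - q \<in> J"
    and q': "q' \<in> smaller (ell (fib z) - 1)" "chi z' - chi z'' - q' \<in> J"
    using assms unfolding related_def by metis
  have "chi z - chi z'' - (q + q') \<in> J"
    using J_add[OF q(2) q'(2)] by (simp add: algebra_simps)
  moreover have "q + q' \<in> smaller (ell (fib z) - 1)"
    using q q' unfolding smaller_def by (auto dest!: subsetD[OF keys_add])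
  ultimately show ?thesis unfolding related_def by blast
qed

text \<open>The relation in \<open>J\<close> has the third term \<open>x^(u+R) \<lambda>^b\<close>,
  whose degree is lower by exactly one since \<open>ell\<close> is 0 on \<open>R\<close> and 1 on
  \<open>e_i\<close>.\<close>

lemma related_step:
  assumes "u \<in> D" "u + lat_of_M R \<in> D"
  shows "related (u + (lat_of_M R + e_dual i), b) (u, b + Poly_Mapping.single i 1)"
  unfolding related_def
proof (rule bexI[of _ "chi (u + lat_of_M R, b)"])
  show "chi (u + (lat_of_M R + e_dual i), b) - chi (u, b + Poly_Mapping.single i 1) - chi (u + lat_of_M R, b) \<in> J"
    using J_relation[OF assms, of i b] by (simp add: algebra_simps)
  show "chi (u + lat_of_M R, b) \<in> smaller (ell (fib (u + (lat_of_M R + e_dual i), b)) - 1)"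
    using assms by (auto simp: smaller_def ell_fib ell_add ell_R ell_e)
qed

text \<open>Both monomials are one \<open>related_step\<close> away from
  \<open>x^v \<lambda>^b \<lambda>_i \<lambda>_j\<close> with \<open>v = u - e_i - R\<close>, and
  \<open>D_diff\<close> places \<open>v\<close> in \<open>D\<close>.\<close>

lemma related_swap:
  assumes "u \<in> D" "u - e_dual i \<in> D"
  shows "related (u, b + Poly_Mapping.single j 1) (u - e_dual i + e_dual j, b + Poly_Mapping.single i 1)"
proof -
  define v where "v = u - e_dual i - lat_of_M R"
  have v: "v \<in> D" "v + lat_of_M R \<in> D"
    using D_diff[of "u - e_dual i" i] assms by (simp_all add: v_def)
  have rel1: "related (v + (lat_of_M R + e_dual i), b + Poly_Mapping.single j 1) (v, b + Poly_Mapping.single j 1 + Poly_Mapping.single i 1)"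
    by (rule related_step[OF v])
  have rel2: "related (v + (lat_of_M R + e_dual j), b + Poly_Mapping.single i 1) (v, b + Poly_Mapping.single i 1 + Poly_Mapping.single j 1)"
    by (rule related_step[OF v])
  have swap: "b + Poly_Mapping.single i 1 + Poly_Mapping.single j 1 = b + Poly_Mapping.single j 1 + Poly_Mapping.single i 1"
    by (simp add: add_ac)
  have comm: "x + a + b = x + b + a" for x a b :: "('n, 'k) lat" by (simp add: add_ac)
  have fibs: "fib (v + (lat_of_M R + e_dual i), b + Poly_Mapping.single j 1)
      = fib (v, b + Poly_Mapping.single j 1 + Poly_Mapping.single i 1)"
    "fib (v + (lat_of_M R + e_dual j), b + Poly_Mapping.single i 1)
      = fib (v, b + Poly_Mapping.single i 1 + Poly_Mapping.single j 1)"
    unfolding leading_exponent_translate leading_exponent_add by (rule comm)+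
  have "related (v + (lat_of_M R + e_dual i), b + Poly_Mapping.single j 1)
     (v + (lat_of_M R + e_dual j), b + Poly_Mapping.single i 1)"
    using related_trans[OF rel1 related_sym[OF rel2[unfolded swap]]] fibs[unfolded swap] by simp
  moreover have "v + (lat_of_M R + e_dual i) = u" "v + (lat_of_M R + e_dual j) = u - e_dual i + e_dual j"
    by (simp_all add: v_def)
  ultimately show ?thesis by metis
qed

text \<open>Induction on the l1 distance between \<open>b\<close> and \<open>b'\<close>. If their
  sizes differ, the longer exponent sheds one \<open>\<lambda>_i\<close> by
  \<open>related_step\<close>; if they agree, one \<open>\<lambda>_j\<close> of \<open>b'\<close> is
  traded for a \<open>\<lambda>_i\<close> by \<open>related_swap\<close>. Each move brings the
  exponents closer and stays in \<open>D\<close>.\<close>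

lemma related_if_leading_exponent_eq:
  assumes "u \<in> D" "u' \<in> D" "fib (u, b) = fib (u', b')"
  shows "related (u, b) (u', b')"
  using assms
proof (induction "\<Sum>i\<in>UNIV. nat \<bar>int (Poly_Mapping.lookup b i) - int (Poly_Mapping.lookup b' i)\<bar>"
    arbitrary: u u' b b' rule: less_induct)
  case less
  let ?d = "\<lambda>b b'. \<Sum>i\<in>UNIV. nat \<bar>int (Poly_Mapping.lookup b i) - int (Poly_Mapping.lookup b' i)\<bar>"
  have m_eq: "fst u + int (exponent_size b) *s R = fst u' + int (exponent_size b') *s R"
    and c_eq: "\<And>i. snd u $ i + int (Poly_Mapping.lookup b i) = snd u' $ i + int (Poly_Mapping.lookup b' i)"
    using less.prems(3) by (auto simp: leading_exponent_def vec_eq_iff)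
  \<comment> \<open>Either of the two monomials may be the longer one, so the induction hypothesis
    is passed in as a premise and the claim is used in both orders.\<close>
  have longer: "related (v', a') (v, a)"
    if vD: "v \<in> D" "v' \<in> D" and fib_eq: "fib (v, a) = fib (v', a')" and le: "exponent_size a < exponent_size a'"
      and IH: "\<And>w a''. w \<in> D \<Longrightarrow> fib (w, a'') = fib (v, a) \<Longrightarrow> ?d a'' a < ?d a' a \<Longrightarrow> related (w, a'') (v, a)"
    for v v' a a'
  proof -
    obtain i where i: "Poly_Mapping.lookup a i < Poly_Mapping.lookup a' i"
      using le unfolding exponent_size_def by (meson not_le sum_mono)
    then obtain a'' where a'': "a' = a'' + Poly_Mapping.single i 1"
      using exponent_split[of a' i] by auto
    define n where "n = exponent_size a' - exponent_size a"
    have "fst v' = fst v - int n *s R"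
      using fib_eq le by (simp add: leading_exponent_def n_def vec_scale_simps algebra_simps of_nat_diff)
    \<comment> \<open>\<open>v'\<close> lies \<open>n\<close> steps below \<open>v\<close> in
      direction \<open>R\<close>, so one step back up remains in \<open>D\<close>.\<close>
    then have v'R: "v' + lat_of_M R \<in> D"
      using D_between[of "fst v" "snd v" n "snd v'"] vD le
      by (cases v, cases v') (simp add: n_def lat_of_M_def)
    have 1: "related (v' + (lat_of_M R + e_dual i), a'') (v', a')"
      using related_step[OF vD(2) v'R] a'' by simp
    have fib': "fib (v' + (lat_of_M R + e_dual i), a'') = fib (v', a')"
      by (simp only: a'' leading_exponent_translate leading_exponent_add)
    have "?d a'' a < ?d a' a"
      by (rule sum_strict_mono_ex1) (use i in \<open>auto simp: a'' lookup_add lookup_single when_def intro!: bexI[of _ i]\<close>)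
    then have "related (v' + (lat_of_M R + e_dual i), a'') (v, a)"
      by (intro IH D_add[OF vD(2) v'R]) (simp only: fib' fib_eq)
    then show ?thesis
      by (rule related_trans[OF related_sym[OF 1 fib'] _ fib'[symmetric]])
  qed
  have d_sym: "?d a a' = ?d a' a" for a a' :: "'k \<Rightarrow>\<^sub>0 nat"
    by (simp add: abs_minus_commute)
  consider "exponent_size b < exponent_size b'" | "exponent_size b' < exponent_size b"
    | "exponent_size b = exponent_size b'" "b = b'" | "exponent_size b = exponent_size b'" "b \<noteq> b'"
    using linorder_less_linear by blast
  then show ?case
  proof cases
    case 1
    have "related (u', b') (u, b)"
    proof (rule longer)
      fix w a'' assume "w \<in> D" "fib (w, a'') = fib (u, b)" "?d a'' b < ?d b' b"
      then show "related (w, a'') (u, b)"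
        by (intro less.hyps) (use less.prems d_sym[of b b'] in auto)
    qed (use less.prems 1 in auto)
    then show ?thesis using less.prems(3) by (metis related_sym)
  next
    case 2
    show ?thesis
    proof (rule longer)
      fix w a'' assume "w \<in> D" "fib (w, a'') = fib (u', b')" "?d a'' b' < ?d b b'"
      then show "related (w, a'') (u', b')"
        by (intro less.hyps) (use less.prems in auto)
    qed (use less.prems 2 in auto)
  next
    case 3
    then have "u = u'"
      using m_eq c_eq by (simp add: prod_eq_iff vec_eq_iff)
    then show ?thesis using 3 related_refl by simp
  next
    case 4
    have ex_less: "\<exists>i. Poly_Mapping.lookup a i < Poly_Mapping.lookup a' i"
      if size_eq: "exponent_size a = exponent_size a'" and neq: "a \<noteq> a'" for a a' :: "'k \<Rightarrow>\<^sub>0 nat"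
    proof (rule ccontr)
      assume "\<nexists>i. Poly_Mapping.lookup a i < Poly_Mapping.lookup a' i"
      then have le: "\<And>i. Poly_Mapping.lookup a' i \<le> Poly_Mapping.lookup a i" by (simp add: not_less)
      obtain i where "Poly_Mapping.lookup a i \<noteq> Poly_Mapping.lookup a' i"
        using neq by (meson poly_mapping_eqI)
      then have "Poly_Mapping.lookup a' i < Poly_Mapping.lookup a i" using le[of i] by simp
      then have "exponent_size a' < exponent_size a"
        unfolding exponent_size_def by (intro sum_strict_mono_ex1) (auto simp: le)
      then show False using size_eq by simp
    qed
    obtain i where i: "Poly_Mapping.lookup b' i < Poly_Mapping.lookup b i"
      using ex_less[of b' b] 4 by auto
    obtain j where j: "Poly_Mapping.lookup b j < Poly_Mapping.lookup b' j"
      using ex_less[of b b'] 4 by auto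
    obtain a where a: "b' = a + Poly_Mapping.single j 1"
      using exponent_split[of b' j] j by auto
    \<comment> \<open>Equal leading exponents turn the excess of \<open>b\<close> at
      \<open>i\<close> into a deficit of \<open>u\<close> at \<open>i\<close>, which is the
      hypothesis of \<open>D_decrease\<close>.\<close>
    have "fst u = fst u'" using m_eq 4 by simp
    moreover have "snd u $ i < snd u' $ i" using c_eq[of i] i by simp
    ultimately have "u' - e_dual i \<in> D"
      using D_decrease[of "fst u" "snd u" "snd u'" i] less.prems by (cases u, cases u') simp
    then have 1: "related (u', b') (u' - e_dual i + e_dual j, a + Poly_Mapping.single i 1)"
      using related_swap[of u' i a j] less.prems a by simp
    define u'' where "u'' = u' - e_dual i + e_dual j"
    define b'' where "b'' = a + Poly_Mapping.single i 1"
    have u''D: "u'' \<in> D"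
    proof -
      have "u' - e_dual i - lat_of_M R \<in> D"
        using D_diff[of "u' - e_dual i" i] \<open>u' - e_dual i \<in> D\<close> less.prems by simp
      then show ?thesis
        using D_add[of "u' - e_dual i - lat_of_M R" j] \<open>u' - e_dual i \<in> D\<close>
        by (simp add: u''_def algebra_simps)
    qed
    have "u'' + (lat_of_M R + e_dual i) = u' + (lat_of_M R + e_dual j)"
      by (simp add: u''_def)
    then have fib'': "fib (u'', b'') = fib (u', b')"
      by (simp only: a b''_def leading_exponent_add flip: leading_exponent_translate)
    have "i \<noteq> j" using i j by auto
    \<comment> \<open>The natural number subtraction at \<open>j\<close> does not truncate, since
      \<open>b'\<close> contains \<open>\<lambda>_j\<close>.\<close>
    have lookup_b'': "Poly_Mapping.lookup b'' x
        = Poly_Mapping.lookup b' x + (if x = i then 1 else 0) - (if x = j then 1 else 0)" for x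
      using \<open>i \<noteq> j\<close> by (simp add: a b''_def lookup_add lookup_single when_def)
    have "?d b b'' < ?d b b'"
    proof (rule sum_strict_mono_ex1)
      show "\<forall>x\<in>UNIV. nat \<bar>int (Poly_Mapping.lookup b x) - int (Poly_Mapping.lookup b'' x)\<bar>
          \<le> nat \<bar>int (Poly_Mapping.lookup b x) - int (Poly_Mapping.lookup b' x)\<bar>"
        unfolding lookup_b'' using i j by auto
      show "\<exists>x\<in>UNIV. nat \<bar>int (Poly_Mapping.lookup b x) - int (Poly_Mapping.lookup b'' x)\<bar>
          < nat \<bar>int (Poly_Mapping.lookup b x) - int (Poly_Mapping.lookup b' x)\<bar>"
        unfolding lookup_b'' using i \<open>i \<noteq> j\<close> by (intro bexI[of _ i]) auto
    qed simp
    then have "related (u, b) (u'', b'')"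
      by (intro less.hyps) (use less.prems fib'' u''D in auto)
    moreover have "related (u'', b'') (u', b')"
      using 1 fib'' unfolding u''_def b''_def by (metis related_sym)
    ultimately show ?thesis
      by (rule related_trans) (simp only: less.prems(3) fib'')
  qed
qed

section \<open>Reduction to representatives and their linear independence\<close>

definition representative where
  "representative f = (SOME z. fst z \<in> D \<and> fib z = f)"

definition representatives where
  "representatives = {z. fst z \<in> D \<and> representative (fib z) = z}"

lemma representative:
  assumes "fst z \<in> D"
  shows "fst (representative (fib z)) \<in> D" "fib (representative (fib z)) = fib z"
    "representative (fib z) \<in> representatives"
proof -
  have "fst (representative (fib z)) \<in> D \<and> fib (representative (fib z)) = fib z"
    unfolding representative_def by (rule someI[of _ z]) (simp add: assms)
  then show "fst (representative (fib z)) \<in> D" "fib (representative (fib z)) = fib z"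
    "representative (fib z) \<in> representatives"
    by (simp_all add: representatives_def)
qed

definition reducible where
  "reducible p \<longleftrightarrow> (\<exists>p'. Poly_Mapping.keys p' \<subseteq> representatives \<and> p - p' \<in> J)"

lemma reducible_add: "reducible p \<Longrightarrow> reducible q \<Longrightarrow> reducible (p + q)"
  unfolding reducible_def
proof (elim exE conjE)
  fix p' q' assume J: "p - p' \<in> J" "q - q' \<in> J"
    and keys: "Poly_Mapping.keys p' \<subseteq> representatives" "Poly_Mapping.keys q' \<subseteq> representatives"
  have "p + q - (p' + q') = (p - p') + (q - q')" by simp
  then have "p + q - (p' + q') \<in> J" using J_add[OF J] by metis
  then show "\<exists>p'. Poly_Mapping.keys p' \<subseteq> representatives \<and> p + q - p' \<in> J"
    using keys_add_closed[OF keys] by blast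
qed

lemma reducible_single:
  assumes "reducible (chi z)"
  shows "reducible (Poly_Mapping.single z c)"
proof -
  obtain p' where p': "Poly_Mapping.keys p' \<subseteq> representatives" "chi z - p' \<in> J"
    using assms unfolding reducible_def by blast
  have "Poly_Mapping.single 0 c * (chi z - p') = Poly_Mapping.single z c - Poly_Mapping.single 0 c * p'"
    by (simp add: right_diff_distrib mult_single)
  moreover have "Poly_Mapping.keys (Poly_Mapping.single 0 c * p') \<subseteq> representatives"
    using p'(1) by (intro keys_mult_closed[of "{0}" representatives]) auto
  ultimately show ?thesis
    using J_scale[OF p'(2), of c] unfolding reducible_def by metis
qed

lemma reducible_zero: "reducible 0"
  unfolding reducible_def by (intro exI[of _ 0]) (simp add: J_zero)

lemma reducible_J: "reducible p \<Longrightarrow> q - p \<in> J \<Longrightarrow> reducible q"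
  unfolding reducible_def
proof (elim exE conjE)
  fix p' assume p': "Poly_Mapping.keys p' \<subseteq> representatives" "p - p' \<in> J" and "q - p \<in> J"
  have "q - p' = (q - p) + (p - p')" by simp
  then have "q - p' \<in> J" using J_add[OF \<open>q - p \<in> J\<close> p'(2)] by metis
  then show "\<exists>p'. Poly_Mapping.keys p' \<subseteq> representatives \<and> q - p' \<in> J" using p'(1) by blast
qed

text \<open>Replacing a monomial by its representative leaves an error of lower degree. The degree
  is real valued, but it is nonnegative on \<open>D\<close> and drops by at least one each time, so
  its floor serves as the induction measure.\<close>

lemma reducible_chi: "fst z \<in> D \<Longrightarrow> reducible (chi z)"
proof (induction "nat \<lfloor>ell (fib z)\<rfloor>" arbitrary: z rule: less_induct)
  case less
  let ?r = "representative (fib z)"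
  have "related z ?r"
    using related_if_leading_exponent_eq[of "fst z" "fst ?r" "snd z" "snd ?r"] representative[OF less.prems] less.prems
    by simp
  then obtain q where q: "q \<in> smaller (ell (fib z) - 1)" "chi z - chi ?r - q \<in> J"
    unfolding related_def by blast
  have red_r: "reducible (chi ?r)"
    unfolding reducible_def
    by (intro exI[of _ "chi ?r"]) (simp add: J_zero representative[OF less.prems])
  have "Poly_Mapping.keys q \<subseteq> {z'. fst z' \<in> D \<and> ell (fib z') \<le> ell (fib z) - 1}"
    using q(1) by (simp add: smaller_def)
  then have "reducible q"
  proof (induction q rule: poly_mapping_keys_induct)
    case (single z' c)
    have "ell (fib z') \<ge> 0"
      using single ell_fib[of "fst z'" "snd z'"] ell_nonneg[of "fst z'"] by simp
    moreover have "ell (fib z') \<le> ell (fib z) - 1" using single by simp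
    ultimately have "nat \<lfloor>ell (fib z')\<rfloor> < nat \<lfloor>ell (fib z)\<rfloor>" by linarith
    then have "reducible (chi z')"
      by (rule less.hyps) (use single in simp)
    then show ?case by (rule reducible_single)
  next
    case (add p q)
    then show ?case by (intro reducible_add)
  qed (rule reducible_zero)
  then have "reducible (chi ?r + q)" by (intro reducible_add red_r)
  moreover have "chi z - (chi ?r + q) \<in> J" using q(2) by (simp only: diff_diff_eq)
  ultimately show ?case using reducible_J by blast
qed

definition monic_at where
  "monic_at p v \<longleftrightarrow> Poly_Mapping.keys (p - chi v) \<subseteq> {w. ell w < ell v}"

lemma monic_at_mult:
  assumes "monic_at p v" "monic_at q w"
  shows "monic_at (p * q) (v + w)"
proof -
  have eq: "p * q - chi (v + w) = (p - chi v) * q + chi v * (q - chi w)"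
    by (simp add: algebra_simps mult_single)
  have "Poly_Mapping.keys ((q - chi w) + chi w) \<subseteq> {x. ell x \<le> ell w}"
    by (rule keys_add_closed) (use assms(2) in \<open>auto simp: monic_at_def\<close>)
  then have q: "Poly_Mapping.keys q \<subseteq> {x. ell x \<le> ell w}" by simp
  show ?thesis
    unfolding monic_at_def eq
  proof (rule keys_add_closed)
    show "Poly_Mapping.keys ((p - chi v) * q) \<subseteq> {x. ell x < ell (v + w)}"
      by (rule keys_mult_closed[OF _ _ q, of "{x. ell x < ell v}"])
        (use assms(1) in \<open>auto simp: monic_at_def ell_add\<close>)
    show "Poly_Mapping.keys (chi v * (q - chi w)) \<subseteq> {x. ell x < ell (v + w)}"
      by (rule keys_mult_closed[of "{v}" "{x. ell x < ell w}"])
        (use assms(2) in \<open>auto simp: monic_at_def ell_add\<close>)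
  qed
qed

text \<open>Each factor \<open>chi (R + e_i) - chi R\<close> has leading term
  \<open>chi (R + e_i)\<close>, and leading terms multiply.\<close>

lemma monic_at_lambda_value: "monic_at (lambda_value R (u, b)) (fib (u, b))"
proof (induction b rule: exponent_induct)
  case zero
  then show ?case by (simp add: lambda_value_zero monic_at_def)
next
  case (add b i)
  have "monic_at (B_generator R i) (lat_of_M R + e_dual i)"
    by (simp add: monic_at_def B_generator_def ell_add ell_R ell_e)
  with add show ?case
    by (simp only: leading_exponent_add lambda_value_step monic_at_mult)
qed

text \<open>Different representatives have different leading exponents. Hence, at the leading
  exponent of a term of maximal degree, no other term contributes and nothing can cancel.\<close>

lemma lambda_value_injective_on_representatives:
  assumes keys: "Poly_Mapping.keys p \<subseteq> representatives" and zero: "linear_extension (lambda_value R) p = 0"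
  shows "p = 0"
proof (rule ccontr)
  assume "p \<noteq> 0"
  then have ne: "(\<lambda>z. ell (fib z)) ` Poly_Mapping.keys p \<noteq> {}" by simp
  obtain z where z1: "z \<in> Poly_Mapping.keys p" "Max ((\<lambda>z. ell (fib z)) ` Poly_Mapping.keys p) = ell (fib z)"
    using Max_in[OF finite_imageI[OF finite_keys] ne] by blast
  then have z: "z \<in> Poly_Mapping.keys p" "\<And>z'. z' \<in> Poly_Mapping.keys p \<Longrightarrow> ell (fib z') \<le> ell (fib z)"
    using Max_ge[OF finite_imageI[OF finite_keys]] by (metis imageI)+
  have coeff: "Poly_Mapping.lookup (lambda_value R z') (fib z) = (if z' = z then 1 else 0)"
    if "z' \<in> Poly_Mapping.keys p" for z'
  proof -
    have "monic_at (lambda_value R z') (fib z')"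
      using monic_at_lambda_value[of "fst z'" "snd z'"] by simp
    then have "fib z \<notin> Poly_Mapping.keys (lambda_value R z' - chi (fib z'))"
      using z(2)[OF that] by (auto simp: monic_at_def)
    then have "Poly_Mapping.lookup (lambda_value R z') (fib z) = Poly_Mapping.lookup (chi (fib z')) (fib z)"
      by (simp add: in_keys_iff lookup_minus)
    moreover have "fib z' = fib z \<longleftrightarrow> z' = z"
    proof
      assume "fib z' = fib z"
      moreover have "representative (fib z') = z'" "representative (fib z) = z"
        using that z(1) keys unfolding representatives_def by blast+
      ultimately show "z' = z" by metis
    qed simp
    ultimately show ?thesis by (simp add: lookup_single when_def)
  qed
  have "Poly_Mapping.lookup (linear_extension (lambda_value R) p) (fib z)
      = (\<Sum>z'\<in>Poly_Mapping.keys p. Poly_Mapping.lookup p z' * (if z' = z then 1 else 0))"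
    by (simp add: linear_extension_def lookup_sum lookup_single_zero_mult coeff)
  also have "\<dots> = Poly_Mapping.lookup p z"
    using z(1) by (simp add: if_distrib sum.delta cong: if_cong)
  finally show False using zero z(1) by (simp add: in_keys_iff)
qed

theorem lambda_value_kernel:
  assumes "Poly_Mapping.keys p \<subseteq> D \<times> UNIV" "linear_extension (lambda_value R) p = 0"
  shows "p \<in> J"
proof -
  have "reducible p"
    using assms(1)
    by (induction p rule: poly_mapping_keys_induct)
      (auto intro!: reducible_zero reducible_add reducible_single reducible_chi)
  then obtain p' where p': "Poly_Mapping.keys p' \<subseteq> representatives" "p - p' \<in> J"
    unfolding reducible_def by blast
  have "linear_extension (lambda_value R) p' = 0"
    using J_kernel[OF p'(2)] assms(2) by (simp add: linear_extension_diff)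
  then have "p' = 0" using lambda_value_injective_on_representatives p'(1) by blast
  then show ?thesis using p'(2) by simp
qed

end

section \<open>Characters of finitely generated free abelian groups\<close>

text \<open>A homomorphism from a subgroup to the nonzero complex numbers. Differences and quotients
  express the subgroup and homomorphism laws in one condition; off \<open>H\<close> the values of
  \<open>h\<close> are arbitrary.\<close>

definition partial_character :: "('a \<Rightarrow>\<^sub>0 int) set \<Rightarrow> (('a \<Rightarrow>\<^sub>0 int) \<Rightarrow> complex) \<Rightarrow> bool" where
  "partial_character H h \<longleftrightarrow> 0 \<in> H \<and> (\<forall>x\<in>H. \<forall>y\<in>H. x - y \<in> H \<and> h x \<noteq> 0 \<and> h (x - y) = h x / h y)"

lemma partial_characterD:
  assumes "partial_character H h"
  shows "0 \<in> H" "h 0 = 1"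
    and "x \<in> H \<Longrightarrow> h x \<noteq> 0" "x \<in> H \<Longrightarrow> y \<in> H \<Longrightarrow> x - y \<in> H" "x \<in> H \<Longrightarrow> y \<in> H \<Longrightarrow> h (x - y) = h x / h y"
    "x \<in> H \<Longrightarrow> y \<in> H \<Longrightarrow> x + y \<in> H" "x \<in> H \<Longrightarrow> y \<in> H \<Longrightarrow> h (x + y) = h x * h y"
proof -
  show 0: "0 \<in> H" and nz: "\<And>x. x \<in> H \<Longrightarrow> h x \<noteq> 0" and cl: "\<And>x y. x \<in> H \<Longrightarrow> y \<in> H \<Longrightarrow> x - y \<in> H"
    and di: "\<And>x y. x \<in> H \<Longrightarrow> y \<in> H \<Longrightarrow> h (x - y) = h x / h y"
    using assms unfolding partial_character_def by blast+
  show 1: "h 0 = 1" using di[OF 0 0] nz[OF 0] by simp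
  have neg: "- y \<in> H" "h (- y) = 1 / h y" if "y \<in> H" for y
    using cl[OF 0 that] di[OF 0 that] 1 by simp_all
  show "x + y \<in> H" "h (x + y) = h x * h y" if "x \<in> H" "y \<in> H"
    using cl[OF that(1) neg(1)[OF that(2)]] di[OF that(1) neg(1)[OF that(2)]] neg(2)[OF that(2)]
    by simp_all
qed

lemma partial_character_frag_cmul:
  assumes h: "partial_character H h" and x: "x \<in> H"
  shows "frag_cmul n x \<in> H \<and> h (frag_cmul n x) = h x powi n"
proof -
  note H = partial_characterD[OF h]
  have nat: "frag_cmul (int k) x \<in> H \<and> h (frag_cmul (int k) x) = h x ^ k" for k
  proof (induction k)
    case (Suc k)
    have "frag_cmul (int (Suc k)) x = frag_cmul (int k) x + x"
      using frag_cmul_distrib[of "int k" 1 x] by (simp add: add.commute)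
    then show ?case using Suc H(6,7) x by simp
  qed (simp add: H)
  show ?thesis
  proof (cases "n \<ge> 0")
    case True
    then show ?thesis using nat[of "nat n"] by (simp add: power_int_def)
  next
    case False
    define k where "k = nat (- n)"
    have eq: "frag_cmul n x = 0 - frag_cmul (int k) x"
      using False by (simp add: k_def)
    have "frag_cmul n x \<in> H \<and> h (frag_cmul n x) = 1 / h x ^ k"
      unfolding eq using H(4)[OF H(1)] H(5)[OF H(1)] H(2) nat by metis
    then show ?thesis using False by (simp add: power_int_def k_def inverse_eq_divide power_one_over)
  qed
qed

text \<open>The extension has to send \<open>x + n g\<close> to \<open>h x * w powi n\<close>.
  Compatibility on the multiples of \<open>g\<close> that fall into \<open>H\<close> makes this
  independent of the chosen representation.\<close>

lemma extend_partial_character: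
  assumes h: "partial_character H h" and w: "w \<noteq> 0"
    and compat: "\<And>n. frag_cmul n g \<in> H \<Longrightarrow> h (frag_cmul n g) = w powi n"
  obtains H' h' where "partial_character H' h'" "H \<subseteq> H'" "g \<in> H'" "\<And>x. x \<in> H \<Longrightarrow> h' x = h x" "h' g = w"
proof -
  note H = partial_characterD[OF h]
  define H' where "H' = {x + frag_cmul n g | x n. x \<in> H}"
  have well_defined: "h x * w powi n = h y * w powi m"
    if "x \<in> H" "y \<in> H" "x + frag_cmul n g = y + frag_cmul m g" for x y n m
  proof -
    have "frag_cmul (n - m) g = frag_cmul n g - frag_cmul m g" by (rule frag_cmul_diff_distrib)
    also have "\<dots> = (x + frag_cmul n g) - x - frag_cmul m g" by simp
    also have "\<dots> = (y + frag_cmul m g) - x - frag_cmul m g" by (simp only: that(3))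
    also have "\<dots> = y - x" by simp
    finally have eq: "frag_cmul (n - m) g = y - x" .
    have "h y / h x = w powi (n - m)"
      using compat[of "n - m"] H(4,5) that by (simp add: eq)
    then show ?thesis
      using H(3) that w by (simp add: power_int_diff field_simps)
  qed
  define h' where "h' z = (SOME c. \<exists>x n. x \<in> H \<and> z = x + frag_cmul n g \<and> c = h x * w powi n)" for z
  have h': "h' (x + frag_cmul n g) = h x * w powi n" if "x \<in> H" for x n
  proof -
    have "\<exists>y m. y \<in> H \<and> x + frag_cmul n g = y + frag_cmul m g \<and> h' (x + frag_cmul n g) = h y * w powi m"
      unfolding h'_def by (rule someI) (use that in blast)
    then show ?thesis using well_defined[OF that] by metis
  qed
  show ?thesis
  proof
    show "partial_character H' h'"
      unfolding partial_character_def
    proof (intro conjI ballI)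
      show "0 \<in> H'" unfolding H'_def using H(1) by (auto intro!: exI[of _ 0])
    next
      fix x y assume "x \<in> H'" "y \<in> H'"
      then obtain a n b m where a: "x = a + frag_cmul n g" "a \<in> H" and b: "y = b + frag_cmul m g" "b \<in> H"
        unfolding H'_def by blast
      have eq: "x - y = (a - b) + frag_cmul (n - m) g"
        unfolding a b frag_cmul_diff_distrib by simp
      show "x - y \<in> H'" unfolding eq H'_def using H(4) a b by blast
      show "h' x \<noteq> 0" using a h' H(3) w by simp
      show "h' (x - y) = h' x / h' y"
        unfolding eq using h' H(3,4,5) a b w by (simp add: power_int_diff)
    qed
    have "x + frag_cmul 0 g \<in> H'" if "x \<in> H" for x unfolding H'_def using that by blast
    then show "H \<subseteq> H'" by auto
    have "0 + frag_cmul 1 g \<in> H'" unfolding H'_def using H(1) by blast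
    then show "g \<in> H'" by simp
    show "h' x = h x" if "x \<in> H" for x using h'[OF that, of 0] by simp
    show "h' g = w" using h'[OF H(1), of 1] H(2) by simp
  qed
qed

text \<open>Divisibility of \<open>\<complex>\<^sup>*\<close> provides a compatible value at a new group element; off \<open>H\<close> there is a
  choice different from \<open>1\<close> when \<open>h\<close> is trivial.\<close>

lemma compatible_value:
  assumes h: "partial_character H h"
  shows "\<exists>w. w \<noteq> 0 \<and> (\<forall>n. frag_cmul n g \<in> H \<longrightarrow> h (frag_cmul n g) = w powi n)
    \<and> (g \<notin> H \<longrightarrow> (\<forall>x\<in>H. h x = 1) \<longrightarrow> w \<noteq> 1)"
proof (cases "\<exists>n>0. frag_cmul (int n) g \<in> H")
  case False
  have "n = 0" if "frag_cmul n g \<in> H" for n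
  proof (rule ccontr)
    assume "n \<noteq> 0"
    have "frag_cmul \<bar>n\<bar> g \<in> H"
      using that partial_character_frag_cmul[OF h that, of "-1"] by (auto simp: abs_if)
    then show False using False \<open>n \<noteq> 0\<close> by (metis abs_ge_zero nat_0_le zero_less_abs_iff zero_less_nat_eq)
  qed
  \<comment> \<open>Only the zeroth multiple of \<open>g\<close> lies in \<open>H\<close>, so every
    nonzero value is compatible; 2 also differs from 1.\<close>
  then have "h (frag_cmul n g) = 2 powi n" if "frag_cmul n g \<in> H" for n
    using that partial_characterD(2)[OF h] by fastforce
  then show ?thesis by (intro exI[of _ 2]) auto
next
  case True
  \<comment> \<open>The \<open>n\<close> with \<open>n g\<close> in \<open>H\<close> form a subgroup
    of the integers with least positive element \<open>N\<close>. Every such \<open>n\<close> is a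
    multiple of \<open>N\<close>, so \<open>w ^ N = h (N g)\<close> is the one condition on
    \<open>w\<close>.\<close>
  define N where "N = (LEAST n. n > 0 \<and> frag_cmul (int n) g \<in> H)"
  have N: "N > 0" "frag_cmul (int N) g \<in> H"
    using LeastI_ex[OF True] unfolding N_def by auto
  have N_min: "n \<ge> N" if "n > 0" "frag_cmul (int n) g \<in> H" for n
    unfolding N_def by (rule Least_le) (use that in simp)
  have mult: "\<exists>q. n = int N * q" if "frag_cmul n g \<in> H" for n
  proof -
    have "frag_cmul (n mod int N) g = frag_cmul n g - frag_cmul (n div int N) (frag_cmul (int N) g)"
      by (simp add: minus_div_mult_eq_mod flip: frag_cmul_diff_distrib)
    then have "frag_cmul (n mod int N) g \<in> H"
      using partial_characterD(4)[OF h that] partial_character_frag_cmul[OF h N(2)] by metis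
    moreover have "n mod int N < int N" "n mod int N \<ge> 0" using N(1) by simp_all
    ultimately have "n mod int N = 0"
      using N_min[of "nat (n mod int N)"] by (cases "n mod int N = 0") auto
    then show ?thesis by (metis dvdE mod_0_imp_dvd)
  qed
  have compat: "\<forall>n. frag_cmul n g \<in> H \<longrightarrow> h (frag_cmul n g) = w powi n"
    if "w ^ N = h (frag_cmul (int N) g)" for w
  proof (intro allI impI)
    fix n assume "frag_cmul n g \<in> H"
    then obtain q where q: "n = int N * q" using mult by blast
    then have "frag_cmul n g = frag_cmul q (frag_cmul (int N) g)" by (simp add: mult.commute)
    then have "h (frag_cmul n g) = h (frag_cmul (int N) g) powi q"
      using partial_character_frag_cmul[OF h N(2)] by metis
    then show "h (frag_cmul n g) = w powi n"
      by (simp add: q power_int_mult flip: that)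
  qed
  let ?c = "h (frag_cmul (int N) g)"
  have c: "?c \<noteq> 0" using partial_characterD(3)[OF h N(2)] .
  define w where "w = exp (ln ?c / of_nat N)"
  have w: "w ^ N = ?c" using N(1) c by (simp add: w_def flip: exp_of_nat_mult)
  show ?thesis
  proof (cases "g \<notin> H \<and> (\<forall>x\<in>H. h x = 1)")
    case False
    then show ?thesis using compat[OF w] by (intro exI[of _ w]) (auto simp: w_def)
  next
    case True
    \<comment> \<open>If \<open>g\<close> is outside \<open>H\<close> then \<open>N\<close> exceeds
      1, so this primitive \<open>N\<close>-th root of unity is not 1. It is compatible because
      \<open>h\<close> is trivial.\<close>
    define z where "z = exp (2 * of_real pi * \<i> / of_nat N)"
    have "N \<noteq> 1" using True N by auto
    have "z ^ N = ?c"
      using N(1) True N(2) by (simp add: z_def flip: exp_of_nat_mult)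
    moreover have "z \<noteq> 1"
    proof
      assume "z = 1"
      then obtain k :: int where "2 * pi / N = of_int (2 * k) * pi"
        unfolding z_def exp_eq_1 by auto
      then have "1 = real_of_int k * real N" using N(1) by (simp add: field_simps)
      then have "k * int N = 1" by (metis of_int_eq_1_iff of_int_mult of_int_of_nat_eq)
      then show False using \<open>N \<noteq> 1\<close> by (simp add: zmult_eq_1_iff)
    qed
    ultimately show ?thesis using compat[of z] by (intro exI[of _ z]) (auto simp: z_def)
  qed
qed

text \<open>The trivial character of \<open>L\<close> is first extended to \<open>a\<close>, with a
  value other than 1, and only then to the basis vectors \<open>frag_of \<xi>\<close>. The values on
  the basis are the required \<open>\<mu>\<close>.\<close>

lemma separating_character:
  assumes "finite A" and L: "0 \<in> L" "\<And>x y. x \<in> L \<Longrightarrow> y \<in> L \<Longrightarrow> x - y \<in> L"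
    and a: "a \<notin> L" "Poly_Mapping.keys a \<subseteq> A"
  obtains \<mu> where "\<mu> \<in> A \<rightarrow>\<^sub>E - {0 :: complex}"
    and "\<forall>x\<in>L. Poly_Mapping.keys x \<subseteq> A \<longrightarrow> (\<Prod>\<xi>\<in>A. \<mu> \<xi> powi Poly_Mapping.lookup x \<xi>) = 1"
    and "(\<Prod>\<xi>\<in>A. \<mu> \<xi> powi Poly_Mapping.lookup a \<xi>) \<noteq> 1"
proof -
  have L1: "partial_character L (\<lambda>_. 1)" using L by (simp add: partial_character_def)
  obtain w where w: "w \<noteq> 0" "\<And>n. frag_cmul n a \<in> L \<Longrightarrow> (1 :: complex) = w powi n" "w \<noteq> 1"
    using compatible_value[OF L1, of a] a(1) by blast
  obtain H0 h0 where H0: "partial_character H0 h0" "L \<subseteq> H0" "a \<in> H0" "\<And>x. x \<in> L \<Longrightarrow> h0 x = 1" "h0 a = w"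
    using extend_partial_character[OF L1 w(1,2)] by metis
  have "\<exists>H h. partial_character H h \<and> H0 \<subseteq> H \<and> (\<forall>x\<in>H0. h x = h0 x) \<and> frag_of ` A \<subseteq> H"
    using \<open>finite A\<close>
  proof (induction A)
    case empty
    then show ?case using H0(1) by auto
  next
    case (insert \<xi> A)
    then obtain H h where H: "partial_character H h" "H0 \<subseteq> H" "\<forall>x\<in>H0. h x = h0 x" "frag_of ` A \<subseteq> H"
      by blast
    obtain v where v: "v \<noteq> 0" "\<And>n. frag_cmul n (frag_of \<xi>) \<in> H \<Longrightarrow> h (frag_cmul n (frag_of \<xi>)) = v powi n"
      using compatible_value[OF H(1)] by metis
    obtain H' h' where "partial_character H' h'" "H \<subseteq> H'" "frag_of \<xi> \<in> H'" "\<And>x. x \<in> H \<Longrightarrow> h' x = h x"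
      using extend_partial_character[OF H(1) v] by metis
    then show ?case using H by (intro exI[of _ H'] exI[of _ h']) auto
  qed
  then obtain H h where H: "partial_character H h" "H0 \<subseteq> H" "\<And>x. x \<in> H0 \<Longrightarrow> h x = h0 x" "frag_of ` A \<subseteq> H"
    by blast
  define \<mu> where "\<mu> = (\<lambda>\<xi>\<in>A. h (frag_of \<xi>))"
  have prod: "(\<Prod>\<xi>\<in>A. \<mu> \<xi> powi Poly_Mapping.lookup x \<xi>) = h x" if "Poly_Mapping.keys x \<subseteq> A" for x
  proof -
    have "(\<Sum>\<xi>\<in>B. frag_cmul (Poly_Mapping.lookup x \<xi>) (frag_of \<xi>)) \<in> H \<and>
        h (\<Sum>\<xi>\<in>B. frag_cmul (Poly_Mapping.lookup x \<xi>) (frag_of \<xi>)) = (\<Prod>\<xi>\<in>B. \<mu> \<xi> powi Poly_Mapping.lookup x \<xi>)"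
      if "finite B" "B \<subseteq> A" for B
      using that
    proof (induction B)
      case (insert \<xi> B)
      have "frag_cmul n (frag_of \<xi>) \<in> H" "h (frag_cmul n (frag_of \<xi>)) = \<mu> \<xi> powi n" for n
        using partial_character_frag_cmul[OF H(1), of "frag_of \<xi>" n] H(4) insert.prems by (auto simp: \<mu>_def)
      then show ?case using insert partial_characterD(6,7)[OF H(1)] by simp
    qed (simp add: partial_characterD[OF H(1)])
    from this[OF \<open>finite A\<close>] have "h (\<Sum>\<xi>\<in>A. frag_cmul (Poly_Mapping.lookup x \<xi>) (frag_of \<xi>))
        = (\<Prod>\<xi>\<in>A. \<mu> \<xi> powi Poly_Mapping.lookup x \<xi>)" by simp
    moreover have "(\<Sum>\<xi>\<in>A. frag_cmul (Poly_Mapping.lookup x \<xi>) (frag_of \<xi>)) = x"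
    proof (rule poly_mapping_eqI)
      fix k
      have "Poly_Mapping.lookup (\<Sum>\<xi>\<in>A. frag_cmul (Poly_Mapping.lookup x \<xi>) (frag_of \<xi>)) k
          = (\<Sum>\<xi>\<in>A. if \<xi> = k then Poly_Mapping.lookup x \<xi> else 0)"
        unfolding lookup_sum by (rule sum.cong) (auto simp: lookup_single)
      also have "\<dots> = Poly_Mapping.lookup x k"
        using that \<open>finite A\<close> by (auto simp: in_keys_iff)
      finally show "Poly_Mapping.lookup (\<Sum>\<xi>\<in>A. frag_cmul (Poly_Mapping.lookup x \<xi>) (frag_of \<xi>)) k
          = Poly_Mapping.lookup x k" .
    qed
    ultimately show ?thesis by simp
  qed
  show ?thesis
  proof
    show "\<mu> \<in> A \<rightarrow>\<^sub>E - {0}"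
      using H(4) partial_characterD(3)[OF H(1)] by (auto simp: \<mu>_def)
    show "\<forall>x\<in>L. Poly_Mapping.keys x \<subseteq> A \<longrightarrow> (\<Prod>\<xi>\<in>A. \<mu> \<xi> powi Poly_Mapping.lookup x \<xi>) = 1"
      using prod H(3) H0 by auto
    show "(\<Prod>\<xi>\<in>A. \<mu> \<xi> powi Poly_Mapping.lookup a \<xi>) \<noteq> 1"
      using prod[OF a(2)] H(3)[OF H0(3)] H0(5) w(3) by simp
  qed
qed

section \<open>Polyhedra without lines\<close>

lemma recession_cone_halfspaces:
  assumes "P = {x. \<forall>i\<in>F. a i \<bullet> x \<le> b i}" "\<forall>i\<in>F. a i \<bullet> v \<le> 0"
  shows "v \<in> recession_cone P"
  unfolding recession_cone_def assms(1)
proof (intro CollectI ballI allI impI)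
  fix x i and t :: real assume x: "x \<in> {x. \<forall>i\<in>F. a i \<bullet> x \<le> b i}" and "0 \<le> t" "i \<in> F"
  then have "t * (a i \<bullet> v) \<le> 0" using assms(2) by (simp add: mult_nonneg_nonpos)
  then show "a i \<bullet> (x + t *\<^sub>R v) \<le> b i" using x \<open>i \<in> F\<close> by (fastforce simp: inner_add_right)
qed

text \<open>The ratio test of linear programming: go as far as the least quotient of slack and
  growth rate among the constraints that increase along \<open>d\<close>. The constraint attaining
  it becomes active, and those already active stay so.\<close>

lemma halfspaces_exit_point:
  fixes d :: "'a::euclidean_space"
  assumes "finite F" "\<forall>i\<in>F. a i \<bullet> x \<le> b i" "k \<in> F" "a k \<bullet> d > 0"
    and "\<forall>i\<in>F. a i \<bullet> x = b i \<longrightarrow> a i \<bullet> d = 0"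
  obtains t where "t > 0" "\<forall>i\<in>F. a i \<bullet> (x + t *\<^sub>R d) \<le> b i"
    "{i\<in>F. a i \<bullet> x = b i} \<subset> {i\<in>F. a i \<bullet> (x + t *\<^sub>R d) = b i}"
proof -
  define K where "K = {i\<in>F. a i \<bullet> d > 0}"
  have K: "finite K" "K \<noteq> {}" using assms by (auto simp: K_def)
  define r where "r i = (b i - a i \<bullet> x) / (a i \<bullet> d)" for i
  have r_pos: "r i > 0" if "i \<in> K" for i
    using that assms(2,5) by (force simp: K_def r_def)
  define t where "t = Min (r ` K)"
  have t: "t \<in> r ` K" "\<And>i. i \<in> K \<Longrightarrow> t \<le> r i" using K by (simp_all add: t_def)
  then obtain j where j: "j \<in> K" "t = r j" by blast
  show ?thesis
  proof
    show "t > 0" using j r_pos by simp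
    show "\<forall>i\<in>F. a i \<bullet> (x + t *\<^sub>R d) \<le> b i"
    proof
      fix i assume i: "i \<in> F"
      show "a i \<bullet> (x + t *\<^sub>R d) \<le> b i"
      proof (cases "i \<in> K")
        case True
        then show ?thesis using t(2)[OF True] by (simp add: K_def r_def inner_add_right field_simps)
      next
        case False
        then have "a i \<bullet> d \<le> 0" using i by (simp add: K_def)
        then have "t * (a i \<bullet> d) \<le> 0" using \<open>t > 0\<close> by (simp add: mult_nonneg_nonpos)
        then show ?thesis using assms(2) i by (fastforce simp: inner_add_right)
      qed
    qed
    have "a j \<bullet> (x + t *\<^sub>R d) = b j" "j \<in> F" "a j \<bullet> x \<noteq> b j"
      using j r_pos[OF j(1)] by (auto simp: K_def r_def inner_add_right)
    then show "{i\<in>F. a i \<bullet> x = b i} \<subset> {i\<in>F. a i \<bullet> (x + t *\<^sub>R d) = b i}"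
      using assms(5) by (auto simp: inner_add_right)
  qed
qed

text \<open>Induction on the number of inactive constraints: unless the active constraints determine the
  point, move along a direction that preserves them until a new one becomes active.\<close>

lemma halfspaces_extreme_recession:
  fixes P :: "'a::euclidean_space set"
  assumes F: "finite F" and P: "P = {x. \<forall>i\<in>F. a i \<bullet> x \<le> b i}"
    and pointed: "\<And>v. v \<in> recession_cone P \<Longrightarrow> - v \<in> recession_cone P \<Longrightarrow> v = 0"
    and "x \<in> P"
  shows "\<exists>y\<in>convex hull {p. p extreme_point_of P}. \<exists>v\<in>recession_cone P. x = y + v"
  using \<open>x \<in> P\<close>
proof (induction "card {i\<in>F. a i \<bullet> x \<noteq> b i}" arbitrary: x rule: less_induct)
  case less
  have rec_add: "u + v \<in> recession_cone P" if "u \<in> recession_cone P" "v \<in> recession_cone P" for u v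
    using that unfolding recession_cone_def by (simp add: scaleR_add_right flip: add.assoc)
  have rec_scale: "c *\<^sub>R v \<in> recession_cone P" if "v \<in> recession_cone P" "c \<ge> 0" for c v
    using that unfolding recession_cone_def by simp
  have conv: "convex (recession_cone P)"
    using rec_add rec_scale by (auto simp: convex_def)
  have xP: "\<forall>i\<in>F. a i \<bullet> x \<le> b i" using less.prems P by simp
  show ?case
  proof (cases "\<exists>d. d \<noteq> 0 \<and> (\<forall>i\<in>F. a i \<bullet> x = b i \<longrightarrow> a i \<bullet> d = 0)")
    case False
    have "x extreme_point_of P"
      unfolding extreme_point_of_def
    proof (intro conjI ballI notI)
      fix y z assume yz: "y \<in> P" "z \<in> P" "x \<in> open_segment y z"
      then obtain u where u: "0 < u" "u < 1" "x = (1 - u) *\<^sub>R y + u *\<^sub>R z" and "y \<noteq> z"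
        by (auto simp: in_segment)
      \<comment> \<open>A constraint tight inside a segment of \<open>P\<close> is tight at both
        ends, so the segment direction preserves all active constraints.\<close>
      have "a i \<bullet> (z - y) = 0" if i: "i \<in> F" "a i \<bullet> x = b i" for i
      proof -
        have le: "a i \<bullet> y \<le> b i" "a i \<bullet> z \<le> b i" using yz i P by auto
        have eq: "(1 - u) * (b i - a i \<bullet> y) + u * (b i - a i \<bullet> z) = 0"
          using i(2) by (simp add: u(3) inner_add_right algebra_simps)
        have "(1 - u) * (b i - a i \<bullet> y) \<ge> 0" "u * (b i - a i \<bullet> z) \<ge> 0" using u le by simp_all
        then have "(1 - u) * (b i - a i \<bullet> y) = 0" "u * (b i - a i \<bullet> z) = 0"
          using eq by linarith+
        then show ?thesis using u by (simp add: inner_diff_right)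
      qed
      then show False using False \<open>y \<noteq> z\<close> by (metis eq_iff_diff_eq_0)
    qed (use less.prems in simp)
    moreover have "0 \<in> recession_cone P" by (simp add: recession_cone_def)
    ultimately show ?thesis by (intro bexI[of _ x] bexI[of _ 0]) (auto intro: hull_inc)
  next
    case True
    then obtain d where d: "d \<noteq> 0" "\<And>i. i \<in> F \<Longrightarrow> a i \<bullet> x = b i \<Longrightarrow> a i \<bullet> d = 0" by blast
    have exit: "\<exists>t>0. \<exists>y\<in>convex hull {p. p extreme_point_of P}. \<exists>v\<in>recession_cone P. x + t *\<^sub>R e = y + v"
      if e: "e \<notin> recession_cone P" "\<And>i. i \<in> F \<Longrightarrow> a i \<bullet> x = b i \<Longrightarrow> a i \<bullet> e = 0" for e
    proof -
      obtain k where k: "k \<in> F" "a k \<bullet> e > 0"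
        using recession_cone_halfspaces[OF P, of e] e(1) not_le by blast
      obtain t where t: "t > 0" "\<forall>i\<in>F. a i \<bullet> (x + t *\<^sub>R e) \<le> b i"
        "{i\<in>F. a i \<bullet> x = b i} \<subset> {i\<in>F. a i \<bullet> (x + t *\<^sub>R e) = b i}"
        by (rule halfspaces_exit_point[OF F xP k]) (use e(2) in blast)+
      have "{i\<in>F. a i \<bullet> (x + t *\<^sub>R e) \<noteq> b i} \<subset> {i\<in>F. a i \<bullet> x \<noteq> b i}"
        using t(3) by blast
      then have "card {i\<in>F. a i \<bullet> (x + t *\<^sub>R e) \<noteq> b i} < card {i\<in>F. a i \<bullet> x \<noteq> b i}"
        using F by (intro psubset_card_mono) auto
      moreover have "x + t *\<^sub>R e \<in> P" unfolding P using t(2) by blast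
      ultimately show ?thesis using less.hyps t(1) by blast
    qed
    \<comment> \<open>With \<open>- e\<close> a recession direction, the way back from the exit
      point along \<open>e\<close> is absorbed into the recession part.\<close>
    have one: ?thesis if e: "e \<notin> recession_cone P" "- e \<in> recession_cone P"
      "\<And>i. i \<in> F \<Longrightarrow> a i \<bullet> x = b i \<Longrightarrow> a i \<bullet> e = 0" for e
    proof -
      obtain t y v where t: "t > 0" "y \<in> convex hull {p. p extreme_point_of P}" "v \<in> recession_cone P"
        "x + t *\<^sub>R e = y + v"
        using exit[of e] e(1,3) by blast
      have "x = y + (v + t *\<^sub>R (- e))" using t(4) by (simp add: algebra_simps)
      moreover have "v + t *\<^sub>R (- e) \<in> recession_cone P"
        using t(1) by (intro rec_add t(3) rec_scale e(2)) simp
      ultimately show ?thesis using t(2) by blast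
    qed
    have dm: "\<And>i. i \<in> F \<Longrightarrow> a i \<bullet> x = b i \<Longrightarrow> a i \<bullet> (- d) = 0" using d(2) by simp
    consider "d \<in> recession_cone P" "- d \<notin> recession_cone P" | "d \<notin> recession_cone P" "- d \<in> recession_cone P"
      | "d \<notin> recession_cone P" "- d \<notin> recession_cone P"
      using pointed d(1) by blast
    then show ?thesis
    proof cases
      case 1
      then show ?thesis using one[of "- d"] dm by simp
    next
      case 2
      then show ?thesis using one[of d] d by simp
    next
      case 3
      obtain t y v where t: "t > 0" "y \<in> convex hull {p. p extreme_point_of P}" "v \<in> recession_cone P"
        "x + t *\<^sub>R d = y + v"
        using exit[of d] 3(1) d(2) by blast
      obtain s z w where s: "s > 0" "z \<in> convex hull {p. p extreme_point_of P}" "w \<in> recession_cone P"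
        "x + s *\<^sub>R (- d) = z + w"
        using exit[of "- d"] 3(2) dm by blast
      \<comment> \<open>The weights for which the displacements \<open>t d\<close> and
        \<open>- s d\<close> cancel, making \<open>x\<close> a convex combination of the two exit
        points.\<close>
      let ?l = "s / (s + t)" and ?m = "t / (s + t)"
      have lm: "?l \<ge> 0" "?m \<ge> 0" "?l + ?m = 1" using s t by (auto simp flip: add_divide_distrib)
      have "?l * t = ?m * s" by simp
      then have "?l *\<^sub>R (x + t *\<^sub>R d) + ?m *\<^sub>R (x + s *\<^sub>R (- d)) = (?l + ?m) *\<^sub>R x"
        by (simp only: scaleR_add_right scaleR_add_left scaleR_scaleR scaleR_minus_right) simp
      then have "x = ?l *\<^sub>R (y + v) + ?m *\<^sub>R (z + w)" using lm(3) t(4) s(4) by simp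
      then have "x = (?l *\<^sub>R y + ?m *\<^sub>R z) + (?l *\<^sub>R v + ?m *\<^sub>R w)" by (simp add: scaleR_add_right)
      moreover have "?l *\<^sub>R y + ?m *\<^sub>R z \<in> convex hull {p. p extreme_point_of P}"
        using convex_convex_hull t s lm by (metis convexD)
      moreover have "?l *\<^sub>R v + ?m *\<^sub>R w \<in> recession_cone P"
        using conv t s lm by (metis convexD)
      ultimately show ?thesis by blast
    qed
  qed
qed

lemma polyhedron_extreme_recession:
  fixes P :: "'a::euclidean_space set"
  assumes "polyhedron P" and "\<And>v. v \<in> recession_cone P \<Longrightarrow> - v \<in> recession_cone P \<Longrightarrow> v = 0" and "x \<in> P"
  obtains y v where "y \<in> convex hull {p. p extreme_point_of P}" "v \<in> recession_cone P" "x = y + v"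
proof -
  obtain F where F: "finite F" "P = \<Inter> F" "\<And>h. h \<in> F \<Longrightarrow> \<exists>a b. a \<noteq> 0 \<and> h = {x. a \<bullet> x \<le> b}"
    using assms(1) unfolding polyhedron_def by auto
  then obtain a b where ab: "\<And>h. h \<in> F \<Longrightarrow> h = {x. a h \<bullet> x \<le> b h}" by metis
  have P_eq: "P = {x. \<forall>h\<in>F. a h \<bullet> x \<le> b h}"
  proof (intro equalityI subsetI CollectI ballI)
    show "a h \<bullet> x \<le> b h" if "x \<in> P" "h \<in> F" for x h
      using that F(2) ab[of h] by blast
    show "x \<in> P" if "x \<in> {x. \<forall>h\<in>F. a h \<bullet> x \<le> b h}" for x
      unfolding F(2) using that ab by blast
  qed
  show ?thesis
    using halfspaces_extreme_recession[OF F(1) P_eq assms(2) assms(3)] that by blast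
qed

section \<open>Extreme rays of pointed cones\<close>

definition ray :: "'a::real_vector \<Rightarrow> 'a set" where
  "ray t = {a *\<^sub>R t | a. a \<ge> 0}"

lemma convex_cone_hull_insert:
  assumes "x \<in> convex_cone hull (insert t T)"
  obtains c y where "c \<ge> 0" "y \<in> convex_cone hull T" "x = c *\<^sub>R t + y"
proof -
  let ?K = "{c *\<^sub>R t + y | c y. c \<ge> 0 \<and> y \<in> convex_cone hull T}"
  have "convex_cone hull (insert t T) \<subseteq> ?K"
  proof (rule hull_minimal)
    have "t = 1 *\<^sub>R t + 0" "\<And>y. y = 0 *\<^sub>R t + y" by simp_all
    then show "insert t T \<subseteq> ?K"
      using convex_cone_hull_contains_0[of T] hull_subset[of T convex_cone]
      by (smt (verit, best) insert_iff mem_Collect_eq subset_iff zero_le_one)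
    have zero: "0 \<in> ?K" using convex_cone_hull_contains_0[of T] by force
    have add: "x + y \<in> ?K" if xy: "x \<in> ?K" "y \<in> ?K" for x y
    proof -
      obtain c d x' y' where "x = c *\<^sub>R t + x'" "y = d *\<^sub>R t + y'" "c \<ge> 0" "d \<ge> 0"
        "x' \<in> convex_cone hull T" "y' \<in> convex_cone hull T" using xy by blast
      then have "x + y = (c + d) *\<^sub>R t + (x' + y')" "x' + y' \<in> convex_cone hull T" "c + d \<ge> 0"
        by (simp_all add: scaleR_add_left convex_cone_hull_add)
      then show ?thesis by blast
    qed
    have scale: "r *\<^sub>R x \<in> ?K" if xr: "x \<in> ?K" "0 \<le> r" for x and r :: real
    proof -
      obtain c x' where "x = c *\<^sub>R t + x'" "c \<ge> 0" "x' \<in> convex_cone hull T" using xr by blast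
      then have "r *\<^sub>R x = (r * c) *\<^sub>R t + r *\<^sub>R x'" "r *\<^sub>R x' \<in> convex_cone hull T" "r * c \<ge> 0"
        using xr(2) by (simp_all add: scaleR_add_right convex_cone_hull_mul)
      then show ?thesis by blast
    qed
    show "convex_cone ?K"
      by (subst convex_cone_iff) (use zero add scale in blast)
  qed
  then show ?thesis using assms that by blast
qed

lemma aff_dim_ray:
  fixes t :: "'a::euclidean_space"
  assumes "t \<noteq> 0"
  shows "aff_dim (ray t) = 1"
proof -
  have "t = 1 *\<^sub>R t" "0 = 0 *\<^sub>R t" by simp_all
  then have in_ray: "t \<in> ray t" "0 \<in> ray t" unfolding ray_def by (smt (verit) mem_Collect_eq zero_le_one)+
  have "ray t \<subseteq> span {t}" by (auto simp: ray_def span_scale span_base)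
  then have "span (ray t) = span {t}"
    using in_ray(1) by (simp add: span_eq span_base subset_iff)
  then have "dim (ray t) = dim {t}" by (metis dim_span)
  moreover have "dim {t} = 1" using assms by (simp add: dim_eq_card_independent)
  ultimately show ?thesis using in_ray(2) by (simp add: aff_dim_zero hull_inc)
qed

text \<open>For \<open>r > 1\<close> and nonzero \<open>x\<close>, the point \<open>x\<close> is
  interior to the segment from 0 to \<open>r x\<close>, so a face containing \<open>x\<close>
  contains both ends. Convexity handles factors below 1.\<close>

lemma face_of_convex_cone_scale:
  assumes C: "convex_cone C" and F: "F face_of C" and x: "x \<in> F" and c: "c \<ge> 0"
  shows "c *\<^sub>R x \<in> F"
proof (cases "x = 0 \<or> c = 1")
  case True
  then show ?thesis using x by auto
next
  case False
  have xC: "x \<in> C" using F x face_of_imp_subset by blast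
  have F_in: "p \<in> F \<and> q \<in> F" if "p \<in> C" "q \<in> C" "x \<in> open_segment p q" for p q
    using F that x unfolding face_of_def by blast
  have big: "0 \<in> F \<and> r *\<^sub>R x \<in> F" if "r > 1" for r
  proof (rule F_in)
    show "0 \<in> C" "r *\<^sub>R x \<in> C"
      using C that xC by (auto simp: convex_cone_contains_0 convex_cone_scaleR)
    show "x \<in> open_segment 0 (r *\<^sub>R x)"
      unfolding in_segment using False that by (auto intro!: exI[of _ "1 / r"])
  qed
  show ?thesis
  proof (cases "c > 1")
    case False
    have "(1 - c) *\<^sub>R 0 + c *\<^sub>R x \<in> F"
      using face_of_imp_convex[OF F] big[of 2] x c False by (intro convexD) auto
    then show ?thesis by simp
  qed (use big in blast)
qed

text \<open>If a point of the ray is a mean of \<open>p\<close> and \<open>q\<close>, the components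
  of \<open>p\<close> and \<open>q\<close> in the hull of \<open>T\<close> average to some
  \<open>g t\<close>. A positive \<open>g\<close> would put \<open>t\<close> into that hull.
  Otherwise the negative of this average lies in the cone too, so it is 0 by pointedness, which then
  kills both components.\<close>

lemma ray_face_of:
  fixes T :: "'a::euclidean_space set"
  assumes pointed: "\<And>z. z \<in> convex_cone hull (insert t T) \<Longrightarrow> - z \<in> convex_cone hull (insert t T) \<Longrightarrow> z = 0"
    and t: "t \<notin> convex_cone hull T"
  shows "ray t face_of (convex_cone hull (insert t T))"
  unfolding face_of_def
proof (intro conjI ballI impI)
  let ?C = "convex_cone hull (insert t T)" and ?C' = "convex_cone hull T"
  have sub: "?C' \<subseteq> ?C" by (rule hull_mono) blast
  have tC: "t \<in> ?C" by (simp add: hull_inc)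
  show "ray t \<subseteq> ?C" using tC by (auto simp: ray_def convex_cone_hull_mul)
  show "convex (ray t)"
    unfolding convex_def
  proof (intro ballI allI impI)
    fix x y and u v :: real assume "x \<in> ray t" "y \<in> ray t" "0 \<le> u" "0 \<le> v"
    then obtain a b where "x = a *\<^sub>R t" "y = b *\<^sub>R t" "a \<ge> 0" "b \<ge> 0" by (auto simp: ray_def)
    then have "u *\<^sub>R x + v *\<^sub>R y = (u * a + v * b) *\<^sub>R t" "u * a + v * b \<ge> 0"
      using \<open>0 \<le> u\<close> \<open>0 \<le> v\<close> by (simp_all add: scaleR_add_left)
    then show "u *\<^sub>R x + v *\<^sub>R y \<in> ray t" unfolding ray_def by blast
  qed
  fix p q x assume pq: "p \<in> ?C" "q \<in> ?C" and x: "x \<in> ray t" "x \<in> open_segment p q"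
  obtain u where u: "0 < u" "u < 1" "x = (1 - u) *\<^sub>R p + u *\<^sub>R q" using x(2) by (auto simp: in_segment)
  obtain r where r: "x = r *\<^sub>R t" "r \<ge> 0" using x(1) by (auto simp: ray_def)
  obtain c p' where p': "c \<ge> 0" "p' \<in> ?C'" "p = c *\<^sub>R t + p'" using pq(1) by (rule convex_cone_hull_insert)
  obtain d q' where q': "d \<ge> 0" "q' \<in> ?C'" "q = d *\<^sub>R t + q'" using pq(2) by (rule convex_cone_hull_insert)
  define w where "w = (1 - u) *\<^sub>R p' + u *\<^sub>R q'"
  have w: "w \<in> ?C'" unfolding w_def using p' q' u by (intro convex_cone_hull_add convex_cone_hull_mul) auto
  define g where "g = r - ((1 - u) * c + u * d)"
  have wg: "w = g *\<^sub>R t"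
    using u(3) unfolding r(1) p'(3) q'(3) w_def g_def by (simp add: algebra_simps)
  have "g \<le> 0"
  proof (rule ccontr)
    assume "\<not> g \<le> 0"
    then have "t = (1 / g) *\<^sub>R w" "1 / g \<ge> 0" unfolding wg by simp_all
    then show False using t w convex_cone_hull_mul by metis
  qed
  then have "- w \<in> ?C" unfolding wg using tC convex_cone_hull_mul[of t "insert t T" "- g"] by simp
  then have "w = 0" using pointed w sub by blast
  then have w0: "- ((1 - u) *\<^sub>R p') = u *\<^sub>R q'" "- (u *\<^sub>R q') = (1 - u) *\<^sub>R p'"
    by (simp_all add: w_def eq_neg_iff_add_eq_0 neg_eq_iff_add_eq_0 add.commute)
  have "p' \<in> ?C" "q' \<in> ?C" using p'(2) q'(2) sub by blast+
  then have "(1 - u) *\<^sub>R p' \<in> ?C" "u *\<^sub>R q' \<in> ?C"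
    using u by (simp_all add: convex_cone_hull_mul)
  then have "(1 - u) *\<^sub>R p' = 0" "u *\<^sub>R q' = 0"
    using pointed[of "(1 - u) *\<^sub>R p'"] pointed[of "u *\<^sub>R q'"] unfolding w0 by blast+
  then have "p' = 0" "q' = 0" using u by simp_all
  then show "p \<in> ray t" "q \<in> ray t" using p' q' by (auto simp: ray_def)
qed

text \<open>A generating subset of least cardinality is irredundant, so each of its elements spans
  an edge by \<open>ray_face_of\<close>. Conversely an edge contains a nonzero sum of generators and
  therefore, being a face, one of the generators.\<close>

lemma pointed_cone_rays:
  fixes T :: "'a::euclidean_space set"
  assumes "finite T" and C: "C = convex_cone hull T"
    and pointed: "\<And>z. z \<in> C \<Longrightarrow> - z \<in> C \<Longrightarrow> z = 0"
  obtains T' where "T' \<subseteq> T" "0 \<notin> T'" "C = convex_cone hull T'" "{\<xi>. \<xi> edge_of C} = ray ` T'"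
proof -
  have "\<exists>T'. T' \<subseteq> T \<and> convex_cone hull T' = C" using C by blast
  then obtain T' where T': "T' \<subseteq> T" "convex_cone hull T' = C"
    and min: "\<And>T''. T'' \<subseteq> T \<and> convex_cone hull T'' = C \<Longrightarrow> card T' \<le> card T''"
    using ex_has_least_nat[of "\<lambda>T'. T' \<subseteq> T \<and> convex_cone hull T' = C" _ card] by metis
  have fin: "finite T'" using T' \<open>finite T\<close> finite_subset by blast
  have indep: "t \<notin> convex_cone hull (T' - {t})" if t: "t \<in> T'" for t
  proof
    assume "t \<in> convex_cone hull (T' - {t})"
    then have "T' \<subseteq> convex_cone hull (T' - {t})"
      using hull_subset[of "T' - {t}" convex_cone] by blast
    then have "convex_cone hull T' \<subseteq> convex_cone hull (T' - {t})"
      by (rule hull_minimal) (rule convex_cone_convex_cone_hull)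
    then have "convex_cone hull (T' - {t}) = C"
      using T' hull_mono[of "T' - {t}" T' convex_cone] by blast
    then have "card T' \<le> card (T' - {t})" using T' by (intro min) blast
    then show False using card_Diff1_less[OF fin t] by simp
  qed
  have nz: "0 \<notin> T'" using indep convex_cone_hull_contains_0 by blast
  have cc: "convex_cone C" unfolding C by (rule convex_cone_convex_cone_hull)
  have face: "ray t face_of C" if t: "t \<in> T'" for t
  proof -
    have ins: "insert t (T' - {t}) = T'" using t by blast
    show ?thesis
      by (rule ray_face_of[of t "T' - {t}", unfolded ins T'(2)]) (fact pointed, fact indep[OF t])
  qed
  have "{\<xi>. \<xi> edge_of C} = ray ` T'"
  proof (intro equalityI subsetI)
    fix \<xi> assume "\<xi> \<in> ray ` T'"
    then obtain t where t: "t \<in> T'" "\<xi> = ray t" by blast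
    then have "t \<noteq> 0" using nz by blast
    then show "\<xi> \<in> {\<xi>. \<xi> edge_of C}"
      using face[OF t(1)] aff_dim_ray[of t] t(2) by (simp add: edge_of_def)
  next
    fix \<xi> assume "\<xi> \<in> {\<xi>. \<xi> edge_of C}"
    then have \<xi>: "\<xi> face_of C" "aff_dim \<xi> = 1" by (auto simp: edge_of_def)
    have "\<not> \<xi> \<subseteq> {0}"
      using \<xi>(2) aff_dim_subset[of \<xi> "{0}"] by auto
    then obtain x where x: "x \<in> \<xi>" "x \<noteq> 0" by blast
    have "x \<in> convex_cone hull T'" using x \<xi> T'(2) face_of_imp_subset by blast
    have "x \<in> \<xi> \<Longrightarrow> \<exists>t\<in>T'. t \<in> \<xi>" if "x \<in> convex_cone hull A" "A \<subseteq> T'" "x \<noteq> 0" "finite A" for x A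
      using that(4,1-3)
    proof (induction A arbitrary: x)
      case empty
      then show ?case by simp
    next
      case (insert t A)
      obtain c y where cy: "c \<ge> 0" "y \<in> convex_cone hull A" "x = c *\<^sub>R t + y"
        using insert.prems(2) by (rule convex_cone_hull_insert)
      have tT: "t \<in> T'" "t \<in> C" using insert.prems(3) T'(2) by (auto intro: hull_inc)
      have yC: "y \<in> C" using cy(2) insert.prems(3) T'(2) hull_mono[of A T' convex_cone] by blast
      \<comment> \<open>These two points have midpoint \<open>x\<close>. When they coincide the open
        segment is empty, but then both equal \<open>x\<close>.\<close>
      have both: "(2 * c) *\<^sub>R t \<in> \<xi> \<and> 2 *\<^sub>R y \<in> \<xi>"
      proof (cases "(2 * c) *\<^sub>R t = 2 *\<^sub>R y")
        case True
        then have "2 *\<^sub>R (c *\<^sub>R t) = 2 *\<^sub>R y" by simp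
        then have "c *\<^sub>R t = y" by (simp only: real_vector.scale_cancel_left) simp
        then have "2 *\<^sub>R y = x" using cy(3) by (simp add: scaleR_2)
        then show ?thesis using True insert.prems(1) by simp
      next
        case False
        have "x \<in> open_segment ((2 * c) *\<^sub>R t) (2 *\<^sub>R y)"
          unfolding in_segment cy(3) using False by (intro conjI exI[of _ "1/2"]) auto
        moreover have "(2 * c) *\<^sub>R t \<in> C" "2 *\<^sub>R y \<in> C"
          using cc tT yC cy(1) by (auto intro: convex_cone_scaleR)
        ultimately show ?thesis using \<xi>(1) insert.prems(1) unfolding face_of_def by blast
      qed
      show ?case
      proof (cases "c = 0")
        case True
        then show ?thesis using insert.IH[of x] cy insert.prems by simp
      next
        case False
        have "(1 / (2 * c)) *\<^sub>R ((2 * c) *\<^sub>R t) \<in> \<xi>"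
          by (rule face_of_convex_cone_scale[OF cc \<xi>(1)]) (use cy(1) both in auto)
        then show ?thesis using \<open>c \<noteq> 0\<close> tT by auto
      qed
    qed
    then obtain t where t: "t \<in> T'" "t \<in> \<xi>"
      using \<open>x \<in> convex_cone hull T'\<close> x fin by blast
    have sub: "ray t \<subseteq> \<xi>" using face_of_convex_cone_scale[OF cc \<xi>(1) t(2)] by (auto simp: ray_def)
    have "ray t face_of \<xi>" using face_of_subset[OF face[OF t(1)] sub] \<xi>(1) face_of_imp_subset by blast
    moreover have "aff_dim (ray t) = aff_dim \<xi>" using aff_dim_ray[of t] nz t(1) \<xi>(2) by metis
    ultimately have "ray t = \<xi>"
      using face_of_aff_dim_lt[OF face_of_imp_convex[OF \<xi>(1)]] by fastforce
    then show "\<xi> \<in> ray ` T'" using t(1) by blast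
  qed
  then show ?thesis using that[OF T'(1) nz] T'(2) by simp
qed

section \<open>The Cayley cone\<close>

definition rational_vec :: "real ^ 'n \<Rightarrow> bool" where
  "rational_vec x \<longleftrightarrow> (\<exists>N v. (N::int) > 0 \<and> real_vec v = of_int N *\<^sub>R x)"

lemma real_vec_simps [simp]:
  "real_vec (0 :: int ^ 'n) = 0" "real_vec (v + w) = real_vec v + real_vec w" "real_vec (v - w) = real_vec v - real_vec w"
  "real_vec (- v) = - real_vec v" "real_vec (n *s v) = of_int n *\<^sub>R real_vec v" "real_vec (axis i 1) = axis i 1"
  by (simp_all add: real_vec_def vec_eq_iff axis_def)

lemma real_vec_inner: "real_vec u \<bullet> real_vec v = of_int (\<Sum>i\<in>UNIV. u $ i * v $ i)"
  by (simp add: real_vec_def inner_vec_def)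

lemma real_vec_eq_0_iff [simp]: "real_vec v = 0 \<longleftrightarrow> v = 0"
  by (simp add: real_vec_def vec_eq_iff)

lemma rational_vec_real_vec: "rational_vec (real_vec v)"
  unfolding rational_vec_def by (intro exI[of _ 1] exI[of _ v]) simp

lemma rational_vec_zero: "rational_vec 0"
  using rational_vec_real_vec[of 0] by simp

lemma rational_vec_diff:
  assumes "rational_vec x" "rational_vec y"
  shows "rational_vec (x - y)"
proof -
  obtain N v M w where "N > 0" "real_vec v = of_int N *\<^sub>R x" "M > 0" "real_vec w = of_int M *\<^sub>R y"
    using assms unfolding rational_vec_def by blast
  then have "N * M > 0" "real_vec (M *s v - N *s w) = of_int (N * M) *\<^sub>R (x - y)"
    by (simp_all add: scaleR_diff_right mult.commute)
  then show ?thesis unfolding rational_vec_def by blast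
qed

lemma rational_vec_sum: "(\<And>i. i \<in> A \<Longrightarrow> rational_vec (f i)) \<Longrightarrow> rational_vec (\<Sum>i\<in>A. f i)"
proof (induction A rule: infinite_finite_induct)
  case (insert i A)
  then have "rational_vec (0 - (\<Sum>i\<in>A. f i))"
    using insert by (intro rational_vec_diff[OF rational_vec_zero]) simp
  then have "rational_vec (f i - (0 - (\<Sum>i\<in>A. f i)))" using insert.prems
    by (intro rational_vec_diff[of "f i"]) auto
  then show ?case using insert by simp
qed (simp_all add: rational_vec_zero)

lemma rational_vec_scale:
  assumes "real_vec s = r *\<^sub>R q" and r: "r = of_int m" "r > 0"
  shows "rational_vec q"
  unfolding rational_vec_def using assms by (intro exI[of _ m] exI[of _ s]) auto

text \<open>One integral formula for the shifts of all summands, so that \<open>Q_0\<close> is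
  handled together with the other \<open>Q_i\<close>.\<close>

definition cayley_shift :: "'k::finite option \<Rightarrow> int ^ 'k" where
  "cayley_shift j = (case j of None \<Rightarrow> - (\<Sum>i\<in>UNIV. axis i 1) | Some i \<Rightarrow> axis i 1)"

lemma real_vec_sum: "real_vec (\<Sum>i\<in>A. f i) = (\<Sum>i\<in>A. real_vec (f i))"
  by (induction A rule: infinite_finite_induct) simp_all

abbreviation "e_shift j \<equiv> real_vec (cayley_shift j)"

lemma cayley_cone_alt:
  "cayley_cone C Q = convex_cone hull ((\<lambda>n. (n, 0)) ` C \<union> (\<Union>j. (\<lambda>q. (q, e_shift j)) ` Q j))"
proof -
  have "(\<Union>j. (\<lambda>q. (q, e_shift j)) ` Q j)
      = (\<lambda>q. (q, e_shift None)) ` Q None \<union> (\<Union>i. (\<lambda>q. (q, e_shift (Some i))) ` Q (Some i))"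
    by (auto simp: UNIV_option_conv)
  then show ?thesis unfolding cayley_cone_def by (simp add: cayley_shift_def real_vec_sum Un_assoc)
qed

lemma dual_lattice_points_hull:
  "u \<in> dual_lattice_points (convex_cone hull T) \<longleftrightarrow> (\<forall>n\<in>T. real_pt u \<bullet> n \<ge> 0)"
proof
  show "u \<in> dual_lattice_points (convex_cone hull T) \<Longrightarrow> \<forall>n\<in>T. real_pt u \<bullet> n \<ge> 0"
    by (simp add: dual_lattice_points_def hull_inc)
next
  assume "\<forall>n\<in>T. real_pt u \<bullet> n \<ge> 0"
  then have "convex_cone hull T \<subseteq> {n. real_pt u \<bullet> n \<ge> 0}"
    by (intro hull_minimal convex_cone_halfspace_ge) auto
  then show "u \<in> dual_lattice_points (convex_cone hull T)"
    by (auto simp: dual_lattice_points_def)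
qed

lemma dual_lattice_points_cayley_cone:
  "u \<in> dual_lattice_points (cayley_cone C Q) \<longleftrightarrow>
     (\<forall>n\<in>C. real_vec (fst u) \<bullet> n \<ge> 0) \<and>
     (\<forall>j. \<forall>q\<in>Q j. real_vec (fst u) \<bullet> q + real_vec (snd u) \<bullet> e_shift j \<ge> 0)"
  unfolding cayley_cone_alt dual_lattice_points_hull by (auto simp: real_pt_def inner_prod_def ball_Un)

locale cayley_data =
  fixes S :: "(int ^ 'n) set" and \<sigma> :: "(real ^ 'n) set" and R :: "int ^ 'n"
    and Q :: "'k::finite option \<Rightarrow> (real ^ 'n) set"
  assumes finite_S: "finite S" and sigma: "\<sigma> = convex_cone hull (real_vec ` S)"
    and sc: "strongly_convex \<sigma>" and full: "dim \<sigma> = CARD('n)"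
    and mink: "minkowski_decomposition (slice \<sigma> R) Q"
    and rec: "\<And>j. recession_cone (Q j) = \<sigma> \<inter> {n. real_vec R \<bullet> n = 0}"
    and vertices: "at_most_one_nonlattice_vertex (slice \<sigma> R) Q"
    and Q0: "Q None \<subseteq> {n. real_vec R \<bullet> n = 1}"
    and Qi: "\<And>i. Q (Some i) \<subseteq> {n. real_vec R \<bullet> n = 0}"
begin

abbreviation "P \<equiv> slice \<sigma> R"

lemma sigma_cone: "convex_cone \<sigma>"
  unfolding sigma by (rule convex_cone_convex_cone_hull)

lemmas sigma_add = convex_cone_add[OF sigma_cone]
lemmas sigma_scale = convex_cone_scaleR[OF sigma_cone]

lemma sigma_polyhedron: "polyhedron \<sigma>"
  unfolding sigma using finite_S by (intro polyhedron_convex_cone_hull) simp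

lemma sigma_pointed: "z \<in> \<sigma> \<Longrightarrow> - z \<in> \<sigma> \<Longrightarrow> z = 0"
  using sc unfolding strongly_convex_def by force

lemma Q_polyhedron: "polyhedron (Q j)" and Q_nonempty: "Q j \<noteq> {}"
  using mink unfolding minkowski_decomposition_def by auto

lemma P_iff: "x \<in> P \<longleftrightarrow> (\<exists>qs. (\<forall>j. qs j \<in> Q j) \<and> x = (\<Sum>j\<in>UNIV. qs j))"
proof -
  have "P = {sum s UNIV |s. \<forall>i\<in>UNIV. s i \<in> Q i}"
    using mink set_sum_alt[of "UNIV :: 'k option set" Q] unfolding minkowski_decomposition_def by simp
  then show ?thesis by auto
qed

lemma P_polyhedron: "polyhedron P"
  unfolding slice_def by (intro polyhedron_Int sigma_polyhedron polyhedron_hyperplane)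

lemma P_nonempty: "P \<noteq> {}"
proof -
  have "\<forall>j. \<exists>x. x \<in> Q j" using Q_nonempty by blast
  then obtain qs where "\<forall>j. qs j \<in> Q j" by (rule choice[THEN exE])
  then show ?thesis using P_iff by blast
qed

lemma P_iff_sigma: "x \<in> P \<longleftrightarrow> x \<in> \<sigma> \<and> real_vec R \<bullet> x = 1"
  by (auto simp: slice_def)

text \<open>A recession direction \<open>v\<close> is the limit of \<open>(p + n v) / n\<close>, and
  \<open>\<sigma>\<close> is a closed cone. Since \<open>R\<close> is constant on the slice, it
  vanishes on \<open>v\<close>.\<close>

lemma recession_P: "recession_cone P \<subseteq> \<sigma> \<inter> {n. real_vec R \<bullet> n = 0}"
proof
  fix v assume v: "v \<in> recession_cone P"
  obtain p where p: "p \<in> P" using P_nonempty by blast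
  have in_P: "p + t *\<^sub>R v \<in> P" if "t \<ge> 0" for t
    using v p that unfolding recession_cone_def by blast
  have "real_vec R \<bullet> (p + 1 *\<^sub>R v) = 1" "real_vec R \<bullet> p = 1"
    using in_P[of 1] p unfolding P_iff_sigma by auto
  then have "real_vec R \<bullet> v = 0" by (simp add: inner_add_right)
  moreover have "v \<in> \<sigma>"
  proof (rule closed_sequentially[OF polyhedron_imp_closed[OF sigma_polyhedron]])
    show "(1 / real (Suc n)) *\<^sub>R (p + real (Suc n) *\<^sub>R v) \<in> \<sigma>" for n
      using in_P sigma_scale by (simp add: P_iff_sigma)
    have "(\<lambda>n. (1 / real (Suc n)) *\<^sub>R p + v) \<longlonglongrightarrow> 0 *\<^sub>R p + v"
      by (intro tendsto_intros LIMSEQ_Suc[OF lim_1_over_n])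
    moreover have "(1 / real (Suc n)) *\<^sub>R (p + real (Suc n) *\<^sub>R v) = (1 / real (Suc n)) *\<^sub>R p + v" for n
      by (simp add: scaleR_add_right del: of_nat_Suc)
    ultimately show "(\<lambda>n. (1 / real (Suc n)) *\<^sub>R (p + real (Suc n) *\<^sub>R v)) \<longlonglongrightarrow> v" by simp
  qed
  ultimately show "v \<in> \<sigma> \<inter> {n. real_vec R \<bullet> n = 0}" by simp
qed

lemma Q_decompose:
  assumes "x \<in> Q j"
  obtains y v where "y \<in> convex hull {p. p extreme_point_of Q j}" "v \<in> \<sigma>" "real_vec R \<bullet> v = 0" "x = y + v"
proof (rule polyhedron_extreme_recession[OF Q_polyhedron _ assms])
  fix v assume "v \<in> recession_cone (Q j)" "- v \<in> recession_cone (Q j)"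
  then show "v = 0" using sigma_pointed unfolding rec by blast
next
  fix y v assume "y \<in> convex hull {p. p extreme_point_of Q j}" "v \<in> recession_cone (Q j)" "x = y + v"
  then show thesis using that[of y v] unfolding rec by blast
qed

lemma P_decompose:
  assumes "x \<in> P"
  obtains y v where "y \<in> convex hull {p. p extreme_point_of P}" "v \<in> \<sigma>" "real_vec R \<bullet> v = 0" "x = y + v"
proof (rule polyhedron_extreme_recession[OF P_polyhedron _ assms])
  fix v assume "v \<in> recession_cone P" "- v \<in> recession_cone P"
  then show "v = 0" using sigma_pointed recession_P by blast
next
  fix y v assume "y \<in> convex hull {p. p extreme_point_of P}" "v \<in> recession_cone P" "x = y + v"
  then show thesis using that[of y v] recession_P by blast
qed

text \<open>A vertex of the slice spans an extreme ray of \<open>\<sigma>\<close>: if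
  \<open>y\<close> were not a multiple of \<open>q\<close>, then \<open>q\<close> could be moved
  both ways inside the slice along \<open>y - <R,y> q\<close>, a direction on which \<open>R\<close>
  vanishes.\<close>

lemma extreme_point_P_split:
  assumes q: "q extreme_point_of P" and xy: "x \<in> \<sigma>" "y \<in> \<sigma>" "x + y = q"
  shows "y = (real_vec R \<bullet> y) *\<^sub>R q"
proof (rule ccontr)
  let ?r = "real_vec R \<bullet> y"
  assume neq: "y \<noteq> ?r *\<^sub>R q"
  have qs: "q \<in> \<sigma>" "real_vec R \<bullet> q = 1" using q unfolding extreme_point_of_def P_iff_sigma by auto
  \<comment> \<open>Small enough that \<open>1 - e r\<close> and \<open>1 + e r - e\<close>, the
    coefficients of \<open>q\<close> in the two moved points, are nonnegative.\<close>
  define e where "e = 1 / (1 + \<bar>?r\<bar>)"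
  have e: "e > 0" "e \<le> 1" "e * \<bar>?r\<bar> \<le> 1" by (simp_all add: e_def field_simps)
  have e2: "e * ?r \<le> 1" "- (e * ?r) \<le> 1"
  proof -
    have "e * ?r \<le> e * \<bar>?r\<bar>" "e * (- ?r) \<le> e * \<bar>?r\<bar>" using e(1) by (intro mult_left_mono; simp)+
    then show "e * ?r \<le> 1" "- (e * ?r) \<le> 1" using e(3) by simp_all
  qed
  have e3: "1 + e * ?r - e \<ge> 0"
  proof -
    have "e * (1 - ?r) \<le> e * (1 + \<bar>?r\<bar>)" using e by (intro mult_left_mono) auto
    also have "\<dots> = 1" by (simp add: e_def)
    finally show ?thesis by (simp add: algebra_simps)
  qed
  define a where "a = q + e *\<^sub>R (y - ?r *\<^sub>R q)"
  define b where "b = q - e *\<^sub>R (y - ?r *\<^sub>R q)"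
  have a_eq: "a = (1 - e * ?r) *\<^sub>R q + e *\<^sub>R y"
    by (simp add: a_def algebra_simps)
  have b_eq: "b = (1 + e * ?r - e) *\<^sub>R q + e *\<^sub>R x"
    unfolding b_def xy(3)[symmetric] by (simp add: algebra_simps)
  have "a \<in> \<sigma>" unfolding a_eq using e e2 qs xy by (intro sigma_add sigma_scale) auto
  moreover have "b \<in> \<sigma>" unfolding b_eq using e e3 qs xy by (intro sigma_add sigma_scale) auto
  moreover have "real_vec R \<bullet> a = 1" "real_vec R \<bullet> b = 1"
    using qs by (simp_all add: a_def b_def inner_add_right inner_diff_right)
  ultimately have "a \<in> P" "b \<in> P" by (simp_all add: P_iff_sigma)
  moreover have "a - b = (2 * e) *\<^sub>R (y - ?r *\<^sub>R q)"
    unfolding a_def b_def by (simp add: algebra_simps flip: scaleR_2)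
  then have "a \<noteq> b" using e neq by auto
  moreover have "(1 - 1/2) *\<^sub>R (q + c) + (1/2) *\<^sub>R (q - c) = q" for c
    by (simp add: scaleR_add_right scaleR_diff_right flip: scaleR_add_left)
  then have "(1 - 1/2) *\<^sub>R a + (1/2) *\<^sub>R b = q" unfolding a_def b_def .
  then have "q \<in> open_segment a b"
    unfolding in_segment using \<open>a \<noteq> b\<close> by (intro conjI exI[of _ "1/2"]) auto
  ultimately show False using q unfolding extreme_point_of_def by blast
qed

text \<open>Some generator \<open>s\<close> of \<open>\<sigma>\<close> must lie on the extreme ray
  through \<open>q\<close>. As \<open><R,q> = 1\<close>, it equals \<open><R,s> q\<close>, and
  \<open><R,s>\<close> is an integer, positive because \<open>\<sigma>\<close> is pointed.\<close>

lemma extreme_point_P_rational: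
  assumes q: "q extreme_point_of P"
  shows "rational_vec q"
proof -
  have qs: "q \<in> \<sigma>" "real_vec R \<bullet> q = 1" using q unfolding extreme_point_of_def P_iff_sigma by auto
  \<comment> \<open>Generators are split off \<open>x\<close> one at a time and collected in
    \<open>y\<close>. The condition that \<open>R\<close> does not vanish on \<open>x\<close>
    survives whenever the generator split off is not yet the desired one.\<close>
  have "\<exists>s\<in>S. real_vec s = (real_vec R \<bullet> real_vec s) *\<^sub>R q \<and> real_vec R \<bullet> real_vec s \<noteq> 0"
    if "finite A" "A \<subseteq> S" "x \<in> convex_cone hull (real_vec ` A)" "y \<in> \<sigma>" "x + y = q" "real_vec R \<bullet> x \<noteq> 0" for A x y
    using that
  proof (induction A arbitrary: x y)
    case empty
    then show ?case by simp
  next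
    case (insert s A)
    obtain c x' where x': "c \<ge> 0" "x' \<in> convex_cone hull (real_vec ` A)" "x = c *\<^sub>R real_vec s + x'"
      using insert.prems(2) convex_cone_hull_insert[of x "real_vec s" "real_vec ` A"] by auto
    have in_sigma: "real_vec s \<in> \<sigma>" "x' \<in> \<sigma>"
      using insert.prems(1) x'(2) hull_mono[of "real_vec ` A" "real_vec ` S" convex_cone]
      unfolding sigma by (auto intro: hull_inc)
    have "c *\<^sub>R real_vec s \<in> \<sigma>" using in_sigma x'(1) sigma_scale by blast
    then have eq: "c *\<^sub>R real_vec s = (real_vec R \<bullet> c *\<^sub>R real_vec s) *\<^sub>R q"
      using insert.prems(3,4) in_sigma x'(3)
      by (intro extreme_point_P_split[OF q, of "x' + y"]) (auto intro: sigma_add simp: add_ac)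
    show ?case
    proof (cases "c = 0 \<or> real_vec R \<bullet> real_vec s = 0")
      case True
      then have "real_vec R \<bullet> x' \<noteq> 0" using insert.prems(5) x'(3) by (auto simp: inner_add_right)
      moreover have "x' + (c *\<^sub>R real_vec s + y) = q" using insert.prems(4) x'(3) by (simp add: add_ac)
      ultimately show ?thesis
        using insert.IH[of x' "c *\<^sub>R real_vec s + y"] insert.prems x' \<open>c *\<^sub>R real_vec s \<in> \<sigma>\<close> sigma_add by simp
    next
      case False
      have "c *\<^sub>R real_vec s = c *\<^sub>R ((real_vec R \<bullet> real_vec s) *\<^sub>R q)" using eq by simp
      then have "real_vec s = (real_vec R \<bullet> real_vec s) *\<^sub>R q" using False by (simp only: real_vector.scale_cancel_left) simp
      then show ?thesis using False insert.prems(1) by blast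
    qed
  qed
  from this[OF finite_S order_refl, of q 0] obtain s where s: "s \<in> S" "real_vec s = (real_vec R \<bullet> real_vec s) *\<^sub>R q"
      "real_vec R \<bullet> real_vec s \<noteq> 0"
    using qs convex_cone_contains_0[OF sigma_cone] unfolding sigma by auto
  define r where "r = real_vec R \<bullet> real_vec s"
  have "r > 0"
  proof (rule ccontr)
    assume "\<not> r > 0"
    then have "- q = (1 / - r) *\<^sub>R real_vec s" "1 / - r \<ge> 0"
      using s(2,3) unfolding r_def[symmetric] by (simp_all add: divide_simps)
    moreover have "real_vec s \<in> \<sigma>" using s(1) unfolding sigma by (simp add: hull_inc)
    ultimately have "- q \<in> \<sigma>" using sigma_scale by metis
    then have "q = 0" using sigma_pointed qs(1) by blast
    then show False using qs(2) by simp
  qed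
  then show ?thesis
    using rational_vec_scale[of s r q "\<Sum>i\<in>UNIV. R $ i * s $ i"] s(2) real_vec_inner[of R s] by (simp add: r_def)
qed

text \<open>A functional exposing \<open>p\<close> in \<open>Q_j\<close> attains its maximum over
  the slice at a vertex \<open>q\<close>, whose \<open>j\<close>-th summand must be
  \<open>p\<close>. All summands of \<open>q\<close> are vertices, so if \<open>p\<close> is not a
  lattice point the others are, and \<open>p\<close> is the rational point \<open>q\<close> minus
  lattice points.\<close>

lemma extreme_point_Q_rational:
  assumes p: "p extreme_point_of Q j"
  shows "rational_vec p"
proof -
  have pQ: "p \<in> Q j" using p by (simp add: extreme_point_of_def)
  have "{p} exposed_face_of Q j"
    using p exposed_face_of_polyhedron[OF Q_polyhedron] face_of_singleton by blast
  then obtain a b where ab: "Q j \<subseteq> {x. a \<bullet> x \<le> b}" "{p} = Q j \<inter> {x. a \<bullet> x = b}"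
    unfolding exposed_face_of_def by blast
  have apb: "a \<bullet> p = b" using ab(2) by blast
  \<comment> \<open>The recession directions of \<open>P\<close> are among these, so the supremum of
    \<open>a\<close> over \<open>P\<close> is its maximum over the vertices.\<close>
  have a_rec: "a \<bullet> v \<le> 0" if v: "v \<in> \<sigma>" "real_vec R \<bullet> v = 0" for v
  proof -
    have "v \<in> recession_cone (Q j)" using v rec by blast
    then have "p + 1 *\<^sub>R v \<in> Q j" using pQ zero_le_one unfolding recession_cone_def by blast
    then have "a \<bullet> (p + v) \<le> b" using ab(1) by auto
    then show ?thesis using apb by (simp add: inner_add_right)
  qed
  let ?V = "{q. q extreme_point_of P}"
  have V: "finite ?V" "?V \<noteq> {}"
    using finite_polyhedron_extreme_points[OF P_polyhedron] P_nonempty P_decompose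
    by (auto, metis convex_hull_empty empty_Collect_eq empty_iff)
  obtain q where q: "q \<in> ?V" "\<And>q'. q' \<in> ?V \<Longrightarrow> a \<bullet> q' \<le> a \<bullet> q"
  proof -
    have "Max ((\<lambda>q. a \<bullet> q) ` ?V) \<in> (\<lambda>q. a \<bullet> q) ` ?V" using V by (intro Max_in) auto
    then obtain q where "q \<in> ?V" "Max ((\<lambda>q. a \<bullet> q) ` ?V) = a \<bullet> q" by blast
    then show ?thesis using that V Max_ge[of "(\<lambda>q. a \<bullet> q) ` ?V"] by (metis finite_imageI imageI)
  qed
  have max: "a \<bullet> x \<le> a \<bullet> q" if x: "x \<in> P" for x
  proof -
    obtain y v where yv: "y \<in> convex hull ?V" "v \<in> \<sigma>" "real_vec R \<bullet> v = 0" "x = y + v"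
      using x by (rule P_decompose)
    have "convex hull ?V \<subseteq> {y. a \<bullet> y \<le> a \<bullet> q}"
      using q(2) by (intro hull_minimal convex_halfspace_le) auto
    then show ?thesis using yv a_rec[of v] by (auto simp: inner_add_right)
  qed
  have qP: "q \<in> P" using q(1) by (simp add: extreme_point_of_def)
  then obtain qs where qs: "\<And>i. qs i \<in> Q i" "q = (\<Sum>i\<in>UNIV. qs i)" using P_iff by auto
  \<comment> \<open>Replacing one summand stays inside \<open>P\<close>; this passes both the
    maximality and the extremality of \<open>q\<close> on to its summands.\<close>
  have exchange: "q - qs i + w \<in> P" if "w \<in> Q i" for i w
  proof -
    have "(\<Sum>l\<in>UNIV. (qs(i := w)) l) = w + (\<Sum>l\<in>UNIV - {i}. (qs(i := w)) l)"
      by (simp add: sum.remove[of UNIV i])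
    also have "(\<Sum>l\<in>UNIV - {i}. (qs(i := w)) l) = (\<Sum>l\<in>UNIV - {i}. qs l)" by (rule sum.cong) auto
    also have "\<dots> = q - qs i" unfolding qs(2) by (simp add: sum_diff1)
    finally have "q - qs i + w = (\<Sum>l\<in>UNIV. (qs(i := w)) l)" by simp
    moreover have "\<forall>l. (qs(i := w)) l \<in> Q l" using qs(1) that by simp
    ultimately show ?thesis unfolding P_iff by blast
  qed
  have "qs j = p"
  proof -
    have "a \<bullet> (q - qs j + p) \<le> a \<bullet> q" using max exchange pQ by blast
    then have "a \<bullet> p \<le> a \<bullet> qs j" by (simp add: inner_add_right inner_diff_right)
    moreover have "a \<bullet> qs j \<le> b" using ab(1) qs(1)[of j] by blast
    ultimately have "qs j \<in> Q j \<inter> {x. a \<bullet> x = b}" using apb qs(1)[of j] by simp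
    then show ?thesis using ab(2) by blast
  qed
  have "qs i extreme_point_of Q i" for i
    unfolding extreme_point_of_def
  proof (intro conjI ballI notI qs(1))
    fix u w assume uw: "u \<in> Q i" "w \<in> Q i" "qs i \<in> open_segment u w"
    then obtain t where t: "0 < t" "t < 1" "qs i = (1 - t) *\<^sub>R u + t *\<^sub>R w" "u \<noteq> w" by (auto simp: in_segment)
    have "(1 - t) *\<^sub>R (q - qs i + u) + t *\<^sub>R (q - qs i + w) = (q - qs i) + ((1 - t) *\<^sub>R u + t *\<^sub>R w)"
      by (simp add: algebra_simps)
    then have "(1 - t) *\<^sub>R (q - qs i + u) + t *\<^sub>R (q - qs i + w) = q" by (simp flip: t(3))
    then have "q \<in> open_segment (q - qs i + u) (q - qs i + w)"
      unfolding in_segment using t by (intro conjI exI[of _ t]) auto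
    then show False using exchange uw q(1) unfolding extreme_point_of_def by blast
  qed
  then have card: "card {i. qs i \<notin> range real_vec} \<le> 1"
    using vertices q(1) qs(2) unfolding at_most_one_nonlattice_vertex_def by blast
  show ?thesis
  proof (cases "p \<in> range real_vec")
    case True
    then show ?thesis using rational_vec_real_vec by blast
  next
    case False
    have lattice: "qs i \<in> range real_vec" if "i \<noteq> j" for i
    proof (rule ccontr)
      assume "qs i \<notin> range real_vec"
      then have "{i, j} \<subseteq> {i. qs i \<notin> range real_vec}" using False \<open>qs j = p\<close> by blast
      then have "card {i, j} \<le> 1" using card card_mono[of "{i. qs i \<notin> range real_vec}" "{i, j}"] by simp
      then show False using that by simp
    qed
    have "p = q - (\<Sum>i\<in>UNIV - {j}. qs i)"
      unfolding qs(2) \<open>qs j = p\<close>[symmetric] by (simp add: sum_diff1)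
    moreover have "rational_vec (\<Sum>i\<in>UNIV - {j}. qs i)"
    proof (rule rational_vec_sum)
      fix i assume "i \<in> UNIV - {j}"
      then obtain v where "qs i = real_vec v" using lattice by blast
      then show "rational_vec (qs i)" by (simp only: rational_vec_real_vec)
    qed
    ultimately show ?thesis
      using rational_vec_diff extreme_point_P_rational q(1) by blast
  qed
qed

end

section \<open>Primitive generators\<close>

text \<open>Both components as one integer vector, so that divisibility and gcd arguments run over a
  single index set.\<close>

definition coordinate :: "('n::finite, 'k::finite) lat \<Rightarrow> 'n + 'k \<Rightarrow> int" where
  "coordinate v s = (case s of Inl i \<Rightarrow> fst v $ i | Inr j \<Rightarrow> snd v $ j)"

lemma primitive_coordinate: "primitive v \<longleftrightarrow> (\<forall>d. (\<forall>s. d dvd coordinate v s) \<longrightarrow> is_unit d)"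
  by (simp add: primitive_def coordinate_def split_sum_all)

lemma lat_eq_coordinate: "v = w \<longleftrightarrow> (\<forall>s. coordinate v s = coordinate w s)"
  by (auto simp: coordinate_def split_sum_all prod_eq_iff vec_eq_iff)

lemma real_pt_eq_scale: "real_pt v = c *\<^sub>R real_pt w \<longleftrightarrow> (\<forall>s. of_int (coordinate v s) = c * of_int (coordinate w s))"
  by (auto simp: real_pt_def coordinate_def real_vec_def split_sum_all prod_eq_iff vec_eq_iff)

lemma real_pt_eq_0_iff [simp]: "real_pt v = 0 \<longleftrightarrow> v = 0"
  by (simp add: real_pt_def prod_eq_iff)

lemma real_pt_inner: "real_pt u \<bullet> real_pt v = of_int (pairing u v)"
  by (simp add: real_pt_def pairing_def inner_prod_def real_vec_inner)

lemma exists_primitive: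
  assumes "l \<noteq> 0"
  obtains v c where "primitive v" "c > 0" "real_pt v = c *\<^sub>R real_pt l"
proof -
  define g where "g = Gcd (range (coordinate l))"
  have "coordinate l s = 0 \<longleftrightarrow> coordinate l s = coordinate 0 s" for s
    by (simp add: coordinate_def split: sum.split)
  then have "g \<noteq> 0" using assms unfolding lat_eq_coordinate g_def by (auto simp: Gcd_0_iff)
  then have g: "g > 0" by (simp add: g_def order_less_le)
  have dvd: "g dvd coordinate l s" for s unfolding g_def by (rule Gcd_dvd) simp
  define v :: "('a, 'b) lat" where "v = (\<chi> i. fst l $ i div g, \<chi> j. snd l $ j div g)"
  have v: "coordinate v s = coordinate l s div g" for s
    by (simp add: v_def coordinate_def split: sum.split)
  show ?thesis
  proof
    show "primitive v"
      unfolding primitive_coordinate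
    proof (intro allI impI)
      fix d assume "\<forall>s. d dvd coordinate v s"
      then have d: "d dvd coordinate l s div g" for s unfolding v by blast
      have "d * g dvd coordinate l s" for s
      proof -
        obtain k where k: "coordinate l s = g * k" using dvd[of s] by blast
        then have "d dvd k" using d[of s] g by simp
        then show ?thesis unfolding k by (simp add: mult.commute mult_dvd_mono)
      qed
      then have "d * g dvd Gcd (range (coordinate l))" by (intro Gcd_greatest) blast
      then have "d * g dvd g" by (simp only: g_def)
      then show "is_unit d" using g by simp
    qed
    show "1 / real_of_int g > 0" using g by simp
    show "real_pt v = (1 / real_of_int g) *\<^sub>R real_pt l"
      unfolding real_pt_eq_scale v using dvd g by (simp add: real_of_int_div)
  qed
qed

text \<open>A nonzero coordinate gives \<open>c = q / p\<close> in lowest terms. Then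
  \<open>p\<close> divides all coordinates of \<open>v\<close> and \<open>q\<close> all those of
  \<open>w\<close>, so both are units, and positivity leaves \<open>c = 1\<close>.\<close>

lemma primitive_unique:
  assumes v: "primitive v" and w: "primitive w" and scale: "real_pt w = c *\<^sub>R real_pt v" "c > 0"
  shows "w = v"
proof -
  have eq: "of_int (coordinate w s) = c * of_int (coordinate v s)" for s
    using scale(1) unfolding real_pt_eq_scale by blast
  obtain s0 where s0: "coordinate v s0 \<noteq> 0"
    using v unfolding primitive_coordinate by (metis dvd_0_right not_is_unit_0)
  define h where "h = gcd (coordinate v s0) (coordinate w s0)"
  obtain p q where pq: "coordinate v s0 = p * h" "coordinate w s0 = q * h" "coprime p q"
    using gcd_coprime_exists[of "coordinate v s0" "coordinate w s0"] s0 unfolding h_def by auto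
  have h: "h \<noteq> 0" using s0 pq by auto
  have cpq: "of_int q = c * of_int p"
    using eq[of s0] h unfolding pq by simp
  have cross: "p * coordinate w s = q * coordinate v s" for s
  proof -
    have "real_of_int (p * coordinate w s) = of_int (q * coordinate v s)"
      using eq[of s] cpq by simp
    then show ?thesis by (simp only: of_int_eq_iff)
  qed
  have "p dvd coordinate v s" for s
    using cross[of s] pq(3) by (metis coprime_dvd_mult_right_iff dvd_triv_left)
  then have "is_unit p" using v unfolding primitive_coordinate by blast
  moreover have "q dvd coordinate w s" for s
    using cross[of s] pq(3) by (metis coprime_commute coprime_dvd_mult_right_iff dvd_triv_left)
  then have "is_unit q" using w unfolding primitive_coordinate by blast
  ultimately have "\<bar>p\<bar> = 1" "\<bar>q\<bar> = 1" by simp_all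
  then have "c = 1" using cpq scale(2) by (auto simp: abs_if split: if_splits)
  then show ?thesis using eq by (simp add: lat_eq_coordinate)
qed

text \<open>Justifies the definite description in \<open>ray_generator\<close> for rays through
  lattice points; the positive factor \<open>c\<close> preserves the signs of pairings.\<close>

lemma ray_generator_ray:
  assumes "l \<noteq> 0"
  obtains c where "c > 0" "real_pt (ray_generator (ray (real_pt l))) = c *\<^sub>R real_pt l"
proof -
  obtain v c where v: "primitive v" "c > 0" "real_pt v = c *\<^sub>R real_pt l"
    using assms by (rule exists_primitive)
  have "ray_generator (ray (real_pt l)) = v"
    unfolding ray_generator_def
  proof (rule the_equality)
    show "real_pt v \<in> ray (real_pt l) \<and> primitive v"
      using v unfolding ray_def by (auto intro: less_imp_le)
    fix w assume "real_pt w \<in> ray (real_pt l) \<and> primitive w"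
    then obtain a where w: "real_pt w = a *\<^sub>R real_pt l" "a \<ge> 0" "primitive w" unfolding ray_def by blast
    have "w \<noteq> 0"
    proof
      assume "w = 0"
      then have "\<forall>s. 2 dvd coordinate w s" by (simp add: coordinate_def split: sum.split)
      then have "is_unit (2 :: int)" using w(3) unfolding primitive_coordinate by blast
      then show False by simp
    qed
    then have "a \<noteq> 0" using w(1) real_pt_eq_0_iff[of w] by auto
    then have "a / c > 0" using w(2) v(2) by simp
    moreover have "real_pt w = (a / c) *\<^sub>R real_pt v" using w(1) v by simp
    ultimately show "w = v" using primitive_unique[OF v(1) w(3)] by blast
  qed
  then show ?thesis using that v by simp
qed

section \<open>Finite generation, pointedness and edges of the Cayley cone\<close>

context cayley_data
begin

abbreviation "\<sigma>' \<equiv> cayley_cone \<sigma> Q"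

inductive_set generators :: "('n, 'k) latR set" where
  cone: "n \<in> \<sigma> \<Longrightarrow> (n, 0) \<in> generators"
| summand: "q \<in> Q j \<Longrightarrow> (q, e_shift j) \<in> generators"

lemma cayley_hull: "\<sigma>' = convex_cone hull generators"
proof -
  have "generators = (\<lambda>n. (n, 0)) ` \<sigma> \<union> (\<Union>j. (\<lambda>q. (q, e_shift j)) ` Q j)"
    by (auto elim!: generators.cases intro: generators.intros)
  then show ?thesis by (simp add: cayley_cone_alt)
qed

text \<open>Integral multiples of the shifted vertices of the \<open>Q_j\<close>, together with
  \<open>S\<close>, are enough: each \<open>Q_j\<close> is the convex hull of its vertices plus
  recession directions, and the latter lie in \<open>\<sigma>\<close>. The multiples exist because
  the vertices are rational.\<close>

lemma finite_lattice_generators: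
  obtains L where "finite L" "\<sigma>' = convex_cone hull (real_pt ` L)"
    "\<forall>l\<in>L. \<exists>c>0. \<exists>g\<in>generators. real_pt l = c *\<^sub>R g"
proof -
  define V where "V j = {q. q extreme_point_of Q j}" for j
  have V: "finite (V j)" "V j \<subseteq> Q j" for j
    using finite_polyhedron_extreme_points[OF Q_polyhedron] by (auto simp: V_def extreme_point_of_def)
  have ex: "\<exists>l. \<exists>c>0. real_pt l = c *\<^sub>R (q, e_shift j)" if q: "q \<in> V j" for q j
  proof -
    have "rational_vec q" using q extreme_point_Q_rational unfolding V_def by blast
    then obtain N v where "N > 0" "real_vec v = of_int N *\<^sub>R q" unfolding rational_vec_def by blast
    then have "real_pt (v, N *s cayley_shift j) = of_int N *\<^sub>R (q, e_shift j)" "real_of_int N > 0"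
      by (simp_all add: real_pt_def)
    then show ?thesis by blast
  qed
  define f :: "'k option \<Rightarrow> real ^ 'n \<Rightarrow> ('n, 'k) lat"
    where "f j q = (SOME l. \<exists>c>0. real_pt l = c *\<^sub>R (q, e_shift j))" for j q
  have f: "\<exists>c>0. real_pt (f j q) = c *\<^sub>R (q, e_shift j)" if "q \<in> V j" for q j
    unfolding f_def by (rule someI_ex) (fact ex[OF that])
  define L where "L = (\<lambda>s. (s, 0)) ` S \<union> (\<Union>j. f j ` V j)"
  have in_sigma: "real_vec s \<in> \<sigma>" if "s \<in> S" for s
    using that unfolding sigma by (simp add: hull_inc)
  have gen: "\<exists>c>0. \<exists>g\<in>generators. real_pt l = c *\<^sub>R g" if l: "l \<in> L" for l
  proof -
    consider s where "s \<in> S" "l = (s, 0)" | j q where "q \<in> V j" "l = f j q"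
      using l unfolding L_def by blast
    then show ?thesis
    proof cases
      case 1
      then have "real_pt l = 1 *\<^sub>R (real_vec s, 0)" by (simp add: real_pt_def)
      then show ?thesis using generators.cone[OF in_sigma[OF 1(1)]] zero_less_one by blast
    next
      case 2
      then show ?thesis using f[OF 2(1)] generators.summand[of q j] V(2)[of j] by blast
    qed
  qed
  let ?K = "convex_cone hull (real_pt ` L)"
  have K_add: "x + y \<in> ?K" if "x \<in> ?K" "y \<in> ?K" for x y using that by (rule convex_cone_hull_add)
  have K_sigma: "(n, 0) \<in> ?K" if n: "n \<in> \<sigma>" for n
  proof -
    have "convex_cone {n. (n, 0) \<in> ?K}"
    proof (subst convex_cone_iff, intro conjI ballI allI impI)
      show "0 \<in> {n. (n, 0) \<in> ?K}"
        using convex_cone_hull_contains_0[of "real_pt ` L"] by (simp add: zero_prod_def)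
    next
      fix x y assume "x \<in> {n. (n, 0) \<in> ?K}" "y \<in> {n. (n, 0) \<in> ?K}"
      then have "(x, 0) + (y, 0) \<in> ?K" by (intro K_add) auto
      then show "x + y \<in> {n. (n, 0) \<in> ?K}" by simp
    next
      fix x and c :: real assume "x \<in> {n. (n, 0) \<in> ?K}" "0 \<le> c"
      then have "c *\<^sub>R (x, 0) \<in> ?K" by (intro convex_cone_hull_mul) auto
      then show "c *\<^sub>R x \<in> {n. (n, 0) \<in> ?K}" by simp
    qed
    moreover have "real_vec s \<in> {n. (n, 0) \<in> ?K}" if "s \<in> S" for s
    proof -
      have "real_pt (s, 0) \<in> real_pt ` L" using that unfolding L_def by blast
      then show ?thesis by (simp add: real_pt_def hull_inc)
    qed
    ultimately have "\<sigma> \<subseteq> {n. (n, 0) \<in> ?K}" unfolding sigma by (intro hull_minimal) auto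
    then show ?thesis using n by blast
  qed
  have K_Q: "(q, e_shift j) \<in> ?K" if q: "q \<in> Q j" for q j
  proof -
    let ?e = "e_shift j"
    obtain y v where yv: "y \<in> convex hull V j" "v \<in> \<sigma>" "q = y + v"
      using q unfolding V_def by (rule Q_decompose)
    have "convex {y. (y, ?e) \<in> ?K}"
      unfolding convex_def
    proof (intro ballI allI impI CollectI)
      fix x y and a b :: real
      assume *: "x \<in> {y. (y, ?e) \<in> ?K}" "y \<in> {y. (y, ?e) \<in> ?K}" "0 \<le> a" "0 \<le> b" "a + b = 1"
      have "a *\<^sub>R (x, ?e) + b *\<^sub>R (y, ?e) = (a *\<^sub>R x + b *\<^sub>R y, (a + b) *\<^sub>R ?e)" by (simp add: scaleR_add_left)
      moreover have "a *\<^sub>R (x, ?e) + b *\<^sub>R (y, ?e) \<in> ?K"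
        using * by (intro K_add convex_cone_hull_mul) auto
      ultimately show "(a *\<^sub>R x + b *\<^sub>R y, ?e) \<in> ?K" using *(5) by simp
    qed
    moreover have "(y, ?e) \<in> ?K" if y: "y \<in> V j" for y
    proof -
      obtain c where c: "c > 0" "real_pt (f j y) = c *\<^sub>R (y, ?e)" using f[OF y] by blast
      have "f j y \<in> L" using y unfolding L_def by blast
      then have "(1 / c) *\<^sub>R real_pt (f j y) \<in> ?K" using c(1) by (intro convex_cone_hull_mul hull_inc) auto
      then show ?thesis using c by simp
    qed
    ultimately have "convex hull V j \<subseteq> {y. (y, ?e) \<in> ?K}" by (intro hull_minimal) auto
    then have "(y, ?e) + (v, 0) \<in> ?K" using yv K_sigma by (intro K_add) auto
    then show ?thesis using yv(3) by simp
  qed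
  have "\<sigma>' = ?K"
  proof
    show "\<sigma>' \<subseteq> ?K"
      unfolding cayley_hull
      by (intro hull_minimal convex_cone_convex_cone_hull) (auto elim!: generators.cases intro: K_sigma K_Q)
    have "real_pt ` L \<subseteq> \<sigma>'"
    proof
      fix x assume "x \<in> real_pt ` L"
      then obtain c g where "c > 0" "g \<in> generators" "x = c *\<^sub>R g" using gen by blast
      then show "x \<in> \<sigma>'" unfolding cayley_hull by (simp add: convex_cone_hull_mul hull_inc)
    qed
    then show "?K \<subseteq> \<sigma>'" unfolding cayley_hull by (intro hull_minimal convex_cone_convex_cone_hull)
  qed
  moreover have "finite L" unfolding L_def using finite_S V(1) by simp
  ultimately show ?thesis using that gen by blast
qed

lemma Q_convex_combination:
  assumes "a \<ge> 0" "b \<ge> 0" "x \<in> Q j" "y \<in> Q j"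
  shows "\<exists>z\<in>Q j. a *\<^sub>R x + b *\<^sub>R y = (a + b) *\<^sub>R z"
proof (cases "a + b = 0")
  case True
  then have "a = 0" "b = 0" using assms by simp_all
  then show ?thesis using assms(3) by auto
next
  case False
  have "(a / (a + b)) *\<^sub>R x + (b / (a + b)) *\<^sub>R y \<in> Q j"
    using assms False polyhedron_imp_convex[OF Q_polyhedron]
    by (intro convexD) (auto simp flip: add_divide_distrib)
  moreover have "a *\<^sub>R x + b *\<^sub>R y = (a + b) *\<^sub>R ((a / (a + b)) *\<^sub>R x + (b / (a + b)) *\<^sub>R y)"
    using False by (simp add: scaleR_add_right)
  ultimately show ?thesis by blast
qed

text \<open>Convexity merges all contributions of one \<open>Q_j\<close> into a multiple of a single
  point. If its coefficient is 0 the point is arbitrary, supplied by nonemptiness of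
  \<open>Q_j\<close>.\<close>

lemma cayley_cone_elements:
  assumes "z \<in> \<sigma>'"
  obtains s a q where "s \<in> \<sigma>" "\<forall>j. a j \<ge> 0" "\<forall>j. q j \<in> Q j"
    "z = (s + (\<Sum>j\<in>UNIV. a j *\<^sub>R q j), \<Sum>j\<in>UNIV. a j *\<^sub>R e_shift j)"
proof -
  define rep where "rep z s a q \<longleftrightarrow> s \<in> \<sigma> \<and> (\<forall>j. a j \<ge> 0) \<and> (\<forall>j. q j \<in> Q j) \<and>
    z = (s + (\<Sum>j\<in>UNIV. a j *\<^sub>R q j), \<Sum>j\<in>UNIV. a j *\<^sub>R e_shift j :: real ^ 'k)" for z s a q
  let ?K = "{z. \<exists>s a q. rep z s a q}"
  have "\<forall>j. \<exists>x. x \<in> Q j" using Q_nonempty by blast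
  then obtain q0 where q0: "\<forall>j. q0 j \<in> Q j" by (rule choice[THEN exE])
  have K_I: "z \<in> ?K" if "s \<in> \<sigma>" "\<forall>j. a j \<ge> 0" "\<forall>j. q j \<in> Q j"
    "z = (s + (\<Sum>j\<in>UNIV. a j *\<^sub>R q j), \<Sum>j\<in>UNIV. a j *\<^sub>R e_shift j)" for z s a q
  proof -
    have "rep z s a q" using that unfolding rep_def by blast
    then show ?thesis by blast
  qed
  have K_E: "\<exists>s a q. rep z s a q" if "z \<in> ?K" for z using that by blast
  have K_sigma: "(n, 0) \<in> ?K" if "n \<in> \<sigma>" for n
    by (rule K_I[OF that, of "\<lambda>_. 0" q0]) (use q0 in simp_all)
  have K_Q: "(q, e_shift j) \<in> ?K" if "q \<in> Q j" for q j
  proof -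
    define a where "a i = (if i = j then 1 else 0 :: real)" for i
    define q' where "q' = q0(j := q)"
    have "(\<Sum>i\<in>UNIV. a i *\<^sub>R q' i) = (\<Sum>i\<in>UNIV. if i = j then q else 0)"
      "(\<Sum>i\<in>UNIV. a i *\<^sub>R e_shift i) = (\<Sum>i\<in>UNIV. if i = j then e_shift j else (0 :: real ^ 'k))"
      by (rule sum.cong; simp add: a_def q'_def)+
    then have *: "(q, e_shift j) = (0 + (\<Sum>i\<in>UNIV. a i *\<^sub>R q' i), \<Sum>i\<in>UNIV. a i *\<^sub>R e_shift i)"
      by simp
    show ?thesis
      by (rule K_I[OF _ _ _ *]) (use convex_cone_contains_0[OF sigma_cone] q0 that in \<open>auto simp: a_def q'_def\<close>)
  qed
  have K_add: "x + y \<in> ?K" if xy: "x \<in> ?K" "y \<in> ?K" for x y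
  proof -
    obtain s a q where x: "x = (s + (\<Sum>j\<in>UNIV. a j *\<^sub>R q j), \<Sum>j\<in>UNIV. a j *\<^sub>R e_shift j)"
      "s \<in> \<sigma>" "\<forall>j. a j \<ge> 0" "\<forall>j. q j \<in> Q j" using K_E[OF xy(1)] unfolding rep_def by (elim exE conjE)
    obtain t b r where y: "y = (t + (\<Sum>j\<in>UNIV. b j *\<^sub>R r j), \<Sum>j\<in>UNIV. b j *\<^sub>R e_shift j)"
      "t \<in> \<sigma>" "\<forall>j. b j \<ge> 0" "\<forall>j. r j \<in> Q j" using K_E[OF xy(2)] unfolding rep_def by (elim exE conjE)
    have "\<forall>j. \<exists>z. z \<in> Q j \<and> a j *\<^sub>R q j + b j *\<^sub>R r j = (a j + b j) *\<^sub>R z"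
    proof
      show "\<exists>z. z \<in> Q j \<and> a j *\<^sub>R q j + b j *\<^sub>R r j = (a j + b j) *\<^sub>R z" for j
        using Q_convex_combination[of "a j" "b j" "q j" j "r j"] x(3,4) y(3,4) by blast
    qed
    then obtain z where "\<forall>j. z j \<in> Q j \<and> a j *\<^sub>R q j + b j *\<^sub>R r j = (a j + b j) *\<^sub>R z j" by (rule choice[THEN exE])
    then have z: "\<And>j. z j \<in> Q j" "\<And>j. a j *\<^sub>R q j + b j *\<^sub>R r j = (a j + b j) *\<^sub>R z j" by blast+
    have "x + y = ((s + t) + (\<Sum>j\<in>UNIV. a j *\<^sub>R q j + b j *\<^sub>R r j), \<Sum>j\<in>UNIV. (a j + b j) *\<^sub>R e_shift j)"
      unfolding x(1) y(1) by (simp add: sum.distrib scaleR_add_left)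
    then have *: "x + y = ((s + t) + (\<Sum>j\<in>UNIV. (a j + b j) *\<^sub>R z j), \<Sum>j\<in>UNIV. (a j + b j) *\<^sub>R e_shift j)"
      unfolding z(2) .
    show ?thesis
      by (rule K_I[OF _ _ _ *]) (use x(2,3) y(2,3) z(1) sigma_add in simp_all)
  qed
  have K_scale: "c *\<^sub>R x \<in> ?K" if xc: "x \<in> ?K" "c \<ge> 0" for x and c :: real
  proof -
    obtain s a q where x: "x = (s + (\<Sum>j\<in>UNIV. a j *\<^sub>R q j), \<Sum>j\<in>UNIV. a j *\<^sub>R e_shift j)"
      "s \<in> \<sigma>" "\<forall>j. a j \<ge> 0" "\<forall>j. q j \<in> Q j" using K_E[OF xc(1)] unfolding rep_def by (elim exE conjE)
    have *: "c *\<^sub>R x = (c *\<^sub>R s + (\<Sum>j\<in>UNIV. (c * a j) *\<^sub>R q j), \<Sum>j\<in>UNIV. (c * a j) *\<^sub>R e_shift j)"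
      unfolding x(1) by (simp add: scaleR_add_right scaleR_sum_right)
    show ?thesis
      by (rule K_I[OF _ _ _ *]) (use x(2-4) xc(2) sigma_scale in simp_all)
  qed
  have zero: "0 \<in> ?K" using K_sigma[OF convex_cone_contains_0[OF sigma_cone]] unfolding zero_prod_def .
  have "convex_cone ?K" by (subst convex_cone_iff) (use zero K_add K_scale in blast)
  moreover have "generators \<subseteq> ?K"
  proof
    fix x assume "x \<in> generators"
    moreover obtain n c where x: "x = (n, c)" by (cases x)
    ultimately have "(n, c) \<in> generators" by simp
    then show "x \<in> ?K" unfolding x
    proof cases
      case cone
      show "(n, c) \<in> ?K" unfolding \<open>c = 0\<close> by (rule K_sigma) fact
    next
      case (summand j)
      show "(n, c) \<in> ?K" unfolding \<open>c = _\<close> by (rule K_Q) fact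
    qed
  qed
  ultimately have "\<sigma>' \<subseteq> ?K" unfolding cayley_hull by (intro hull_minimal)
  then obtain s a q where "rep z s a q" using assms by blast
  then show ?thesis unfolding rep_def by (elim conjE) (rule that)
qed

lemma shift_sum:
  fixes a :: "'k option \<Rightarrow> real"
  shows "(\<Sum>j\<in>UNIV. a j *\<^sub>R e_shift j) $ i = a (Some i) - a None"
proof -
  have "(\<Sum>j\<in>UNIV. a j *\<^sub>R e_shift j) $ i
      = a None * (e_shift None $ i) + (\<Sum>l\<in>UNIV. a (Some l) * (e_shift (Some l) $ i))"
    by (simp add: UNIV_option_conv sum.reindex)
  also have "real_vec (cayley_shift (None :: 'k option)) $ i = - 1"
    by (simp add: cayley_shift_def real_vec_sum) (simp add: axis_def)
  also have "(\<Sum>l\<in>UNIV. a (Some l) * (e_shift (Some l) $ i)) = a (Some i)"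
    by (simp add: cayley_shift_def) (simp add: axis_def if_distrib sum.delta cong: if_cong)
  finally show ?thesis by simp
qed

lemma R_Q: "q \<in> Q j \<Longrightarrow> real_vec R \<bullet> q = (if j = None then 1 else 0)"
  using Q0 Qi by (cases j) auto

text \<open>In the sum of representations of \<open>z\<close> and \<open>- z\<close>, vanishing of
  the \<open>e_i\<close>-coordinates forces all coefficients of the \<open>Q_j\<close> to be one
  number \<open>\<alpha>\<close>. Their contribution is then \<open>\<alpha> p\<close> with
  \<open>p\<close> in the slice. Pointedness of \<open>\<sigma>\<close> gives
  \<open>\<alpha> p = 0\<close>, and \<open><R,p> = 1\<close> gives
  \<open>\<alpha> = 0\<close>.\<close>

lemma cayley_pointed:
  assumes "z \<in> \<sigma>'" "- z \<in> \<sigma>'"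
  shows "z = 0"
proof -
  obtain s a q where z: "s \<in> \<sigma>" "\<forall>j. a j \<ge> 0" "\<forall>j. q j \<in> Q j"
    "z = (s + (\<Sum>j\<in>UNIV. a j *\<^sub>R q j), \<Sum>j\<in>UNIV. a j *\<^sub>R e_shift j)"
    using assms(1) by (rule cayley_cone_elements)
  obtain t b r where mz: "t \<in> \<sigma>" "\<forall>j. b j \<ge> 0" "\<forall>j. r j \<in> Q j"
    "- z = (t + (\<Sum>j\<in>UNIV. b j *\<^sub>R r j), \<Sum>j\<in>UNIV. b j *\<^sub>R e_shift j)"
    using assms(2) by (rule cayley_cone_elements)
  have "\<forall>j. \<exists>z. z \<in> Q j \<and> a j *\<^sub>R q j + b j *\<^sub>R r j = (a j + b j) *\<^sub>R z"
  proof
    show "\<exists>z. z \<in> Q j \<and> a j *\<^sub>R q j + b j *\<^sub>R r j = (a j + b j) *\<^sub>R z" for j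
      using Q_convex_combination[of "a j" "b j" "q j" j "r j"] z(2,3) mz(2,3) by blast
  qed
  then obtain w where "\<forall>j. w j \<in> Q j \<and> a j *\<^sub>R q j + b j *\<^sub>R r j = (a j + b j) *\<^sub>R w j" by (rule choice[THEN exE])
  then have w: "\<And>j. w j \<in> Q j" "\<And>j. a j *\<^sub>R q j + b j *\<^sub>R r j = (a j + b j) *\<^sub>R w j" by blast+
  have "z + (- z) = ((s + t) + (\<Sum>j\<in>UNIV. a j *\<^sub>R q j + b j *\<^sub>R r j), \<Sum>j\<in>UNIV. (a j + b j) *\<^sub>R e_shift j)"
    unfolding mz(4) unfolding z(4) by (simp add: sum.distrib scaleR_add_left)
  then have fst0: "(s + t) + (\<Sum>j\<in>UNIV. (a j + b j) *\<^sub>R w j) = 0"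
    and snd0: "(\<Sum>j\<in>UNIV. (a j + b j) *\<^sub>R e_shift j) = (0 :: real ^ 'k)"
    unfolding w(2) by (simp_all add: zero_prod_def)
  define \<alpha> where "\<alpha> = a None + b None"
  have \<alpha>: "a j + b j = \<alpha>" for j
  proof (cases j)
    case (Some i)
    have "a (Some i) + b (Some i) - (a None + b None) = 0"
      using shift_sum[of "\<lambda>j. a j + b j" i] unfolding snd0 by simp
    then show ?thesis by (simp add: Some \<alpha>_def)
  qed (simp add: \<alpha>_def)
  have ab: "a j \<ge> 0" "b j \<ge> 0" for j using z(2) mz(2) by blast+
  then have "\<alpha> \<ge> 0" by (simp add: \<alpha>_def)
  define p where "p = (\<Sum>j\<in>UNIV. w j)"
  have p: "p \<in> P" unfolding P_iff p_def using w(1) by blast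
  then have p_sigma: "\<alpha> *\<^sub>R p \<in> \<sigma>" using \<open>\<alpha> \<ge> 0\<close> sigma_scale by (simp add: P_iff_sigma)
  have sum0: "s + t + \<alpha> *\<^sub>R p = 0" using fst0 unfolding \<alpha> p_def by (simp add: scaleR_sum_right)
  have "- (\<alpha> *\<^sub>R p) = s + t" using sum0 by (simp add: neg_eq_iff_add_eq_0 add.commute)
  then have "\<alpha> *\<^sub>R p = 0" using sigma_pointed[OF p_sigma] sigma_add z(1) mz(1) by simp
  then have "\<alpha> * (real_vec R \<bullet> p) = 0" by (metis inner_scaleR_right inner_zero_right)
  then have "\<alpha> = 0" using p by (simp add: P_iff_sigma)
  then have "a j = 0" for j using \<alpha>[of j] ab[of j] by simp
  moreover have "s = 0"
  proof (rule sigma_pointed[OF z(1)])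
    have "s + t = 0" using sum0 \<open>\<alpha> = 0\<close> by simp
    then have "- s = t" by (simp add: neg_eq_iff_add_eq_0)
    then show "- s \<in> \<sigma>" using mz(1) by simp
  qed
  ultimately show ?thesis using z(4) by (simp add: zero_prod_def)
qed

lemma cayley_rays:
  obtains L where "finite (L :: ('n, 'k) lat set)" "\<forall>l\<in>L. l \<noteq> 0" "rays \<sigma>' = ray ` real_pt ` L"
    "\<sigma>' = convex_cone hull (real_pt ` L)" "\<forall>l\<in>L. \<exists>c>0. \<exists>g\<in>generators. real_pt l = c *\<^sub>R g"
proof -
  obtain L where L: "finite L" "\<sigma>' = convex_cone hull (real_pt ` L)"
    "\<forall>l\<in>L. \<exists>c>0. \<exists>g\<in>generators. real_pt l = c *\<^sub>R g"
    using finite_lattice_generators by blast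
  obtain T where T: "T \<subseteq> real_pt ` L" "0 \<notin> T" "\<sigma>' = convex_cone hull T" "{\<xi>. \<xi> edge_of \<sigma>'} = ray ` T"
    by (rule pointed_cone_rays[OF finite_imageI[OF L(1), of real_pt] L(2) cayley_pointed])
  obtain L' where L': "L' \<subseteq> L" "T = real_pt ` L'" using T(1) by (auto simp: subset_image_iff)
  show ?thesis
  proof
    show "finite L'" using L' L(1) finite_subset by blast
    show "\<forall>l\<in>L'. l \<noteq> 0"
    proof
      show "l \<noteq> 0" if "l \<in> L'" for l
        using that T(2) unfolding L'(2) by (metis imageI real_pt_eq_0_iff)
    qed
    show "rays \<sigma>' = ray ` real_pt ` L'" using T(4) L'(2) by (simp add: rays_def)
    show "\<sigma>' = convex_cone hull (real_pt ` L')" using T(3) L'(2) by simp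
    show "\<forall>l\<in>L'. \<exists>c>0. \<exists>g\<in>generators. real_pt l = c *\<^sub>R g" using L(3) L'(1) by blast
  qed
qed

lemma finite_rays: "finite (rays \<sigma>')"
  by (rule cayley_rays) simp

text \<open>Reduces signs of pairings with the edge generators to signs on \<open>\<sigma>\<close>
  and on the shifted \<open>Q_j\<close>, where \<open>R\<close> and the \<open>e_i\<close> are
  known.\<close>

lemma ray_generator_type:
  assumes "\<xi> \<in> rays \<sigma>'"
  obtains c g where "c > 0" "g \<in> generators" "real_pt (ray_generator \<xi>) = c *\<^sub>R g"
proof -
  obtain L where L: "\<forall>l\<in>L. l \<noteq> 0" "rays \<sigma>' = ray ` real_pt ` L"
    "\<forall>l\<in>L. \<exists>c>0. \<exists>g\<in>generators. real_pt l = c *\<^sub>R g"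
    by (rule cayley_rays)
  obtain l where l: "l \<in> L" "\<xi> = ray (real_pt l)" using assms L(2) by blast
  obtain c where c: "c > 0" "real_pt (ray_generator \<xi>) = c *\<^sub>R real_pt l"
    using ray_generator_ray[of l] L(1) l by metis
  obtain d g where d: "d > 0" "g \<in> generators" "real_pt l = d *\<^sub>R g" using L(3) l(1) by blast
  have "real_pt (ray_generator \<xi>) = (c * d) *\<^sub>R g" "c * d > 0" using c d by simp_all
  then show ?thesis using that d(2) by blast
qed

text \<open>In terms of monomials: \<open>x^u\<close> has no negative exponent exactly when
  \<open>u\<close> is in \<open>D\<close>.\<close>

lemma dual_lattice_points_rays:
  "u \<in> dual_lattice_points \<sigma>' \<longleftrightarrow> (\<forall>\<xi>\<in>rays \<sigma>'. pairing u (ray_generator \<xi>) \<ge> 0)"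
proof -
  obtain L where L: "\<forall>l\<in>L. l \<noteq> 0" "rays \<sigma>' = ray ` real_pt ` L" "\<sigma>' = convex_cone hull (real_pt ` L)"
    by (rule cayley_rays)
  have "pairing u (ray_generator (ray (real_pt l))) \<ge> 0 \<longleftrightarrow> real_pt u \<bullet> real_pt l \<ge> 0" if l: "l \<in> L" for l
  proof -
    obtain c where c: "c > 0" "real_pt (ray_generator (ray (real_pt l))) = c *\<^sub>R real_pt l"
      using ray_generator_ray[of l] L(1) l by metis
    have "real_of_int (pairing u (ray_generator (ray (real_pt l)))) = c * (real_pt u \<bullet> real_pt l)"
      using c(2) by (simp flip: real_pt_inner)
    then show ?thesis using c(1) by (metis of_int_0_le_iff zero_le_mult_iff less_imp_le not_le)
  qed
  then show ?thesis unfolding L(2) by (subst L(3)) (simp add: dual_lattice_points_hull)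
qed

lemma dual_iff:
  "u \<in> dual_lattice_points \<sigma>' \<longleftrightarrow> (\<forall>g\<in>generators. real_pt u \<bullet> g \<ge> 0)"
  unfolding cayley_hull by (rule dual_lattice_points_hull)

text \<open>Both \<open>u\<close> and \<open>- u\<close> are in the dual cone, so \<open>u\<close>
  vanishes on every generator. As \<open>\<sigma>\<close> spans the space, the first component of
  \<open>u\<close> is 0; a point of each \<open>Q_i\<close> then reveals the remaining
  coordinates.\<close>

lemma pairing_rays_eq_0:
  assumes "\<And>\<xi>. \<xi> \<in> rays \<sigma>' \<Longrightarrow> pairing u (ray_generator \<xi>) = 0"
  shows "u = 0"
proof -
  have minus: "pairing (- u) v = - pairing u v" for v by (simp add: pairing_def sum_negf)
  have "u \<in> dual_lattice_points \<sigma>'" "- u \<in> dual_lattice_points \<sigma>'"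
    unfolding dual_lattice_points_rays using assms by (simp_all add: minus)
  moreover have "real_pt (- u) = - real_pt u" by (simp add: real_pt_def)
  ultimately have zero: "real_pt u \<bullet> g = 0" if "g \<in> generators" for g
    using that unfolding dual_iff by (force intro: antisym)
  have "\<sigma> \<subseteq> {n. real_vec (fst u) \<bullet> n = 0}"
    using zero[OF generators.cone] by (auto simp: real_pt_def)
  then have "span \<sigma> \<subseteq> {n. real_vec (fst u) \<bullet> n = 0}"
    by (intro span_minimal subspace_hyperplane)
  moreover have "span \<sigma> = UNIV" using full dim_eq_full[of \<sigma>] by simp
  ultimately have "real_vec (fst u) \<bullet> real_vec (fst u) = 0" by blast
  then have fst: "fst u = 0" by simp
  have "snd u $ i = 0" for i
  proof -
    obtain q where "q \<in> Q (Some i)" using Q_nonempty by blast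
    from zero[OF generators.summand[OF this]] have "real_vec (snd u) \<bullet> axis i 1 = 0"
      by (simp add: real_pt_def fst cayley_shift_def)
    then show ?thesis by (simp add: inner_axis real_vec_def)
  qed
  then show ?thesis using fst by (simp add: prod_eq_iff vec_eq_iff)
qed

end

section \<open>Lattice points of the dual cones\<close>

lemma pairing_add: "pairing (u + v) w = pairing u w + pairing v w"
  by (simp add: pairing_def distrib_right sum.distrib)

lemma pairing_diff: "pairing (u - v) w = pairing u w - pairing v w"
  by (simp add: pairing_def left_diff_distrib sum_subtractf)

lemma pairing_zero [simp]: "pairing 0 w = 0"
  by (simp add: pairing_def)

lemma real_pt_add: "real_pt (u + v) = real_pt u + real_pt v"
  by (simp add: real_pt_def)

lemma inner_cayley_shift:
  "real_vec c \<bullet> e_shift (Some i) = of_int (c $ i)"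
  "real_vec c \<bullet> e_shift None = - (\<Sum>i\<in>UNIV. of_int (c $ i))"
  by (simp_all add: cayley_shift_def real_vec_sum inner_sum_right inner_axis) (simp_all add: real_vec_def)

lemma dual_cayley_cone_iff:
  "(m, c) \<in> dual_lattice_points (cayley_cone C Q) \<longleftrightarrow>
     (\<forall>n\<in>C. real_vec m \<bullet> n \<ge> 0) \<and>
     (\<forall>q\<in>Q None. real_vec m \<bullet> q \<ge> (\<Sum>i\<in>UNIV. of_int (c $ i))) \<and>
     (\<forall>i. \<forall>q\<in>Q (Some i). real_vec m \<bullet> q + of_int (c $ i) \<ge> 0)"
proof -
  have "(\<forall>j. \<forall>q\<in>Q j. real_vec m \<bullet> q + real_vec c \<bullet> e_shift j \<ge> 0) \<longleftrightarrow>
    (\<forall>q\<in>Q None. real_vec m \<bullet> q + real_vec c \<bullet> e_shift None \<ge> 0) \<and>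
    (\<forall>i. \<forall>q\<in>Q (Some i). real_vec m \<bullet> q + real_vec c \<bullet> e_shift (Some i) \<ge> 0)"
    by (metis option.exhaust)
  then show ?thesis
    unfolding dual_lattice_points_cayley_cone by (simp add: inner_cayley_shift)
qed

lemma dual_lattice_points_zero: "0 \<in> dual_lattice_points C"
  by (simp add: dual_lattice_points_def real_pt_def flip: zero_prod_def)

lemma dual_lattice_points_add:
  "u \<in> dual_lattice_points C \<Longrightarrow> v \<in> dual_lattice_points C \<Longrightarrow> u + v \<in> dual_lattice_points C"
  by (simp add: dual_lattice_points_def real_pt_add inner_add_left)

lemma sum_axis: "(\<Sum>l\<in>UNIV. of_int ((axis i 1 :: int ^ 'k::finite) $ l)) = (1 :: real)"
proof -
  have "(\<Sum>l\<in>UNIV. of_int ((axis i 1 :: int ^ 'k) $ l)) = (\<Sum>l\<in>UNIV. if l = i then 1 else (0 :: real))"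
    by (rule sum.cong) (auto simp: axis_def)
  then show ?thesis by simp
qed

context cayley_data
begin

abbreviation "D \<equiv> dual_lattice_points \<sigma>'"

text \<open>On \<open>Q_0\<close> the value 1 of \<open>R\<close> pays for the coordinate sum raised
  by \<open>e_i\<close>; on \<open>\<sigma>\<close> the inequality is that of
  \<open>u + R\<close>.\<close>

lemma D_add:
  assumes u: "u \<in> D" "u + lat_of_M R \<in> D"
  shows "u + (lat_of_M R + e_dual i) \<in> D"
proof -
  obtain m c where mc: "u = (m, c)" by (cases u)
  have 1: "(m, c) \<in> D" and 2: "(m + R, c) \<in> D" using u by (simp_all add: mc lat_of_M_def)
  have "(m + R, c + axis i 1) \<in> D"
    unfolding dual_cayley_cone_iff
  proof (intro conjI ballI allI)
    show "real_vec (m + R) \<bullet> n \<ge> 0" if "n \<in> \<sigma>" for n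
      using 2 that unfolding dual_cayley_cone_iff by blast
    show "real_vec (m + R) \<bullet> q \<ge> (\<Sum>l\<in>UNIV. of_int ((c + axis i 1) $ l))" if q: "q \<in> Q None" for q
    proof -
      have "real_vec m \<bullet> q \<ge> (\<Sum>l\<in>UNIV. of_int (c $ l))" using 1 q unfolding dual_cayley_cone_iff by blast
      then show ?thesis using R_Q[OF q] by (simp add: inner_add_left sum.distrib sum_axis)
    qed
    show "real_vec (m + R) \<bullet> q + of_int ((c + axis i 1) $ l) \<ge> 0" if q: "q \<in> Q (Some l)" for q l
    proof -
      have "real_vec m \<bullet> q + of_int (c $ l) \<ge> 0" using 1 q unfolding dual_cayley_cone_iff by blast
      moreover have "real_of_int ((axis i 1 :: int ^ 'k) $ l) \<ge> 0" by (simp add: axis_def)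
      ultimately show ?thesis using R_Q[OF q] by (simp add: inner_add_left)
    qed
  qed
  then show ?thesis by (simp add: mc lat_of_M_def e_dual_def)
qed

text \<open>For \<open>p\<close> in the slice, split as a sum of points of the \<open>Q_j\<close>,
  the inequality of \<open>u + e_i\<close> on \<open>Q_0\<close> and those of \<open>u\<close> on
  the other \<open>Q_l\<close> add up to \<open><m,p> >= 1\<close>, because the coordinates of
  \<open>c\<close> cancel. Hence \<open>m >= R\<close> on \<open>\<sigma>\<close>.\<close>

lemma D_diff:
  assumes u: "u \<in> D" "u + e_dual i \<in> D"
  shows "u - lat_of_M R \<in> D"
proof -
  obtain m c where mc: "u = (m, c)" by (cases u)
  have 1: "(m, c) \<in> D" and 2: "(m, c + axis i 1) \<in> D" using u by (simp_all add: mc e_dual_def)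
  have none: "real_vec m \<bullet> q \<ge> (\<Sum>l\<in>UNIV. of_int (c $ l)) + 1" if q: "q \<in> Q None" for q
  proof -
    have "real_vec m \<bullet> q \<ge> (\<Sum>l\<in>UNIV. of_int ((c + axis i 1) $ l))" using 2 q unfolding dual_cayley_cone_iff by blast
    then show ?thesis by (simp add: sum.distrib sum_axis)
  qed
  have some: "real_vec m \<bullet> q + of_int (c $ l) \<ge> 0" if "q \<in> Q (Some l)" for q l
    using 1 that unfolding dual_cayley_cone_iff by blast
  have on_P: "real_vec m \<bullet> p \<ge> 1" if p: "p \<in> P" for p
  proof -
    obtain w where w: "\<forall>j. w j \<in> Q j" "p = (\<Sum>j\<in>UNIV. w j)" using p unfolding P_iff by blast
    have "real_vec m \<bullet> p = real_vec m \<bullet> w None + (\<Sum>l\<in>UNIV. real_vec m \<bullet> w (Some l))"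
      unfolding w(2) by (simp add: UNIV_option_conv sum.reindex inner_add_right inner_sum_right)
    moreover have "(\<Sum>l\<in>UNIV. real_vec m \<bullet> w (Some l)) \<ge> (\<Sum>l\<in>UNIV. - of_int (c $ l))"
    proof (rule sum_mono)
      fix l show "real_vec m \<bullet> w (Some l) \<ge> - of_int (c $ l)"
        using some[of "w (Some l)" l] w(1) by auto
    qed
    ultimately show ?thesis using none[of "w None"] w(1) by (simp add: sum_negf)
  qed
  have "(m - R, c) \<in> D"
    unfolding dual_cayley_cone_iff
  proof (intro conjI ballI allI)
    fix n assume n: "n \<in> \<sigma>"
    have m: "real_vec m \<bullet> n \<ge> 0" using 1 n unfolding dual_cayley_cone_iff by blast
    show "real_vec (m - R) \<bullet> n \<ge> 0"
    proof (cases "real_vec R \<bullet> n \<le> 0")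
      case True
      then show ?thesis using m by (simp add: inner_diff_left)
    next
      case False
      let ?r = "real_vec R \<bullet> n"
      \<comment> \<open>Every point of the cone with positive \<open>R\<close> is a multiple of a
        point of the slice; where \<open>R\<close> is nonpositive, \<open>m >= 0\<close>
        suffices.\<close>
      have "(1 / ?r) *\<^sub>R n \<in> P" using False n sigma_scale by (simp add: P_iff_sigma)
      then have "real_vec m \<bullet> ((1 / ?r) *\<^sub>R n) \<ge> 1" by (rule on_P)
      then show ?thesis using False by (simp add: inner_diff_left field_simps)
    qed
  next
    show "real_vec (m - R) \<bullet> q \<ge> (\<Sum>l\<in>UNIV. of_int (c $ l))" if "q \<in> Q None" for q
      using none[OF that] R_Q[OF that] by (simp add: inner_diff_left)
    show "real_vec (m - R) \<bullet> q + of_int (c $ l) \<ge> 0" if "q \<in> Q (Some l)" for q l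
      using some[OF that] R_Q[OF that] by (simp add: inner_diff_left)
  qed
  then show ?thesis by (simp add: mc lat_of_M_def)
qed

text \<open>At points of \<open>\<sigma>\<close> where \<open>R\<close> is nonnegative, adding
  \<open>R\<close> preserves the second inequality; where it is negative,
  \<open>m - (n-1) R >= m >= 0\<close>. On the \<open>Q_j\<close>, \<open>R\<close> is 0 or
  1.\<close>

lemma D_between:
  assumes 1: "(m, c) \<in> D" and 2: "(m - int n *s R, c') \<in> D" and n: "n > 0"
  shows "(m - int n *s R + R, c') \<in> D"
  unfolding dual_cayley_cone_iff
proof (intro conjI ballI allI)
  fix x assume x: "x \<in> \<sigma>"
  have m: "real_vec m \<bullet> x \<ge> 0" using 1 x unfolding dual_cayley_cone_iff by blast
  have mn: "real_vec m \<bullet> x - n * (real_vec R \<bullet> x) \<ge> 0"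
    using 2 x unfolding dual_cayley_cone_iff by (simp add: inner_diff_left)
  show "real_vec (m - int n *s R + R) \<bullet> x \<ge> 0"
  proof (cases "real_vec R \<bullet> x \<ge> 0")
    case True
    then show ?thesis using mn by (simp add: inner_diff_left inner_add_left)
  next
    case False
    have "(real n - 1) * (- (real_vec R \<bullet> x)) \<ge> 0" using False n by (intro mult_nonneg_nonneg) auto
    then show ?thesis using m by (simp add: inner_diff_left inner_add_left algebra_simps)
  qed
next
  show "real_vec (m - int n *s R + R) \<bullet> q \<ge> (\<Sum>l\<in>UNIV. of_int (c' $ l))" if q: "q \<in> Q None" for q
  proof -
    have "real_vec (m - int n *s R) \<bullet> q \<ge> (\<Sum>l\<in>UNIV. of_int (c' $ l))" using 2 q unfolding dual_cayley_cone_iff by blast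
    then show ?thesis unfolding real_vec_simps(2) inner_add_left using R_Q[OF q] by simp
  qed
  show "real_vec (m - int n *s R + R) \<bullet> q + of_int (c' $ l) \<ge> 0" if q: "q \<in> Q (Some l)" for q l
  proof -
    have "real_vec (m - int n *s R) \<bullet> q + of_int (c' $ l) \<ge> 0" using 2 q unfolding dual_cayley_cone_iff by blast
    then show ?thesis unfolding real_vec_simps(2) inner_add_left using R_Q[OF q] by simp
  qed
qed

text \<open>Lowering the coordinate \<open>i\<close> endangers only the inequality on
  \<open>Q_i\<close>, and there the first point supplies the bound because it has the same
  \<open>m\<close> and \<open>c_i <= c'_i - 1\<close>.\<close>

lemma D_decrease:
  assumes 1: "(m, c) \<in> D" and 2: "(m, c') \<in> D" and i: "c $ i < c' $ i"
  shows "(m, c') - e_dual i \<in> D"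
proof -
  have "(m, c' - axis i 1) \<in> D"
    unfolding dual_cayley_cone_iff
  proof (intro conjI ballI allI)
    show "real_vec m \<bullet> n \<ge> 0" if "n \<in> \<sigma>" for n
      using 1 that unfolding dual_cayley_cone_iff by blast
    show "real_vec m \<bullet> q \<ge> (\<Sum>l\<in>UNIV. of_int ((c' - axis i 1) $ l))" if q: "q \<in> Q None" for q
    proof -
      have "real_vec m \<bullet> q \<ge> (\<Sum>l\<in>UNIV. of_int (c' $ l))" using 2 q unfolding dual_cayley_cone_iff by blast
      then show ?thesis by (simp add: sum_subtractf sum_axis)
    qed
    show "real_vec m \<bullet> q + of_int ((c' - axis i 1) $ l) \<ge> 0" if q: "q \<in> Q (Some l)" for q l
    proof -
      have "real_vec m \<bullet> q + of_int (c' $ l) \<ge> 0" "real_vec m \<bullet> q + of_int (c $ l) \<ge> 0"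
        using 1 2 q unfolding dual_cayley_cone_iff by blast+
      moreover have "real_of_int (c $ i) \<le> of_int (c' $ i) - 1" using i by linarith
      ultimately show ?thesis by (cases "l = i") (auto simp: axis_def)
    qed
  qed
  then show ?thesis by (simp add: e_dual_def)
qed

text \<open>\<open>ell\<close> is the pairing with the sum of the vectors \<open>(q_i, e_i)\<close>,
  one for each \<open>i >= 1\<close>. They belong to \<open>\<sigma>'\<close>, and \<open>R\<close>
  vanishes on every \<open>q_i\<close>.\<close>

lemma exists_degree:
  obtains ell :: "('n, 'k) lat \<Rightarrow> real" where "\<forall>u v. ell (u + v) = ell u + ell v" "ell (lat_of_M R) = 0"
    "\<forall>i. ell (e_dual i) = 1" "\<forall>u\<in>D. ell u \<ge> 0"
proof -
  have "\<forall>i. \<exists>x. x \<in> Q (Some i)" using Q_nonempty by blast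
  then obtain q where q: "\<forall>i. q i \<in> Q (Some i)" by (rule choice[THEN exE])
  define ell where "ell u = (\<Sum>i\<in>UNIV. real_vec (fst u) \<bullet> q i + of_int (snd u $ i))" for u :: "('n, 'k) lat"
  show ?thesis
  proof
    show "\<forall>u v. ell (u + v) = ell u + ell v" by (simp add: ell_def inner_add_left sum.distrib)
    have "real_vec R \<bullet> q i = 0" for i using R_Q[of "q i" "Some i"] q by simp
    then show "ell (lat_of_M R) = 0" by (simp add: ell_def lat_of_M_def)
    show "\<forall>i. ell (e_dual i) = 1" by (simp add: ell_def e_dual_def sum_axis)
    show "\<forall>u\<in>D. ell u \<ge> 0"
    proof
      fix u assume "u \<in> D"
      then have "(fst u, snd u) \<in> D" by simp
      then show "ell u \<ge> 0" unfolding dual_cayley_cone_iff ell_def using q by (intro sum_nonneg) blast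
    qed
  qed
qed

text \<open>The generators on which \<open>e_i\<close> is negative come from \<open>Q_0\<close>,
  where the value -1 is offset by \<open>R = 1\<close>. Consequently the monomial clearing the
  denominator of \<open>x^R\<close> also clears that of \<open>x^(R+e_i)\<close>.\<close>

lemma generator_lower_bound:
  assumes "g \<in> generators"
  shows "real_pt (lat_of_M R + e_dual i) \<bullet> g \<ge> min 0 (real_pt (lat_of_M R) \<bullet> g)"
proof -
  obtain n c where g: "g = (n, c)" by (cases g)
  have "(n, c) \<in> generators" using assms g by simp
  then show ?thesis
  proof cases
    case (summand j)
    show ?thesis
    proof (cases j)
      case None
      have "real_vec (axis i 1 :: int ^ 'k) \<bullet> e_shift None = - 1"
        by (simp only: inner_cayley_shift sum_axis)
      then show ?thesis using summand R_Q[of n j] None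
        by (simp add: g real_pt_def lat_of_M_def e_dual_def inner_add_left)
    next
      case (Some l)
      have "real_vec (axis i 1 :: int ^ 'k) \<bullet> e_shift (Some l) \<ge> 0"
        by (simp only: inner_cayley_shift) (simp add: axis_def)
      then show ?thesis using summand R_Q[of n j] Some
        by (simp add: g real_pt_def lat_of_M_def e_dual_def inner_add_left)
    qed
  qed (simp add: g real_pt_def lat_of_M_def e_dual_def)
qed

lemma ray_lower_bound:
  assumes "\<xi> \<in> rays \<sigma>'"
  shows "pairing (lat_of_M R + e_dual i) (ray_generator \<xi>) \<ge> min 0 (pairing (lat_of_M R) (ray_generator \<xi>))"
proof -
  obtain c g where cg: "c > 0" "g \<in> generators" "real_pt (ray_generator \<xi>) = c *\<^sub>R g"
    using assms by (rule ray_generator_type)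
  have eq: "real_of_int (pairing u (ray_generator \<xi>)) = c * (real_pt u \<bullet> g)" for u
    using cg(3) by (simp flip: real_pt_inner)
  let ?x = "real_pt (lat_of_M R) \<bullet> g" and ?y = "real_pt (lat_of_M R + e_dual i) \<bullet> g"
  have "min 0 (c * ?x) \<le> c * min 0 ?x" using cg(1) by (simp add: min_mult_distrib_left)
  also have "\<dots> \<le> c * ?y"
    using generator_lower_bound[OF cg(2)] cg(1) by (intro mult_left_mono) auto
  finally have "min 0 (real_of_int (pairing (lat_of_M R) (ray_generator \<xi>)))
      \<le> real_of_int (pairing (lat_of_M R + e_dual i) (ray_generator \<xi>))"
    unfolding eq .
  then show ?thesis by linarith
qed

abbreviation "\<tau>' \<equiv> cayley_cone (\<sigma> \<inter> {n. real_vec R \<bullet> n \<ge> 0}) Q"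
abbreviation "T \<equiv> dual_lattice_points \<tau>'"

lemma D_subset_T: "D \<subseteq> T"
proof
  fix u assume "u \<in> D"
  moreover obtain m c where "u = (m, c)" by (cases u)
  ultimately show "u \<in> T" by (simp add: dual_cayley_cone_iff)
qed

lemma R_in_T: "lat_of_M R \<in> T" "lat_of_M R + e_dual i \<in> T"
proof -
  show "lat_of_M R \<in> T"
    unfolding lat_of_M_def dual_cayley_cone_iff using R_Q by auto
  have "(R, axis i 1) \<in> T"
    unfolding dual_cayley_cone_iff sum_axis using R_Q by (auto simp: axis_def)
  then show "lat_of_M R + e_dual i \<in> T" by (simp add: lat_of_M_def e_dual_def)
qed

end

lemma ideal_semigroup_ringI:
  assumes S: "0 \<in> S" "\<And>a b. a \<in> S \<Longrightarrow> b \<in> S \<Longrightarrow> a + b \<in> S"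
    and K: "K \<subseteq> carrier (semigroup_ring S)" "0 \<in> K" "\<And>p q. p \<in> K \<Longrightarrow> q \<in> K \<Longrightarrow> p + q \<in> K"
    "\<And>p q. p \<in> K \<Longrightarrow> q \<in> carrier (semigroup_ring S) \<Longrightarrow> q * p \<in> K"
  shows "ideal K (semigroup_ring S)"
proof -
  interpret cring "semigroup_ring S" by (rule cring_semigroup_ring) (fact S)+
  have "- p \<in> K" if p: "p \<in> K" for p
  proof -
    have "Poly_Mapping.single 0 (-1) \<in> carrier (semigroup_ring S)" using S(1) by (simp add: semigroup_ring_simps)
    then have "Poly_Mapping.single 0 (-1) * p \<in> K" using K(4)[OF p] by blast
    then show ?thesis by (simp add: single_uminus)
  qed
  moreover have "\<ominus>\<^bsub>semigroup_ring S\<^esub> p = - p" if "p \<in> K" for p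
    by (rule a_inv_semigroup_ring) (use S K(1) that in \<open>auto simp: semigroup_ring_simps\<close>)
  ultimately have "subgroup K (add_monoid (semigroup_ring S))"
    using K(1-3) by (intro add.subgroupI) (auto simp: semigroup_ring_simps a_inv_def[symmetric])
  then show ?thesis
    by (intro idealI) (use K(4) in \<open>auto simp: mult_semigroup_ring mult.commute intro: ring_axioms\<close>)
qed

lemma chi_add: "chi (a + b) = chi a * chi b"
  by (simp add: mult_single)

lemma chi_prod: "(\<Prod>i\<in>A. chi (f i)) = chi (\<Sum>i\<in>A. f i)"
  by (induction A rule: infinite_finite_induct) (simp_all add: chi_add)

lemma x_var_power: "x_var \<xi> ^ n = chi (Poly_Mapping.single \<xi> (int n), 0)"
proof (induction n)
  case (Suc n)
  have "(Poly_Mapping.single \<xi> (int (Suc n)), 0 :: 'b \<Rightarrow>\<^sub>0 nat)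
      = (Poly_Mapping.single \<xi> 1, 0) + (Poly_Mapping.single \<xi> (int n), 0)"
    by (simp add: single_add)
  then show ?case unfolding power_Suc Suc by (simp only: chi_add x_var_def)
qed (simp flip: zero_prod_def)

lemma sum_prod_fst: "(\<Sum>i\<in>A. (f i, 0 :: 'b::comm_monoid_add)) = (\<Sum>i\<in>A. f i, 0)"
  by (induction A rule: infinite_finite_induct) (simp_all add: zero_prod_def)

section \<open>Exponents and weights\<close>

context cayley_data
begin

text \<open>The exponent of the Laurent monomial \<open>x^u\<close>. The range of
  \<open>theta\<close> will turn out to be the group of exponents of trivial weight, that is, of
  degree zero.\<close>

definition theta :: "('n, 'k) lat \<Rightarrow> ('n, 'k) latR set \<Rightarrow>\<^sub>0 int" where
  "theta u = (\<Sum>\<xi>\<in>rays \<sigma>'. Poly_Mapping.single \<xi> (pairing u (ray_generator \<xi>)))"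

lemma lookup_theta:
  "Poly_Mapping.lookup (theta u) \<xi> = (if \<xi> \<in> rays \<sigma>' then pairing u (ray_generator \<xi>) else 0)"
  using finite_rays by (simp add: theta_def lookup_sum lookup_single when_def)

lemma theta_add: "theta (u + v) = theta u + theta v"
  by (rule poly_mapping_eqI) (simp add: lookup_theta lookup_add pairing_add)

lemma theta_diff: "theta (u - v) = theta u - theta v"
  by (rule poly_mapping_eqI) (simp add: lookup_theta lookup_minus pairing_diff)

lemma theta_zero [simp]: "theta 0 = 0"
  by (rule poly_mapping_eqI) (simp add: lookup_theta)

lemma inj_theta: "inj theta"
proof (rule injI)
  fix u v assume eq: "theta u = theta v"
  have "u - v = 0"
  proof (rule pairing_rays_eq_0)
    fix \<xi> assume "\<xi> \<in> rays \<sigma>'"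
    then show "pairing (u - v) (ray_generator \<xi>) = 0"
      using arg_cong[OF eq, of "\<lambda>a. Poly_Mapping.lookup a \<xi>"] by (simp add: lookup_theta pairing_diff)
  qed
  then show "u = v" by simp
qed

lemma keys_theta: "Poly_Mapping.keys (theta u) \<subseteq> rays \<sigma>'"
  by (auto simp: in_keys_iff lookup_theta split: if_splits)

lemma x_monom_theta: "x_monom \<sigma>' u = chi (theta u, 0)"
  by (simp add: x_monom_def theta_def)

definition exponents :: "('n, 'k) expo set" where
  "exponents = {(a, b). Poly_Mapping.keys a \<subseteq> rays \<sigma>' \<and> (\<forall>\<xi>. Poly_Mapping.lookup a \<xi> \<ge> 0)}"

lemma exponents_zero: "0 \<in> exponents"
  by (simp add: exponents_def zero_prod_def)

lemma exponents_iff: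
  "(a, b) \<in> exponents \<longleftrightarrow> (\<forall>\<xi>\<in>rays \<sigma>'. Poly_Mapping.lookup a \<xi> \<ge> 0) \<and> (\<forall>\<xi>. \<xi> \<notin> rays \<sigma>' \<longrightarrow> Poly_Mapping.lookup a \<xi> = 0)"
proof -
  have "Poly_Mapping.keys a \<subseteq> rays \<sigma>' \<longleftrightarrow> (\<forall>\<xi>. \<xi> \<notin> rays \<sigma>' \<longrightarrow> Poly_Mapping.lookup a \<xi> = 0)"
    by (auto simp: in_keys_iff)
  then show ?thesis by (simp add: exponents_def) (metis order_refl)
qed

lemma exponents_add:
  assumes "x \<in> exponents" "y \<in> exponents"
  shows "x + y \<in> exponents"
proof -
  obtain a b a' b' where xy: "x = (a, b)" "y = (a', b')" by (metis prod.exhaust)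
  show ?thesis using assms unfolding xy add_Pair exponents_iff by (simp add: lookup_add)
qed

lemma theta_exponents: "(theta u, b) \<in> exponents \<longleftrightarrow> u \<in> D"
  by (simp add: exponents_iff lookup_theta dual_lattice_points_rays)

abbreviation "A \<equiv> cox_ring \<sigma>'"
abbreviation "I \<equiv> I_lambda \<sigma>' R"

lemma A_def: "A = semigroup_ring exponents"
  by (simp add: cox_ring_def exponents_def)

lemma cring_A: "cring A"
  unfolding A_def by (intro cring_semigroup_ring exponents_zero exponents_add)

lemma A_simps: "carrier A = {p. Poly_Mapping.keys p \<subseteq> exponents}"
  "x \<otimes>\<^bsub>A\<^esub> y = x * y" "x \<oplus>\<^bsub>A\<^esub> y = x + y" "\<one>\<^bsub>A\<^esub> = 1" "\<zero>\<^bsub>A\<^esub> = 0"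
  by (simp_all add: A_def semigroup_ring_simps)

text \<open>The negative part of \<open>theta R\<close>, the exponent of the monomial factor in
  \<open>I_generator\<close>.\<close>

definition phi :: "('n, 'k) latR set \<Rightarrow>\<^sub>0 int" where
  "phi = (\<Sum>\<xi>\<in>{\<xi>\<in>rays \<sigma>'. pairing (lat_of_M R) (ray_generator \<xi>) < 0}.
     Poly_Mapping.single \<xi> (- pairing (lat_of_M R) (ray_generator \<xi>)))"

lemma lookup_phi:
  "Poly_Mapping.lookup phi \<xi> = (if \<xi> \<in> rays \<sigma>' then max 0 (- pairing (lat_of_M R) (ray_generator \<xi>)) else 0)"
  using finite_rays by (auto simp: phi_def lookup_sum lookup_single when_def)

lemma I_generator_expand:
  "I_generator \<sigma>' R i = chi (theta (lat_of_M R + e_dual i) + phi, 0) - chi (theta (lat_of_M R) + phi, 0)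
     - chi (phi, Poly_Mapping.single i 1)"
proof -
  have prod: "(\<Prod>\<xi>\<in>{\<xi>\<in>rays \<sigma>'. pairing (lat_of_M R) (ray_generator \<xi>) < 0}.
      x_var \<xi> ^ nat (- pairing (lat_of_M R) (ray_generator \<xi>))) = (chi (phi, 0) :: ('n, 'k) cox)"
    unfolding x_var_power phi_def sum_prod_fst[symmetric] chi_prod[symmetric] by (rule prod.cong) auto
  show ?thesis
    unfolding I_generator_def prod x_monom_theta lambda_var_def left_diff_distrib chi_add[symmetric] by simp
qed

lemma I_generator_mult:
  "chi (a, b) * I_generator \<sigma>' R i = chi (a + theta (lat_of_M R + e_dual i) + phi, b)
     - chi (a + theta (lat_of_M R) + phi, b) - chi (a + phi, b + Poly_Mapping.single i 1)"
  unfolding I_generator_expand right_diff_distrib chi_add[symmetric] by (simp add: add.assoc)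

text \<open>\<open>ray_lower_bound\<close> makes \<open>x^phi\<close> clear the denominator of
  \<open>x^(R+e_i)\<close>, so the generators are honest polynomials and \<open>genideal\<close>
  yields an ideal of the Cox ring.\<close>

lemma I_generator_in_carrier: "I_generator \<sigma>' R i \<in> carrier A"
proof -
  have "pairing (lat_of_M R + e_dual i) (ray_generator \<xi>) + max 0 (- pairing (lat_of_M R) (ray_generator \<xi>)) \<ge> 0"
    if "\<xi> \<in> rays \<sigma>'" for \<xi>
    using ray_lower_bound[OF that, of i] by linarith
  then have "(theta (lat_of_M R + e_dual i) + phi, 0) \<in> exponents"
    by (simp add: exponents_iff lookup_add lookup_theta lookup_phi)
  moreover have "(theta (lat_of_M R) + phi, 0) \<in> exponents" "(phi, Poly_Mapping.single i 1) \<in> exponents"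
    by (auto simp: exponents_iff lookup_add lookup_theta lookup_phi)
  ultimately show ?thesis
    unfolding A_simps I_generator_expand by (intro CollectI keys_diff_closed keys_single_subset)
qed

lemma ideal_I: "ideal I A"
  unfolding I_lambda_def using I_generator_in_carrier
  by (intro ring.genideal_ideal cring.axioms(1) cring_A) blast

lemma I_carrier: "p \<in> I \<Longrightarrow> p \<in> carrier A"
  using ideal.Icarr[OF ideal_I] .

lemma I_zero: "0 \<in> I"
  using additive_subgroup.zero_closed[OF ideal.axioms(1)[OF ideal_I]] by (simp add: A_simps)

lemma I_add: "p \<in> I \<Longrightarrow> q \<in> I \<Longrightarrow> p + q \<in> I"
  using additive_subgroup.a_closed[OF ideal.axioms(1)[OF ideal_I]] by (simp add: A_simps)

lemma I_mult: "p \<in> I \<Longrightarrow> q \<in> carrier A \<Longrightarrow> q * p \<in> I"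
  using ideal.I_l_closed[OF ideal_I] by (simp add: A_simps)

lemma I_scale: "p \<in> I \<Longrightarrow> Poly_Mapping.single 0 c * p \<in> I"
  by (rule I_mult) (simp_all add: A_simps exponents_zero)

lemma I_uminus: "p \<in> I \<Longrightarrow> - p \<in> I"
  using I_scale[of p "-1"] by (simp add: single_uminus)

lemma I_diff: "p \<in> I \<Longrightarrow> q \<in> I \<Longrightarrow> p - q \<in> I"
  using I_add[of p "- q"] I_uminus[of q] by simp

lemma I_generator_in: "I_generator \<sigma>' R i \<in> I"
  unfolding I_lambda_def
  using ring.genideal_self[OF cring.axioms(1)[OF cring_A], of "range (I_generator \<sigma>' R)"] I_generator_in_carrier
  by blast

text \<open>The induction principle for \<open>I\<close>; it yields both that the substitution kills
  \<open>I\<close> and that the group preserves it.\<close>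

lemma I_subset:
  assumes "K \<subseteq> carrier A" "0 \<in> K" "\<And>p q. p \<in> K \<Longrightarrow> q \<in> K \<Longrightarrow> p + q \<in> K"
    "\<And>p q. p \<in> K \<Longrightarrow> q \<in> carrier A \<Longrightarrow> q * p \<in> K" "\<And>i. I_generator \<sigma>' R i \<in> K"
  shows "I \<subseteq> K"
proof -
  have "ideal K A"
    unfolding A_def
    by (rule ideal_semigroup_ringI) (use assms exponents_zero exponents_add in \<open>auto simp: A_def\<close>)
  then show ?thesis
    unfolding I_lambda_def using ring.genideal_minimal[OF cring.axioms(1)[OF cring_A]] assms(5) by blast
qed

lemma A_mult: "p \<in> carrier A \<Longrightarrow> q \<in> carrier A \<Longrightarrow> p * q \<in> carrier A"
  unfolding A_simps mem_Collect_eq by (rule keys_mult_closed) (rule exponents_add)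

lemma A_add: "p \<in> carrier A \<Longrightarrow> q \<in> carrier A \<Longrightarrow> p + q \<in> carrier A"
  unfolding A_simps mem_Collect_eq by (rule keys_add_closed)

lemma coset_def: "I +>\<^bsub>A\<^esub> p = (\<lambda>i. i + p) ` I"
  unfolding a_r_coset_def' by (auto simp: A_simps)

lemma coset_eq_iff: "I +>\<^bsub>A\<^esub> p = I +>\<^bsub>A\<^esub> q \<longleftrightarrow> p - q \<in> I"
proof
  assume eq: "I +>\<^bsub>A\<^esub> p = I +>\<^bsub>A\<^esub> q"
  have "0 + p \<in> (\<lambda>i. i + p) ` I" by (rule imageI) (rule I_zero)
  then have "0 + p \<in> (\<lambda>i. i + q) ` I" using eq unfolding coset_def by (simp only:)
  then obtain i where i: "i \<in> I" "0 + p = i + q" by (rule imageE)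
  have "p - q = (0 + p) - q" by simp
  also have "\<dots> = i" unfolding i(2) by simp
  finally show "p - q \<in> I" using i(1) by (simp only:)
next
  assume d: "p - q \<in> I"
  have "(\<lambda>i. i + p) ` I \<subseteq> (\<lambda>i. i + q) ` I"
  proof (rule image_subsetI)
    fix i assume i: "i \<in> I"
    have "i + p = (i + (p - q)) + q" by (simp only: add.assoc diff_add_cancel)
    then show "i + p \<in> (\<lambda>i. i + q) ` I" by (rule image_eqI) (rule I_add[OF i d])
  qed
  moreover have "(\<lambda>i. i + q) ` I \<subseteq> (\<lambda>i. i + p) ` I"
  proof (rule image_subsetI)
    fix i assume i: "i \<in> I"
    have "i + q = (i - (p - q)) + p" by (simp add: diff_diff_eq2)
    then show "i + q \<in> (\<lambda>i. i + p) ` I" by (rule image_eqI) (rule I_diff[OF i d])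
  qed
  ultimately show "I +>\<^bsub>A\<^esub> p = I +>\<^bsub>A\<^esub> q" unfolding coset_def by (rule equalityI)
qed

section \<open>The substitution for the \<open>\<lambda>_i\<close> on the degree zero part\<close>

abbreviation "lambda_image i \<equiv> x_monom \<sigma>' (lat_of_M R + e_dual i) - x_monom \<sigma>' (lat_of_M R)"

text \<open>Defined on the ambient Laurent ring, since the images of the \<open>\<lambda>_i\<close>
  may have negative exponents.\<close>

definition sub_lambda :: "('n, 'k) cox \<Rightarrow> ('n, 'k) cox" where
  "sub_lambda = linear_extension (\<lambda>(a, b). chi (a, 0) *
     (\<Prod>i\<in>UNIV. lambda_image i ^ Poly_Mapping.lookup b i))"

lemma sub_lambda_mult: "sub_lambda (p * q) = sub_lambda p * sub_lambda q"
  unfolding sub_lambda_def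
proof (rule linear_extension_mult)
  fix x y :: "('n, 'k) expo"
  let ?F = "\<lambda>(a, b). chi (a, 0 :: 'k \<Rightarrow>\<^sub>0 nat) * (\<Prod>i\<in>UNIV. lambda_image i ^ Poly_Mapping.lookup b i)"
  obtain a b a' b' where [simp]: "x = (a, b)" "y = (a', b')" by (cases x, cases y)
  have "chi (a + a', 0 :: 'k \<Rightarrow>\<^sub>0 nat) = chi (a, 0) * chi (a', 0)" by (simp add: mult_single)
  then show "?F (x + y) = ?F x * ?F y"
    by (simp add: lookup_add power_add prod.distrib mult_ac)
qed

lemma sub_lambda_x: "sub_lambda (chi (a, 0)) = chi (a, 0)"
  by (simp add: sub_lambda_def)

lemma sub_lambda_lambda:
  "sub_lambda (chi (0, Poly_Mapping.single i 1)) = lambda_image i"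
proof -
  have "(\<Prod>j\<in>UNIV. lambda_image j ^ Poly_Mapping.lookup (Poly_Mapping.single i 1) j) = (\<Prod>j\<in>UNIV. if j = i then lambda_image j else 1)"
    by (rule prod.cong) (auto simp: lookup_single)
  then have "(\<Prod>j\<in>UNIV. lambda_image j ^ Poly_Mapping.lookup (Poly_Mapping.single i 1) j) = lambda_image i" by simp
  then show ?thesis
    unfolding sub_lambda_def linear_extension_single prod.case zero_prod_def[symmetric] single_one by simp
qed

lemma sub_lambda_diff: "sub_lambda (p - q) = sub_lambda p - sub_lambda q"
  by (simp add: sub_lambda_def linear_extension_diff)

lemma sub_lambda_I:
  assumes "p \<in> I"
  shows "sub_lambda p = 0"
proof -
  let ?K = "{p \<in> carrier A. sub_lambda p = 0}"
  have "I \<subseteq> ?K"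
  proof (rule I_subset)
    fix i
    have "sub_lambda (lambda_image i - lambda_var i) = 0"
      unfolding x_monom_theta lambda_var_def sub_lambda_diff sub_lambda_x sub_lambda_lambda by simp
    then show "I_generator \<sigma>' R i \<in> ?K"
      using I_generator_in_carrier by (simp add: I_generator_def sub_lambda_mult)
  next
    show "0 \<in> ?K" by (simp add: A_simps sub_lambda_def)
    show "p + q \<in> ?K"
      if "p \<in> ?K" "q \<in> ?K" for p q
      using that A_add[of p q] by (simp add: sub_lambda_def linear_extension_add)
    show "q * p \<in> ?K"
      if "p \<in> ?K" "q \<in> carrier A" for p q
      using that A_mult[of q p] by (simp add: sub_lambda_mult)
  qed blast
  then show ?thesis using assms by blast
qed

lemma cox_hom_linear: "cox_hom \<sigma>' = linear_extension (x_monom \<sigma>')"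
  by (rule ext) (simp add: cox_hom_def linear_extension_def)

lemma cox_hom_injective: "cox_hom \<sigma>' p = cox_hom \<sigma>' q \<Longrightarrow> p = q"
  unfolding cox_hom_linear x_monom_theta
  by (rule linear_extension_injective[of "\<lambda>u. (theta u, 0)"]) (use inj_theta in \<open>auto simp: inj_def\<close>)

lemma cox_hom_mult: "cox_hom \<sigma>' (p * q) = cox_hom \<sigma>' p * cox_hom \<sigma>' q"
  unfolding cox_hom_linear
  by (rule linear_extension_mult) (simp add: x_monom_theta theta_add mult_single)

abbreviation "D_supported p \<equiv> Poly_Mapping.keys p \<subseteq> D \<times> (UNIV :: ('k \<Rightarrow>\<^sub>0 nat) set)"

text \<open>Embeds the polynomials in the \<open>\<lambda>_i\<close> over the semigroup ring of
  \<open>D\<close> as the degree zero part of the Cox ring.\<close>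

definition to_cox :: "(('n, 'k) lat \<times> ('k \<Rightarrow>\<^sub>0 nat) \<Rightarrow>\<^sub>0 complex) \<Rightarrow> ('n, 'k) cox" where
  "to_cox = linear_extension (\<lambda>(u, b). chi (theta u, b))"

abbreviation "evaluate \<equiv> linear_extension (lambda_value R)"

lemma to_cox_mult: "to_cox (p * q) = to_cox p * to_cox q"
  unfolding to_cox_def by (rule linear_extension_mult) (simp add: case_prod_beta theta_add mult_single)

lemma to_cox_add: "to_cox (p + q) = to_cox p + to_cox q"
  and to_cox_diff: "to_cox (p - q) = to_cox p - to_cox q"
  by (simp_all add: to_cox_def linear_extension_add linear_extension_diff)

lemma to_cox_chi: "to_cox (chi (u, b)) = chi (theta u, b)"
  by (simp add: to_cox_def)

lemma to_cox_constant: "to_cox (Poly_Mapping.single 0 c) = Poly_Mapping.single 0 c"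
  by (simp add: to_cox_def mult_single case_prod_beta flip: zero_prod_def)

lemma keys_to_cox:
  assumes "D_supported p"
  shows "to_cox p \<in> carrier A"
proof -
  have "to_cox p = linear_extension (\<lambda>z. chi (theta (fst z), snd z)) p"
    by (simp add: to_cox_def case_prod_beta')
  then have "Poly_Mapping.keys (to_cox p) \<subseteq> (\<lambda>z. (theta (fst z), snd z)) ` Poly_Mapping.keys p"
    using keys_linear_extension_chi[of "\<lambda>z. (theta (fst z), snd z)" p] by simp
  also have "\<dots> \<subseteq> exponents" using assms theta_exponents by auto
  finally show ?thesis by (simp add: A_simps)
qed

definition constant_lambda :: "(('n, 'k) lat \<Rightarrow>\<^sub>0 complex) \<Rightarrow> (('n, 'k) lat \<times> ('k \<Rightarrow>\<^sub>0 nat) \<Rightarrow>\<^sub>0 complex)" where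
  "constant_lambda = linear_extension (\<lambda>u. chi (u, 0))"

lemma evaluate_constant_lambda: "evaluate (constant_lambda p) = p"
proof (induction p rule: poly_mapping_keys_induct[OF subset_UNIV])
  case (2 u c)
  show ?case by (simp add: constant_lambda_def mult_single lambda_value_zero)
qed (simp_all add: constant_lambda_def linear_extension_add)

lemma to_cox_constant_lambda: "to_cox (constant_lambda p) = cox_hom \<sigma>' p"
proof (induction p rule: poly_mapping_keys_induct[OF subset_UNIV])
  case (2 u c)
  show ?case by (simp add: constant_lambda_def to_cox_def cox_hom_linear x_monom_theta mult_single)
qed (simp_all add: constant_lambda_def to_cox_def cox_hom_linear linear_extension_add)

lemma keys_constant_lambda:
  "Poly_Mapping.keys p \<subseteq> D \<Longrightarrow> D_supported (constant_lambda p)"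
  using keys_linear_extension_chi[of "\<lambda>u. (u, 0)" p] unfolding constant_lambda_def by auto

text \<open>Substituting in the Cox ring or in the group ring of the lattice gives the same result.
  Since \<open>cox_hom\<close> is injective, vanishing on one side implies vanishing on the
  other.\<close>

lemma sub_lambda_to_cox: "sub_lambda (to_cox p) = cox_hom \<sigma>' (evaluate p)"
proof (induction p rule: poly_mapping_keys_induct[OF subset_UNIV])
  case (2 z c)
  obtain u b where z: "z = (u, b)" by (cases z)
  have mono: "sub_lambda (chi (theta u, b)) = cox_hom \<sigma>' (lambda_value R (u, b))" for b
  proof (induction b rule: exponent_induct)
    case zero
    show ?case by (simp add: sub_lambda_x lambda_value_zero cox_hom_linear x_monom_theta)
  next
    case (add b i)
    have "chi (theta u, b + Poly_Mapping.single i 1) = chi (theta u, b) * chi (0, Poly_Mapping.single i 1)"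
      by (simp add: mult_single)
    then have "sub_lambda (chi (theta u, b + Poly_Mapping.single i 1))
        = cox_hom \<sigma>' (lambda_value R (u, b)) * lambda_image i"
      by (simp only: sub_lambda_mult sub_lambda_lambda add)
    also have "\<dots> = cox_hom \<sigma>' (lambda_value R (u, b + Poly_Mapping.single i 1))"
      unfolding lambda_value_step cox_hom_mult by (simp add: B_generator_def cox_hom_linear linear_extension_diff)
    finally show ?case .
  qed
  have "Poly_Mapping.single z c = Poly_Mapping.single 0 c * chi (u, b)" by (simp add: z mult_single)
  then have l: "sub_lambda (to_cox (Poly_Mapping.single z c)) = sub_lambda (Poly_Mapping.single 0 c) * sub_lambda (chi (theta u, b))"
    by (simp only: to_cox_mult to_cox_chi to_cox_constant sub_lambda_mult)
  have "sub_lambda (Poly_Mapping.single 0 c) = Poly_Mapping.single 0 c"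
    by (simp add: sub_lambda_def zero_prod_def mult_single)
  moreover have "cox_hom \<sigma>' (Poly_Mapping.single 0 c) = Poly_Mapping.single 0 c"
    by (simp add: cox_hom_linear x_monom_theta mult_single flip: zero_prod_def)
  moreover have "evaluate (Poly_Mapping.single z c) = Poly_Mapping.single 0 c * lambda_value R (u, b)" by (simp add: z)
  ultimately show ?case by (simp only: l mono cox_hom_mult)
qed (simp_all add: sub_lambda_def to_cox_def cox_hom_linear linear_extension_add)

lemma evaluate_kernel:
  assumes "D_supported p" "evaluate p = 0"
  shows "to_cox p \<in> I"
proof -
  obtain ell :: "('n, 'k) lat \<Rightarrow> real" where ell: "\<forall>u v. ell (u + v) = ell u + ell v" "ell (lat_of_M R) = 0"
    "\<forall>i. ell (e_dual i) = 1" "\<forall>u\<in>D. ell u \<ge> 0" by (rule exists_degree)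
  let ?J = "{p. to_cox p \<in> I}"
  interpret lambda_substitution R D ell "?J"
  proof
    fix u b i assume u: "u \<in> D" "u + lat_of_M R \<in> D"
    \<comment> \<open>\<open>u\<close> and \<open>u + R\<close> in \<open>D\<close> say exactly that
      the exponent of \<open>x^u\<close> dominates both 0 and the negative part of \<open>R\<close>.
      The multiplier need not have degree zero, but its product with the generator does.\<close>
    have "(theta u - phi, b) \<in> exponents"
      using u unfolding dual_lattice_points_rays
      by (auto simp: exponents_iff lookup_minus lookup_theta lookup_phi pairing_add)
    then have "chi (theta u - phi, b) * I_generator \<sigma>' R i \<in> I"
      by (intro I_mult I_generator_in) (simp add: A_simps)
    moreover have "theta u - phi + theta v + phi = theta (u + v)" for v by (simp add: theta_add)
    ultimately show "chi (u + (lat_of_M R + e_dual i), b) - chi (u + lat_of_M R, b) - chi (u, b + Poly_Mapping.single i 1)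
        \<in> ?J"
      unfolding I_generator_mult mem_Collect_eq to_cox_diff to_cox_chi by simp
  next
    fix p assume "p \<in> ?J"
    then have "cox_hom \<sigma>' (evaluate p) = 0" by (simp add: sub_lambda_I flip: sub_lambda_to_cox)
    then show "evaluate p = 0" using cox_hom_injective[of "evaluate p" 0] by (simp add: cox_hom_linear)
  next
    show "0 \<in> ?J" using I_zero by (simp add: to_cox_def)
    show "p + q \<in> ?J" if "p \<in> ?J" "q \<in> ?J" for p q
      using that I_add by (simp add: to_cox_add)
    show "Poly_Mapping.single 0 c * p \<in> ?J" if "p \<in> ?J" for p c
      using that I_scale by (simp add: to_cox_mult to_cox_constant)
  next
    show "ell (u + v) = ell u + ell v" for u v using ell(1) by blast
    show "ell (lat_of_M R) = 0" by (fact ell(2))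
    show "ell (e_dual i) = 1" for i using ell(3) by blast
    show "ell u \<ge> 0" if "u \<in> D" for u using ell(4) that by blast
  qed (fact D_add D_diff D_between D_decrease)+
  show ?thesis using lambda_value_kernel assms by blast
qed

section \<open>Invariant classes\<close>

definition weight :: "(('n, 'k) latR set \<Rightarrow> complex) \<Rightarrow> (('n, 'k) latR set \<Rightarrow>\<^sub>0 int) \<Rightarrow> complex" where
  "weight \<mu> a = (\<Prod>\<xi>\<in>rays \<sigma>'. \<mu> \<xi> powi Poly_Mapping.lookup a \<xi>)"

text \<open>Weights are products over all edges and therefore additive in the exponent, which makes
  this a ring homomorphism for group elements; it agrees with \<open>cox_act\<close> on the Cox
  ring.\<close>

definition act :: "(('n, 'k) latR set \<Rightarrow> complex) \<Rightarrow> ('n, 'k) cox \<Rightarrow> ('n, 'k) cox" where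
  "act \<mu> = linear_extension (\<lambda>(a, b). Poly_Mapping.single (a, b) (weight \<mu> a))"

lemma cox_group_nonzero: "\<mu> \<in> cox_group \<sigma>' \<Longrightarrow> \<xi> \<in> rays \<sigma>' \<Longrightarrow> \<mu> \<xi> \<noteq> 0"
  unfolding cox_group_def by (auto simp: PiE_iff)

lemma weight_add: "\<mu> \<in> cox_group \<sigma>' \<Longrightarrow> weight \<mu> (a + a') = weight \<mu> a * weight \<mu> a'"
  unfolding weight_def prod.distrib[symmetric]
  by (rule prod.cong) (auto simp: lookup_add power_int_add cox_group_nonzero)

lemma weight_theta:
  assumes "\<mu> \<in> cox_group \<sigma>'"
  shows "weight \<mu> (theta u) = 1"
proof -
  have "weight \<mu> (theta u) = (\<Prod>\<xi>\<in>rays \<sigma>'. \<mu> \<xi> powi pairing u (ray_generator \<xi>))"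
    unfolding weight_def by (rule prod.cong) (auto simp: lookup_theta)
  also have "\<dots> = 1" using assms unfolding cox_group_def by blast
  finally show ?thesis .
qed

lemma lookup_act: "Poly_Mapping.lookup (act \<mu> p) (a, b) = weight \<mu> a * Poly_Mapping.lookup p (a, b)"
proof (induction p rule: poly_mapping_keys_induct[OF subset_UNIV])
  case (2 z c)
  obtain u d where "z = (u, d)" by (cases z)
  then show ?case by (auto simp: act_def lookup_single_zero_mult lookup_single when_def)
qed (simp_all add: act_def linear_extension_add lookup_add distrib_left)

lemma cox_act_eq:
  assumes "p \<in> carrier A"
  shows "cox_act \<mu> p = act \<mu> p"
proof (rule poly_mapping_eqI)
  fix k :: "('n, 'k) expo"
  obtain a b where k: "k = (a, b)" by (cases k)
  show "Poly_Mapping.lookup (cox_act \<mu> p) k = Poly_Mapping.lookup (act \<mu> p) k"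
  proof (cases "k \<in> Poly_Mapping.keys p")
    case True
    then have "Poly_Mapping.keys a \<subseteq> rays \<sigma>'" using assms unfolding A_simps k exponents_def by auto
    then have "(\<Prod>\<xi>\<in>Poly_Mapping.keys a. \<mu> \<xi> powi Poly_Mapping.lookup a \<xi>) = weight \<mu> a"
      unfolding weight_def by (intro prod.mono_neutral_left finite_rays) (auto simp: in_keys_iff)
    then show ?thesis using True by (simp add: cox_act_def lookup_mapp k lookup_act)
  next
    case False
    then show ?thesis by (simp add: cox_act_def lookup_mapp k lookup_act in_keys_iff)
  qed
qed

lemma act_add: "act \<mu> (p + q) = act \<mu> p + act \<mu> q"
  by (simp add: act_def linear_extension_add)

lemma act_mult: "\<mu> \<in> cox_group \<sigma>' \<Longrightarrow> act \<mu> (p * q) = act \<mu> p * act \<mu> q"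
  unfolding act_def by (rule linear_extension_mult) (auto simp: mult_single weight_add)

lemma keys_act: "Poly_Mapping.keys (act \<mu> p) \<subseteq> Poly_Mapping.keys p"
proof
  fix k assume "k \<in> Poly_Mapping.keys (act \<mu> p)"
  then show "k \<in> Poly_Mapping.keys p" by (cases k) (auto simp: in_keys_iff lookup_act)
qed

lemma act_to_cox: "\<mu> \<in> cox_group \<sigma>' \<Longrightarrow> act \<mu> (to_cox p) = to_cox p"
proof (induction p rule: poly_mapping_keys_induct[OF subset_UNIV])
  case (2 z c)
  obtain u b where z: "z = (u, b)" by (cases z)
  show ?case by (simp add: z to_cox_def act_def mult_single weight_theta[OF 2(2)])
qed (simp_all add: to_cox_def act_def linear_extension_add)

text \<open>All terms of a generator have the weight of \<open>x^phi\<close>, as the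
  \<open>x^u\<close> and the \<open>\<lambda>_i\<close> have trivial weight, so the action only
  rescales it.\<close>

lemma act_I:
  assumes \<mu>: "\<mu> \<in> cox_group \<sigma>'" and "p \<in> I"
  shows "act \<mu> p \<in> I"
proof -
  let ?K = "{p \<in> carrier A. act \<mu> p \<in> I}"
  have "I \<subseteq> ?K"
  proof (rule I_subset)
    show "0 \<in> ?K" using I_zero by (simp add: A_simps act_def)
    show "p + q \<in> ?K" if "p \<in> ?K" "q \<in> ?K" for p q
      using that I_add A_add[of p q] by (simp add: act_add)
    show "q * p \<in> ?K" if "p \<in> ?K" "q \<in> carrier A" for p q
    proof -
      have "act \<mu> q \<in> carrier A" using that(2) keys_act[of \<mu> q] by (auto simp: A_simps)
      then show ?thesis
        using that A_mult[of q p] I_mult by (simp add: act_mult[OF \<mu>])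
    qed
    fix i
    have w: "weight \<mu> (theta u + phi) = weight \<mu> phi" for u
      by (simp add: weight_add[OF \<mu>] weight_theta[OF \<mu>])
    have "act \<mu> (I_generator \<sigma>' R i) = Poly_Mapping.single 0 (weight \<mu> phi) * I_generator \<sigma>' R i"
      unfolding I_generator_expand right_diff_distrib act_def linear_extension_diff
      by (simp add: w mult_single)
    then show "I_generator \<sigma>' R i \<in> ?K"
      using I_generator_in_carrier I_scale[OF I_generator_in] by simp
  qed blast
  then show ?thesis using assms(2) by blast
qed

lemma cox_group_inverse:
  assumes \<mu>: "\<mu> \<in> cox_group \<sigma>'"
  obtains \<nu> where "\<nu> \<in> cox_group \<sigma>'" "\<forall>p. act \<mu> (act \<nu> p) = p"
proof
  let ?\<nu> = "\<lambda>\<xi>\<in>rays \<sigma>'. inverse (\<mu> \<xi>)"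
  have w: "weight ?\<nu> a = inverse (weight \<mu> a)" for a
    unfolding weight_def prod_inversef[symmetric] by (rule prod.cong) (auto simp: power_int_inverse)
  have "(\<Prod>\<xi>\<in>rays \<sigma>'. ?\<nu> \<xi> powi pairing u (ray_generator \<xi>)) = 1" for u
  proof -
    have "(\<Prod>\<xi>\<in>rays \<sigma>'. ?\<nu> \<xi> powi pairing u (ray_generator \<xi>)) = weight ?\<nu> (theta u)"
      unfolding weight_def by (rule prod.cong) (auto simp: lookup_theta)
    then show ?thesis by (simp add: w weight_theta[OF \<mu>])
  qed
  then show "?\<nu> \<in> cox_group \<sigma>'"
    using cox_group_nonzero[OF \<mu>] by (auto simp: cox_group_def)
  have nz: "weight \<mu> a \<noteq> 0" for a
    unfolding weight_def using finite_rays cox_group_nonzero[OF \<mu>] by (auto simp: prod_zero_iff)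
  show "\<forall>p. act \<mu> (act ?\<nu> p) = p"
  proof
    fix p
    have "Poly_Mapping.lookup (act \<mu> (act ?\<nu> p)) (a, b) = Poly_Mapping.lookup p (a, b)" for a b
      unfolding lookup_act w using nz by simp
    then show "act \<mu> (act ?\<nu> p) = p" by (intro poly_mapping_eqI) auto
  qed
qed

lemma invariant_coset_to_cox:
  assumes p: "D_supported p" and \<mu>: "\<mu> \<in> cox_group \<sigma>'"
  shows "cox_act \<mu> ` (I +>\<^bsub>A\<^esub> to_cox p) = I +>\<^bsub>A\<^esub> to_cox p"
proof -
  have "i + to_cox p \<in> carrier A" if "i \<in> I" for i
    using I_carrier[OF that] keys_to_cox[OF p] by (simp add: A_simps keys_add_closed)
  then have "cox_act \<mu> (i + to_cox p) = act \<mu> i + to_cox p" if "i \<in> I" for i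
    using that cox_act_eq act_to_cox[OF \<mu>] by (simp add: act_add)
  then have "cox_act \<mu> ` (I +>\<^bsub>A\<^esub> to_cox p) = (\<lambda>i. i + to_cox p) ` act \<mu> ` I"
    unfolding coset_def image_image by (intro image_cong) simp_all
  moreover have "act \<mu> ` I = I"
  proof (intro equalityI subsetI)
    show "x \<in> I" if "x \<in> act \<mu> ` I" for x using that act_I[OF \<mu>] by blast
    fix x assume "x \<in> I"
    obtain \<nu> where \<nu>: "\<nu> \<in> cox_group \<sigma>'" "\<forall>p. act \<mu> (act \<nu> p) = p" using \<mu> by (rule cox_group_inverse)
    have "act \<nu> x \<in> I" using act_I[OF \<nu>(1) \<open>x \<in> I\<close>] .
    then show "x \<in> act \<mu> ` I" using \<nu>(2) by (metis image_eqI)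
  qed
  ultimately show ?thesis by (simp add: coset_def)
qed

lemma to_cox_preimage:
  assumes "Poly_Mapping.keys p \<subseteq> {(a, b). a \<in> range theta} \<inter> exponents"
  shows "\<exists>q. D_supported q \<and> p = to_cox q"
  using assms
proof (induction p rule: poly_mapping_keys_induct)
  case zero
  show ?case by (intro exI[of _ 0]) (simp add: to_cox_def)
next
  case (single k c)
  then obtain u b where k: "k = (theta u, b)" by auto
  then have "u \<in> D" using single theta_exponents by auto
  then show ?case by (intro exI[of _ "Poly_Mapping.single (u, b) c"]) (auto simp: k to_cox_def mult_single)
next
  case (add p q)
  then obtain p' q' where "Poly_Mapping.keys p' \<subseteq> D \<times> UNIV" "p = to_cox p'"
    "Poly_Mapping.keys q' \<subseteq> D \<times> UNIV" "q = to_cox q'" by blast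
  then show ?case by (intro exI[of _ "p' + q'"]) (simp add: to_cox_add keys_add_closed)
qed

text \<open>A representative with the fewest monomials has only monomials of trivial weight: another
  monomial \<open>k\<close> could be eliminated with \<open>(\<mu> p - \<mu>\<^sup>k p) / (1 - \<mu>\<^sup>k)\<close>.\<close>

lemma invariant_representative:
  assumes X: "X = I +>\<^bsub>A\<^esub> p0" "p0 \<in> carrier A" and inv: "\<forall>\<mu>\<in>cox_group \<sigma>'. cox_act \<mu> ` X = X"
  obtains q where "D_supported q" "X = I +>\<^bsub>A\<^esub> to_cox q"
proof -
  have X_carrier: "X \<subseteq> carrier A"
    using I_carrier X(2) unfolding X(1) coset_def by (auto simp: A_simps dest!: subsetD[OF keys_add])
  have X_diff: "p - q \<in> I" if pq: "p \<in> X" "q \<in> X" for p q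
  proof -
    obtain i j where "i \<in> I" "j \<in> I" "p = i + p0" "q = j + p0" using pq unfolding X(1) coset_def by blast
    then show ?thesis using I_diff by simp
  qed
  have X_shift: "p + i \<in> X" if pi: "p \<in> X" "i \<in> I" for p i
  proof -
    obtain j where j: "j \<in> I" "p = j + p0" using pi(1) unfolding X(1) coset_def by blast
    have "p + i = (j + i) + p0" using j(2) by (simp add: add_ac)
    then show ?thesis using I_add[OF j(1) pi(2)] unfolding X(1) coset_def by blast
  qed
  have "0 + p0 \<in> X" unfolding X(1) coset_def using I_zero by blast
  then obtain p where p: "p \<in> X" and min: "\<And>q. q \<in> X \<Longrightarrow> card (Poly_Mapping.keys p) \<le> card (Poly_Mapping.keys q)"
    using ex_has_least_nat[of "\<lambda>p. p \<in> X" "0 + p0" "\<lambda>p. card (Poly_Mapping.keys p)"] by blast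
  have "a \<in> range theta" if ab: "(a, b) \<in> Poly_Mapping.keys p" for a b
  proof (rule ccontr)
    assume a: "a \<notin> range theta"
    have keys_a: "Poly_Mapping.keys a \<subseteq> rays \<sigma>'"
    proof -
      have "(a, b) \<in> exponents" using ab p X_carrier unfolding A_simps by blast
      then show ?thesis by (simp add: exponents_def)
    qed
    have zero: "0 \<in> range theta" by (rule range_eqI[of _ _ 0]) simp
    have diff: "x - y \<in> range theta" if "x \<in> range theta" "y \<in> range theta" for x y
    proof -
      obtain u v where "x = theta u" "y = theta v" using \<open>x \<in> range theta\<close> \<open>y \<in> range theta\<close> by blast
      then have "x - y = theta (u - v)" by (simp only: theta_diff)
      then show ?thesis by blast
    qed
    \<comment> \<open>Triviality on the subgroup \<open>range theta\<close> is the defining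
      condition of the group, so an exponent outside it is moved by some group element.\<close>
    obtain \<mu> :: "('n, 'k) latR set \<Rightarrow> complex" where \<mu>: "\<mu> \<in> rays \<sigma>' \<rightarrow>\<^sub>E - {0}"
      "\<forall>x\<in>range theta. Poly_Mapping.keys x \<subseteq> rays \<sigma>' \<longrightarrow> (\<Prod>\<xi>\<in>rays \<sigma>'. \<mu> \<xi> powi Poly_Mapping.lookup x \<xi>) = 1"
      "(\<Prod>\<xi>\<in>rays \<sigma>'. \<mu> \<xi> powi Poly_Mapping.lookup a \<xi>) \<noteq> 1"
      by (rule separating_character[OF finite_rays zero diff a keys_a])
    have "(\<Prod>\<xi>\<in>rays \<sigma>'. \<mu> \<xi> powi pairing u (ray_generator \<xi>)) = 1" for u
    proof -
      have "(\<Prod>\<xi>\<in>rays \<sigma>'. \<mu> \<xi> powi pairing u (ray_generator \<xi>))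
          = (\<Prod>\<xi>\<in>rays \<sigma>'. \<mu> \<xi> powi Poly_Mapping.lookup (theta u) \<xi>)"
        by (rule prod.cong) (auto simp: lookup_theta)
      then show ?thesis using \<mu>(2) keys_theta[of u] by simp
    qed
    then have group: "\<mu> \<in> cox_group \<sigma>'" using \<mu>(1) by (simp add: cox_group_def)
    define w where "w = weight \<mu> a"
    have w: "w \<noteq> 1" using \<mu>(3) by (simp add: w_def weight_def)
    have "cox_act \<mu> ` X = X" using inv group by (rule bspec)
    then have "cox_act \<mu> p \<in> X" using imageI[OF p, of "cox_act \<mu>"] by (simp only:)
    then have "act \<mu> p \<in> X" unfolding cox_act_eq[OF subsetD[OF X_carrier p]] .
    then have d: "act \<mu> p - p \<in> I" using p by (rule X_diff)
    define q where "q = p + Poly_Mapping.single 0 (1 / (1 - w)) * (act \<mu> p - p)"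
    have q: "q \<in> X" unfolding q_def by (intro X_shift p I_scale d)
    have lookup_q: "Poly_Mapping.lookup q (a', b') = Poly_Mapping.lookup p (a', b') * (1 + (1 / (1 - w)) * (weight \<mu> a' - 1))" for a' b'
      unfolding q_def lookup_add lookup_single_zero_mult lookup_minus lookup_act by (simp add: algebra_simps)
    have "Poly_Mapping.lookup q (a, b) = 0"
      unfolding lookup_q w_def[symmetric] using w by (simp add: field_simps)
    moreover have "Poly_Mapping.keys q \<subseteq> Poly_Mapping.keys p"
      using lookup_q by (auto simp: in_keys_iff)
    ultimately have "Poly_Mapping.keys q \<subset> Poly_Mapping.keys p"
      using ab by (auto simp: in_keys_iff)
    then have "card (Poly_Mapping.keys q) < card (Poly_Mapping.keys p)" by (intro psubset_card_mono finite_keys)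
    then show False using min[OF q] by simp
  qed
  then have "Poly_Mapping.keys p \<subseteq> {(a, b). a \<in> range theta} \<inter> exponents"
    using p X_carrier by (auto simp: A_simps)
  then obtain q where q: "D_supported q" "p = to_cox q"
    using to_cox_preimage by blast
  have "p0 - p \<in> I" using X_diff \<open>0 + p0 \<in> X\<close> p by simp
  then have "X = I +>\<^bsub>A\<^esub> to_cox q" unfolding X(1) q(2)[symmetric] coset_eq_iff .
  then show ?thesis using that q(1) by blast
qed

lemma invariant_quotient_carrier:
  "carrier (invariant_quotient \<sigma>' R) = {I +>\<^bsub>A\<^esub> to_cox q | q. D_supported q}" (is "?L = ?R")
proof
  show "?L \<subseteq> ?R"
  proof
    fix X assume "X \<in> ?L"
    then have "X \<in> a_rcosets\<^bsub>A\<^esub> I" and inv: "\<forall>\<mu>\<in>cox_group \<sigma>'. cox_act \<mu> ` X = X"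
      by (auto simp: invariant_quotient_def Let_def FactRing_def)
    then obtain p0 where "p0 \<in> carrier A" "X = I +>\<^bsub>A\<^esub> p0" by (auto simp: A_RCOSETS_def')
    then obtain q where "D_supported q" "X = I +>\<^bsub>A\<^esub> to_cox q"
      using invariant_representative[of X p0] inv by blast
    then show "X \<in> ?R" by blast
  qed
  show "?R \<subseteq> ?L"
  proof
    fix X assume "X \<in> ?R"
    then obtain q where q: "D_supported q" "X = I +>\<^bsub>A\<^esub> to_cox q" by blast
    have "X \<in> a_rcosets\<^bsub>A\<^esub> I" using keys_to_cox[OF q(1)] q(2) by (auto simp: A_RCOSETS_def')
    then show "X \<in> ?L"
      using invariant_coset_to_cox[OF q(1)] q(2) by (simp add: invariant_quotient_def Let_def FactRing_def)
  qed
qed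

section \<open>The isomorphism\<close>

definition BT :: "(('n, 'k) lat \<Rightarrow>\<^sub>0 complex) ring" where
  "BT = semigroup_ring T"

lemma cring_BT: "cring BT"
  unfolding BT_def by (intro cring_semigroup_ring dual_lattice_points_zero dual_lattice_points_add)

abbreviation "B_carrier \<equiv> generate_ring BT (carrier (semigroup_ring D) \<union> range (B_generator R))"

lemma B_carrier_subset: "B_carrier \<subseteq> carrier BT"
proof (rule ring.generate_ring_incl[OF cring.axioms(1)[OF cring_BT]])
  have "B_generator R i \<in> carrier BT" for i
    unfolding B_generator_def BT_def carrier_semigroup_ring mem_Collect_eq
    by (intro keys_diff_closed keys_single_subset R_in_T)
  then show "carrier (semigroup_ring D) \<union> range (B_generator R) \<subseteq> carrier BT"
    using D_subset_T by (auto simp: BT_def carrier_semigroup_ring)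
qed

text \<open>Constants already belong to the semigroup ring of \<open>D\<close>, so the subring
  generated by it and the \<open>B_generator R i\<close> consists of all polynomial expressions in
  these with coefficients over \<open>D\<close>.\<close>

lemma B_carrier_eq: "B_carrier = evaluate ` {q. D_supported q}"
proof (intro equalityI subsetI)
  have BT_simps: "x \<otimes>\<^bsub>BT\<^esub> y = x * y" "x \<oplus>\<^bsub>BT\<^esub> y = x + y" "\<one>\<^bsub>BT\<^esub> = 1" for x y
    by (simp_all add: BT_def semigroup_ring_simps)
  note B_add = generate_ring.eng_add[of _ BT "carrier (semigroup_ring D) \<union> range (B_generator R)", unfolded BT_simps]
  note B_mult = generate_ring.eng_mult[of _ BT "carrier (semigroup_ring D) \<union> range (B_generator R)", unfolded BT_simps]
  have single_in: "Poly_Mapping.single u c \<in> B_carrier" if "u \<in> D" for u c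
    by (rule generate_ring.incl) (use that in \<open>simp add: carrier_semigroup_ring\<close>)
  have gen_in: "B_generator R i \<in> B_carrier" for i
    by (rule generate_ring.incl) blast
  {
    fix x assume "x \<in> evaluate ` {q. D_supported q}"
    then obtain q where q: "D_supported q" "x = evaluate q" by blast
    have "evaluate q \<in> B_carrier"
      using q(1)
    proof (induction q rule: poly_mapping_keys_induct)
      case zero
      show ?case using single_in[OF dual_lattice_points_zero, of 0] by simp
    next
      case (single z c)
      obtain u b where z: "z = (u, b)" "u \<in> D" using single by (cases z) auto
      have "lambda_value R (u, b) \<in> B_carrier"
      proof (induction b rule: exponent_induct)
        case zero
        show ?case unfolding lambda_value_zero by (rule single_in) (fact z(2))
      next
        case (add b i)
        show ?case unfolding lambda_value_step by (rule B_mult[OF add gen_in])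
      qed
      then show ?case unfolding linear_extension_single z(1) by (intro B_mult single_in dual_lattice_points_zero)
    next
      case (add p q)
      then show ?case unfolding linear_extension_add by (intro B_add)
    qed
    then show "x \<in> B_carrier" using q(2) by simp
  }
  fix x assume "x \<in> B_carrier"
  then show "x \<in> evaluate ` {q. D_supported q}"
  proof (induction x rule: generate_ring.induct)
    case one
    have "\<one>\<^bsub>BT\<^esub> = evaluate (chi (0, 0))" by (simp add: BT_simps lambda_value_zero)
    moreover have "Poly_Mapping.keys (chi (0, 0)) \<subseteq> D \<times> UNIV" using dual_lattice_points_zero by simp
    ultimately show ?case by blast
  next
    case (incl h)
    then consider "h \<in> carrier (semigroup_ring D)" | i where "h = B_generator R i" by blast
    then show ?case
    proof cases
      case 1
      then show ?thesis
        using evaluate_constant_lambda[of h] keys_constant_lambda[of h]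
        by (intro image_eqI[of _ _ "constant_lambda h"]) (simp_all add: carrier_semigroup_ring)
    next
      case 2
      have "h = evaluate (chi (0, Poly_Mapping.single i 1))"
        unfolding 2 linear_extension_single lambda_value_single by simp
      moreover have "Poly_Mapping.keys (chi (0, Poly_Mapping.single i 1)) \<subseteq> D \<times> UNIV"
        using dual_lattice_points_zero by simp
      ultimately show ?thesis by blast
    qed
  next
    case (a_inv h)
    then obtain q where q: "D_supported q" "h = evaluate q" by blast
    have "h \<in> carrier BT" using a_inv(1) B_carrier_subset by blast
    then have "\<ominus>\<^bsub>BT\<^esub> h = - h"
      unfolding BT_def
      by (intro a_inv_semigroup_ring dual_lattice_points_zero dual_lattice_points_add) (auto simp: carrier_semigroup_ring)
    then have "\<ominus>\<^bsub>BT\<^esub> h = evaluate (- q)" using q(2) by (simp add: linear_extension_uminus)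
    moreover have "D_supported (- q)" using q(1) by simp
    ultimately show ?case by blast
  next
    case (eng_add h1 h2)
    then obtain q1 q2 where q: "D_supported q1" "h1 = evaluate q1"
      "D_supported q2" "h2 = evaluate q2" by blast
    then have "h1 \<oplus>\<^bsub>BT\<^esub> h2 = evaluate (q1 + q2)" by (simp add: BT_simps linear_extension_add)
    then show ?case using q keys_add_closed[OF q(1,3)] by blast
  next
    case (eng_mult h1 h2)
    then obtain q1 q2 where q: "D_supported q1" "h1 = evaluate q1"
      "D_supported q2" "h2 = evaluate q2" by blast
    then have "h1 \<otimes>\<^bsub>BT\<^esub> h2 = evaluate (q1 * q2)"
      by (simp add: BT_simps linear_extension_mult[OF lambda_value_add])
    moreover have "Poly_Mapping.keys (q1 * q2) \<subseteq> D \<times> UNIV"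
      by (rule keys_mult_closed[OF _ q(1,3)]) (simp add: mem_Times_iff dual_lattice_points_add)
    ultimately show ?case by blast
  qed
qed

end

context cayley_data
begin

text \<open>The value is read off any degree zero representative; \<open>evaluate_coset\<close>
  shows that the choice does not matter.\<close>

definition coset_value :: "('n, 'k) cox set \<Rightarrow> (('n, 'k) lat \<Rightarrow>\<^sub>0 complex)" where
  "coset_value X = (THE b. \<exists>q. X = I +>\<^bsub>A\<^esub> to_cox q \<and> b = evaluate q)"

text \<open>\<open>sub_lambda\<close> vanishes on \<open>I\<close>, and \<open>cox_hom\<close> is
  injective.\<close>

lemma evaluate_coset:
  assumes "I +>\<^bsub>A\<^esub> to_cox p = I +>\<^bsub>A\<^esub> to_cox q"
  shows "evaluate p = evaluate q"
proof (rule cox_hom_injective)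
  have "to_cox p - to_cox q \<in> I" using assms unfolding coset_eq_iff .
  then have "sub_lambda (to_cox p) - sub_lambda (to_cox q) = 0"
    unfolding sub_lambda_diff[symmetric] by (rule sub_lambda_I)
  then show "cox_hom \<sigma>' (evaluate p) = cox_hom \<sigma>' (evaluate q)" by (simp add: sub_lambda_to_cox)
qed

lemma coset_value_coset: "coset_value (I +>\<^bsub>A\<^esub> to_cox q) = evaluate q"
  unfolding coset_value_def
proof (rule the_equality)
  show "\<exists>q'. I +>\<^bsub>A\<^esub> to_cox q = I +>\<^bsub>A\<^esub> to_cox q' \<and> evaluate q = evaluate q'"
    by (rule exI[of _ q]) simp
  fix b assume "\<exists>q'. I +>\<^bsub>A\<^esub> to_cox q = I +>\<^bsub>A\<^esub> to_cox q' \<and> b = evaluate q'"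
  then obtain q' where q': "I +>\<^bsub>A\<^esub> to_cox q = I +>\<^bsub>A\<^esub> to_cox q'" "b = evaluate q'" by (elim exE conjE)
  show "b = evaluate q" unfolding q'(2) by (rule evaluate_coset[OF q'(1), symmetric])
qed

lemma B_ring_simps:
  "carrier (B_ring \<sigma>' \<tau>' R) = B_carrier" "x \<otimes>\<^bsub>B_ring \<sigma>' \<tau>' R\<^esub> y = x * y"
  "x \<oplus>\<^bsub>B_ring \<sigma>' \<tau>' R\<^esub> y = x + y" "\<one>\<^bsub>B_ring \<sigma>' \<tau>' R\<^esub> = 1"
  by (simp_all add: B_ring_def Let_def BT_def semigroup_ring_simps)

lemma invariant_quotient_simps:
  "x \<otimes>\<^bsub>invariant_quotient \<sigma>' R\<^esub> y = [mod I:] x \<Otimes>\<^bsub>A\<^esub> y"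
  "x \<oplus>\<^bsub>invariant_quotient \<sigma>' R\<^esub> y = x <+>\<^bsub>A\<^esub> y" "\<one>\<^bsub>invariant_quotient \<sigma>' R\<^esub> = I +>\<^bsub>A\<^esub> \<one>\<^bsub>A\<^esub>"
  by (simp_all add: invariant_quotient_def Let_def FactRing_def)

text \<open>Degree zero representatives add and multiply like their classes. Injectivity is
  \<open>evaluate_kernel\<close>, surjectivity is \<open>B_carrier_eq\<close>.\<close>

lemma coset_value_ring_iso: "coset_value \<in> ring_iso (invariant_quotient \<sigma>' R) (B_ring \<sigma>' \<tau>' R)"
proof -
  interpret I: ideal I A by (rule ideal_I)
  have one: "\<one>\<^bsub>A\<^esub> = to_cox (chi (0, 0))"
    unfolding A_simps to_cox_chi theta_zero by (simp flip: zero_prod_def)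
  have "coset_value \<in> ring_hom (invariant_quotient \<sigma>' R) (B_ring \<sigma>' \<tau>' R)"
  proof (rule ring_hom_memI)
    fix X assume "X \<in> carrier (invariant_quotient \<sigma>' R)"
    then obtain p where p: "D_supported p" "X = I +>\<^bsub>A\<^esub> to_cox p"
      unfolding invariant_quotient_carrier by blast
    show "coset_value X \<in> carrier (B_ring \<sigma>' \<tau>' R)"
      unfolding p(2) coset_value_coset B_ring_simps B_carrier_eq using p(1) by blast
    fix Y assume "Y \<in> carrier (invariant_quotient \<sigma>' R)"
    then obtain q where q: "D_supported q" "Y = I +>\<^bsub>A\<^esub> to_cox q"
      unfolding invariant_quotient_carrier by blast
    have "X \<otimes>\<^bsub>invariant_quotient \<sigma>' R\<^esub> Y = I +>\<^bsub>A\<^esub> to_cox (p * q)"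
      unfolding invariant_quotient_simps p(2) q(2) to_cox_mult
        I.rcoset_mult_add[OF keys_to_cox[OF p(1)] keys_to_cox[OF q(1)]] A_simps ..
    then show "coset_value (X \<otimes>\<^bsub>invariant_quotient \<sigma>' R\<^esub> Y) = coset_value X \<otimes>\<^bsub>B_ring \<sigma>' \<tau>' R\<^esub> coset_value Y"
      by (simp only: coset_value_coset p(2) q(2) B_ring_simps linear_extension_mult[OF lambda_value_add])
    have "X \<oplus>\<^bsub>invariant_quotient \<sigma>' R\<^esub> Y = I +>\<^bsub>A\<^esub> to_cox (p + q)"
      unfolding invariant_quotient_simps p(2) q(2) to_cox_add
        I.a_rcos_sum[OF keys_to_cox[OF p(1)] keys_to_cox[OF q(1)]] A_simps ..
    then show "coset_value (X \<oplus>\<^bsub>invariant_quotient \<sigma>' R\<^esub> Y) = coset_value X \<oplus>\<^bsub>B_ring \<sigma>' \<tau>' R\<^esub> coset_value Y"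
      by (simp only: coset_value_coset p(2) q(2) B_ring_simps linear_extension_add)
  next
    show "coset_value \<one>\<^bsub>invariant_quotient \<sigma>' R\<^esub> = \<one>\<^bsub>B_ring \<sigma>' \<tau>' R\<^esub>"
      unfolding invariant_quotient_simps one coset_value_coset B_ring_simps by (simp add: lambda_value_zero)
  qed
  moreover have "bij_betw coset_value (carrier (invariant_quotient \<sigma>' R)) (carrier (B_ring \<sigma>' \<tau>' R))"
    unfolding bij_betw_def
  proof
    show "inj_on coset_value (carrier (invariant_quotient \<sigma>' R))"
    proof (rule inj_onI)
      fix X Y assume "X \<in> carrier (invariant_quotient \<sigma>' R)" "Y \<in> carrier (invariant_quotient \<sigma>' R)"
        and eq: "coset_value X = coset_value Y"
      then obtain p q where p: "D_supported p" "X = I +>\<^bsub>A\<^esub> to_cox p"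
        and q: "D_supported q" "Y = I +>\<^bsub>A\<^esub> to_cox q"
        unfolding invariant_quotient_carrier by blast
      have "evaluate (p - q) = 0" using eq unfolding p(2) q(2) coset_value_coset by (simp add: linear_extension_diff)
      then have "to_cox (p - q) \<in> I" by (rule evaluate_kernel[OF keys_diff_closed[OF p(1) q(1)]])
      then show "X = Y" unfolding p(2) q(2) coset_eq_iff to_cox_diff .
    qed
    have "carrier (invariant_quotient \<sigma>' R) = (\<lambda>q. I +>\<^bsub>A\<^esub> to_cox q) ` {q. D_supported q}"
      unfolding invariant_quotient_carrier by blast
    then show "coset_value ` carrier (invariant_quotient \<sigma>' R) = carrier (B_ring \<sigma>' \<tau>' R)"
      unfolding B_ring_simps B_carrier_eq by (simp only: image_image coset_value_coset)
  qed
  ultimately show ?thesis unfolding ring_iso_def by blast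
qed

lemma coset_value_cox_hom: "coset_value (I +>\<^bsub>A\<^esub> cox_hom \<sigma>' p) = p"
  unfolding to_cox_constant_lambda[symmetric] coset_value_coset by (rule evaluate_constant_lambda)

lemma coset_value_lambda_var: "coset_value (I +>\<^bsub>A\<^esub> lambda_var i) = B_generator R i"
proof -
  have eq: "lambda_var i = to_cox (chi (0, Poly_Mapping.single i 1))"
    unfolding to_cox_chi theta_zero by (simp add: lambda_var_def)
  show ?thesis
    unfolding eq coset_value_coset linear_extension_single lambda_value_single by simp
qed

end

theorem proposition2p13:
  fixes \<sigma> \<tau> :: "(real ^ 'n) set"
    and R :: "int ^ 'n"
    and Q :: "'k::finite option \<Rightarrow> (real ^ 'n) set"
    and \<sigma>' \<tau>' :: "('n, 'k) latR set"
  assumes "rational_polyhedral_cone \<sigma>"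
    and "strongly_convex \<sigma>"
    and "dim \<sigma> = CARD('n)"
    and "minkowski_decomposition (slice \<sigma> R) Q"
    and "\<And>j. recession_cone (Q j) = \<sigma> \<inter> {n. real_vec R \<bullet> n = 0}"
    and "at_most_one_nonlattice_vertex (slice \<sigma> R) Q"
    and "Q None \<subseteq> {n. real_vec R \<bullet> n = 1}"
    and "\<And>i. Q (Some i) \<subseteq> {n. real_vec R \<bullet> n = 0}"
    and "\<sigma>' = cayley_cone \<sigma> Q"
    and "\<tau> = \<sigma> \<inter> {n. real_vec R \<bullet> n \<ge> 0}"
    and "\<tau>' = cayley_cone \<tau> Q"
  shows "carrier (B_ring \<sigma>' \<tau>' R) \<subseteq> carrier (semigroup_ring (dual_lattice_points \<tau>')) \<and>
    (\<exists>\<phi> \<in> ring_iso (invariant_quotient \<sigma>' R) (B_ring \<sigma>' \<tau>' R).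
       (\<forall>p \<in> carrier (semigroup_ring (dual_lattice_points \<sigma>')).
          \<phi> (I_lambda \<sigma>' R +>\<^bsub>cox_ring \<sigma>'\<^esub> cox_hom \<sigma>' p) = p) \<and>
       (\<forall>i. \<phi> (I_lambda \<sigma>' R +>\<^bsub>cox_ring \<sigma>'\<^esub> lambda_var i) = B_generator R i))"
proof -
  obtain S :: "(int ^ 'n) set" where S: "finite S" "\<sigma> = convex_cone hull (real_vec ` S)"
    using assms(1) unfolding rational_polyhedral_cone_def by blast
  interpret cayley_data S \<sigma> R Q
    by unfold_locales (fact S assms)+
  show ?thesis
    unfolding assms(9-11)
  proof (intro conjI bexI[of _ coset_value] ballI allI)
    show "carrier (B_ring (cayley_cone \<sigma> Q) (cayley_cone (\<sigma> \<inter> {n. real_vec R \<bullet> n \<ge> 0}) Q) R)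
        \<subseteq> carrier (semigroup_ring (dual_lattice_points (cayley_cone (\<sigma> \<inter> {n. real_vec R \<bullet> n \<ge> 0}) Q)))"
      using B_carrier_subset unfolding B_ring_simps BT_def .
  qed (rule coset_value_cox_hom coset_value_lambda_var coset_value_ring_iso)+
qed

end
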